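(* Let $k$ be a field of characteristic zero, let $G$ be a commutative Lie algebra of dimension $r$ over $k$, and let $V$ be a faithful split semisimple finite-dimensional representation of $G$ over $k$. Choose coordinates $x_1,\dots,x_n$ on $V$ and elements (roots) $\alpha_1,\dots,\alpha_n$ of the dual space $\widehat{G}$ of $G$ such that $s x_i=\alpha_i(s)x_i$ for all $s\in G$ and all $i$. Consider the singular foliation on $V$ determined by $G$, and view $V$ as a toric variety such that the monomials in the $x_i$ are the characters of the torus which are well defined on all of $V$. Then it is possible to resolve the foliation on $V$ torically if and only if the underlying set of nonzero roots (that is, the set $\{\alpha_1,\dots,\alpha_n\}\setminus\{0\}$, counted without multiplicities) forms a basis of the dual $\widehat{G}$.
   Context: $V$ is regarded as affine $n$-space with coordinate ring $k[x_1,\dots,x_n]$ and function field $k(V)=k(x_1,\dots,x_n)$. Each $s\in G$ acts as the derivation $\sum_i\alpha_i(s)x_i\,\partial/\partial x_i$ of $k(V)$. The singular foliation determined by $G$ is the $k(V)$-linear span $\mathcal{L}\subset\mathrm{Der}_k(k(V),k(V))$ of these derivations; it has dimension $\dim_{k(V)}\mathcal{L}=r$. For a variety $V'$ with a birational map to $V$, the lifted foliation on $V'$ is given by the same $\mathcal{L}$ under $k(V')=k(V)$. Let $\Omega_{\mathcal{L}}$ be the image of $\Omega_{V'/k}\to\mathrm{Hom}_{k(V)}(\mathcal{L},k(V))$, $dx\mapsto(\delta\mapsto\delta(x))$. The foliation on $V'$ is nonsingular if $\Omega_{\mathcal{L}}$ is locally free (of rank $r$). The foliation on $V$ is resolved torically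 if there is a toric variety $V'$ (for the same torus) and a locally projective birational toric morphism $V'\to V$ such that the lifted foliation on $V'$ is nonsingular. *)

theory Defs
  imports Complex_Main "HOL-Library.Function_Algebras" "HOL-Computational_Algebra.Polynomial"
begin

section \<open>Commutative Lie algebras and their representations\<close>

definition lie_algebra ::
    "('k::field \<Rightarrow> 'g::ab_group_add \<Rightarrow> 'g) \<Rightarrow> ('g \<Rightarrow> 'g \<Rightarrow> 'g) \<Rightarrow> bool" where
  "lie_algebra scale br \<longleftrightarrow>
     vector_space scale \<and>
     (\<forall>s. Vector_Spaces.linear scale scale (\<lambda>t. br s t)) \<and>
     (\<forall>t. Vector_Spaces.linear scale scale (\<lambda>s. br s t)) \<and>
     (\<forall>s. br s s = 0) \<and>
     (\<forall>s t u. br s (br t u) + br t (br u s) + br u (br s t) = 0)"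

definition commutative_lie_algebra ::
    "('k::field \<Rightarrow> 'g::ab_group_add \<Rightarrow> 'g) \<Rightarrow> ('g \<Rightarrow> 'g \<Rightarrow> 'g) \<Rightarrow> bool" where
  "commutative_lie_algebra scale br \<longleftrightarrow> lie_algebra scale br \<and> (\<forall>s t. br s t = 0)"

definition lie_representation ::
    "('k::field \<Rightarrow> 'g::ab_group_add \<Rightarrow> 'g) \<Rightarrow> ('g \<Rightarrow> 'g \<Rightarrow> 'g) \<Rightarrow>
     ('k \<Rightarrow> 'v::ab_group_add \<Rightarrow> 'v) \<Rightarrow> ('g \<Rightarrow> 'v \<Rightarrow> 'v) \<Rightarrow> bool" where
  "lie_representation scaleG br scaleV \<rho> \<longleftrightarrow>
     (\<forall>s. Vector_Spaces.linear scaleV scaleV (\<rho> s)) \<and>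
     (\<forall>v. Vector_Spaces.linear scaleG scaleV (\<lambda>s. \<rho> s v)) \<and>
     (\<forall>s t v. \<rho> (br s t) v = \<rho> s (\<rho> t v) - \<rho> t (\<rho> s v))"

definition faithful :: "('g \<Rightarrow> 'v \<Rightarrow> 'v) \<Rightarrow> bool" where
  "faithful \<rho> \<longleftrightarrow> inj \<rho>"

text \<open>Split semisimple: the representation is a direct sum of one-dimensional
  subrepresentations, spanned by the elements of the basis \<open>B\<close>.\<close>

definition split_semisimple ::
    "('k::field \<Rightarrow> 'v::ab_group_add \<Rightarrow> 'v) \<Rightarrow> ('g \<Rightarrow> 'v \<Rightarrow> 'v) \<Rightarrow> bool" where
  "split_semisimple scaleV \<rho> \<longleftrightarrow>
     (\<exists>B. \<not> module.dependent scaleV B \<and> module.span scaleV B = UNIV \<and>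
          (\<forall>b\<in>B. \<forall>s. \<exists>c. \<rho> s b = scaleV c b))"

definition dual_space ::
    "('k::field \<Rightarrow> 'v::ab_group_add \<Rightarrow> 'v) \<Rightarrow> ('v \<Rightarrow> 'k) set" where
  "dual_space scale = {f. Vector_Spaces.linear scale (*) f}"

definition linear_coordinates ::
    "('k::field \<Rightarrow> 'v::ab_group_add \<Rightarrow> 'v) \<Rightarrow> nat \<Rightarrow> (nat \<Rightarrow> 'v \<Rightarrow> 'k) \<Rightarrow> bool" where
  "linear_coordinates scale n \<xi> \<longleftrightarrow>
     (\<forall>i<n. \<xi> i \<in> dual_space scale) \<and> (\<forall>c. \<exists>!v. \<forall>i<n. \<xi> i v = c i)"

definition is_basis_of ::
    "('k::field \<Rightarrow> 'a::ab_group_add \<Rightarrow> 'a) \<Rightarrow> 'a set \<Rightarrow> 'a set \<Rightarrow> bool" where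
  "is_basis_of scale B W \<longleftrightarrow> \<not> module.dependent scale B \<and> module.span scale B = W"


section \<open>Function fields\<close>

text \<open>\<open>k\<close> and \<open>K\<close> are types, and \<open>K\<close> is a \<open>k\<close>-algebra by means of \<open>emb\<close>.  Exponents of
  monomials in \<open>x 0, \<dots>, x (n - 1)\<close> are functions on \<^typ>\<open>nat\<close> that vanish outside \<open>{..<n}\<close>.\<close>

definition field_embedding :: "('k::field \<Rightarrow> 'K::field) \<Rightarrow> bool" where
  "field_embedding emb \<longleftrightarrow>
     emb 1 = 1 \<and> (\<forall>a b. emb (a + b) = emb a + emb b) \<and> (\<forall>a b. emb (a * b) = emb a * emb b)"

definition algebraically_independent ::
    "('k::field \<Rightarrow> 'K::field) \<Rightarrow> nat \<Rightarrow> (nat \<Rightarrow> 'K) \<Rightarrow> bool" where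
  "algebraically_independent emb n x \<longleftrightarrow>
     (\<forall>E c. finite E \<and> E \<subseteq> {e :: nat \<Rightarrow> nat. \<forall>i\<ge>n. e i = 0} \<and>
        (\<Sum>e\<in>E. emb (c e) * (\<Prod>i<n. x i ^ e i)) = 0 \<longrightarrow> (\<forall>e\<in>E. c e = 0))"

definition k_subalgebra :: "('k::field \<Rightarrow> 'K::field) \<Rightarrow> 'K set \<Rightarrow> bool" where
  "k_subalgebra emb A \<longleftrightarrow>
     range emb \<subseteq> A \<and> (\<forall>a\<in>A. \<forall>b\<in>A. a + b \<in> A) \<and> (\<forall>a\<in>A. \<forall>b\<in>A. a * b \<in> A)"

definition has_fraction_field_UNIV :: "'K::field set \<Rightarrow> bool" where
  "has_fraction_field_UNIV A \<longleftrightarrow> (\<forall>z. \<exists>a\<in>A. \<exists>b\<in>A. b \<noteq> 0 \<and> z = a / b)"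

definition affine_coordinate_ring ::
    "('k::field \<Rightarrow> 'K::field) \<Rightarrow> nat \<Rightarrow> (nat \<Rightarrow> 'K) \<Rightarrow> 'K set" where
  "affine_coordinate_ring emb n x = k_subalgebra emb hull (x ` {..<n})"

text \<open>\<open>K = k(x\<^sub>1, \<dots>, x\<^sub>n)\<close> is the field of rational functions in the variables \<open>x\<close>.\<close>

definition rational_function_field ::
    "('k::field \<Rightarrow> 'K::field) \<Rightarrow> nat \<Rightarrow> (nat \<Rightarrow> 'K) \<Rightarrow> bool" where
  "rational_function_field emb n x \<longleftrightarrow>
     field_embedding emb \<and> algebraically_independent emb n x \<and>
     has_fraction_field_UNIV (affine_coordinate_ring emb n x)"


section \<open>Varieties with a given function field\<close>

text \<open>
  A variety with function field \<open>K\<close> is identified with the set of its local rings, which are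
  subrings of \<open>K\<close> (the points of the scheme correspond bijectively to their local rings).
  A birational map between two such varieties that induces the identity on \<open>K\<close> is then a
  morphism iff every local ring of the source dominates one of the target.
\<close>

definition prime_ideal_of :: "'K::field set \<Rightarrow> 'K set \<Rightarrow> bool" where
  "prime_ideal_of A P \<longleftrightarrow>
     P \<subseteq> A \<and> 0 \<in> P \<and> 1 \<notin> P \<and>
     (\<forall>a\<in>P. \<forall>b\<in>P. a + b \<in> P) \<and> (\<forall>a\<in>A. \<forall>b\<in>P. a * b \<in> P) \<and>
     (\<forall>a\<in>A. \<forall>b\<in>A. a * b \<in> P \<longrightarrow> a \<in> P \<or> b \<in> P)"

definition localization_at :: "'K::field set \<Rightarrow> 'K set \<Rightarrow> 'K set" where
  "localization_at A P = {a / b | a b. a \<in> A \<and> b \<in> A - P}"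

text \<open>The affine scheme \<open>Spec A\<close>.\<close>

definition local_rings :: "'K::field set \<Rightarrow> 'K set set" where
  "local_rings A = localization_at A ` {P. prime_ideal_of A P}"

definition local_subring :: "'K::field set \<Rightarrow> bool" where
  "local_subring R \<longleftrightarrow>
     1 \<in> R \<and> (\<forall>a\<in>R. \<forall>b\<in>R. a - b \<in> R) \<and> (\<forall>a\<in>R. \<forall>b\<in>R. a * b \<in> R) \<and>
     (let m = {a \<in> R. a = 0 \<or> inverse a \<notin> R} in \<forall>a\<in>m. \<forall>b\<in>m. a + b \<in> m)"

text \<open>For local rings: \<open>Q \<subseteq> R\<close> and the maximal ideal of \<open>Q\<close> lies in that of \<open>R\<close>.\<close>

definition dominates :: "'K::field set \<Rightarrow> 'K set \<Rightarrow> bool" where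
  "dominates R Q \<longleftrightarrow> Q \<subseteq> R \<and> (\<forall>a\<in>Q. inverse a \<in> R \<longrightarrow> inverse a \<in> Q)"

text \<open>The sets \<open>{R \<in> X. F \<subseteq> R}\<close> with \<open>F\<close> finite, on which finitely many rational functions
  are regular, form a basis of the Zariski topology.\<close>

definition zariski_open :: "'K::field set set \<Rightarrow> 'K set set \<Rightarrow> bool" where
  "zariski_open X U \<longleftrightarrow>
     U \<subseteq> X \<and> (\<forall>R\<in>U. \<exists>F. finite F \<and> F \<subseteq> R \<and> {R'\<in>X. F \<subseteq> R'} \<subseteq> U)"

definition affine_model :: "('k::field \<Rightarrow> 'K::field) \<Rightarrow> 'K set \<Rightarrow> bool" where
  "affine_model emb A \<longleftrightarrow>
     (\<exists>F. finite F \<and> A = k_subalgebra emb hull F) \<and> has_fraction_field_UNIV A"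

text \<open>Chevalley's criterion: an integral scheme is separated iff no two distinct local rings
  are dominated by the same local ring of the function field.\<close>

definition separated :: "'K::field set set \<Rightarrow> bool" where
  "separated X \<longleftrightarrow>
     (\<forall>R\<in>X. \<forall>R'\<in>X. (\<exists>S. local_subring S \<and> dominates S R \<and> dominates S R') \<longrightarrow> R = R')"

definition variety_covered_by ::
    "('k::field \<Rightarrow> 'K::field) \<Rightarrow> 'K set set \<Rightarrow> 'K set set \<Rightarrow> bool" where
  "variety_covered_by emb \<A> X \<longleftrightarrow>
     finite \<A> \<and> \<A> \<noteq> {} \<and> (\<forall>A\<in>\<A>. affine_model emb A) \<and>
     X = (\<Union>A\<in>\<A>. local_rings A) \<and> separated X"

definition integrally_closed :: "'K::field set \<Rightarrow> bool" where
  "integrally_closed R \<longleftrightarrow>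
     (\<forall>z p. (\<forall>i. coeff p i \<in> R) \<and> lead_coeff p = 1 \<and> poly p z = 0 \<longrightarrow> z \<in> R)"

definition normal_variety :: "'K::field set set \<Rightarrow> bool" where
  "normal_variety X \<longleftrightarrow> (\<forall>R\<in>X. integrally_closed R)"

definition birational_morphism :: "'K::field set set \<Rightarrow> 'K set set \<Rightarrow> bool" where
  "birational_morphism X Y \<longleftrightarrow> (\<forall>R\<in>X. \<exists>Q\<in>Y. dominates R Q)"

text \<open>The closure in \<open>\<P>\<^sup>N\<close> over \<open>Spec B\<close> of the \<open>K\<close>-valued point whose homogeneous
  coordinates are the elements of \<open>F\<close>.  Up to isomorphism, these are the integral schemes that
  are projective and birational over \<open>Spec B\<close>: homogeneous coordinates that vanish
  at the generic point can be dropped.\<close>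

definition projective_model ::
    "('k::field \<Rightarrow> 'K::field) \<Rightarrow> 'K set \<Rightarrow> 'K set \<Rightarrow> 'K set set" where
  "projective_model emb B F =
     (\<Union>f\<in>F. local_rings (k_subalgebra emb hull (B \<union> (\<lambda>g. g / f) ` F)))"

definition locally_projective ::
    "('k::field \<Rightarrow> 'K::field) \<Rightarrow> 'K set set \<Rightarrow> 'K set set \<Rightarrow> bool" where
  "locally_projective emb X Y \<longleftrightarrow>
     birational_morphism X Y \<and>
     (\<forall>Q\<in>Y. \<exists>B. affine_model emb B \<and> Q \<in> local_rings B \<and> zariski_open Y (local_rings B) \<and>
        (\<exists>F. finite F \<and> F \<noteq> {} \<and> 0 \<notin> F \<and>
           {R\<in>X. \<exists>Q'\<in>local_rings B. dominates R Q'} = projective_model emb B F))"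


section \<open>Toric varieties\<close>

text \<open>The torus with coordinate ring \<open>k[x\<^sub>1\<^sup>\<plusminus>\<^sup>1, \<dots>, x\<^sub>n\<^sup>\<plusminus>\<^sup>1]\<close>; its characters are the
  Laurent monomials.\<close>

definition torus_coordinate_ring ::
    "('k::field \<Rightarrow> 'K::field) \<Rightarrow> nat \<Rightarrow> (nat \<Rightarrow> 'K) \<Rightarrow> 'K set" where
  "torus_coordinate_ring emb n x =
     k_subalgebra emb hull (x ` {..<n} \<union> (\<lambda>i. inverse (x i)) ` {..<n})"

definition characters :: "nat \<Rightarrow> (nat \<Rightarrow> 'K::field) \<Rightarrow> 'K set" where
  "characters n x = range (\<lambda>m :: nat \<Rightarrow> int. \<Prod>i<n. x i powi m i)"

text \<open>An algebraic action of the torus on \<open>Spec A\<close> that extends multiplication on the torus is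
  the same as a decomposition of \<open>A\<close> into weight spaces, and in \<open>K\<close> these are spanned by characters.\<close>

definition torus_stable ::
    "('k::field \<Rightarrow> 'K::field) \<Rightarrow> nat \<Rightarrow> (nat \<Rightarrow> 'K) \<Rightarrow> 'K set \<Rightarrow> bool" where
  "torus_stable emb n x A \<longleftrightarrow> A = module.span (\<lambda>c z. emb c * z) (A \<inter> characters n x)"

text \<open>Toric varieties are normal and contain the torus as an open subvariety, and the
  torus acts on them.  The action is expressed on a cover by torus-stable affine open sets, which
  exists for every algebraic action of a torus on a normal variety (Sumihiro).\<close>

definition toric_variety ::
    "('k::field \<Rightarrow> 'K::field) \<Rightarrow> nat \<Rightarrow> (nat \<Rightarrow> 'K) \<Rightarrow> 'K set set \<Rightarrow> bool" where
  "toric_variety emb n x X \<longleftrightarrow>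
     (\<exists>\<A>. variety_covered_by emb \<A> X \<and> (\<forall>A\<in>\<A>. torus_stable emb n x A)) \<and>
     normal_variety X \<and>
     zariski_open X (local_rings (torus_coordinate_ring emb n x))"

definition affine_space ::
    "('k::field \<Rightarrow> 'K::field) \<Rightarrow> nat \<Rightarrow> (nat \<Rightarrow> 'K) \<Rightarrow> 'K set set" where
  "affine_space emb n x = local_rings (affine_coordinate_ring emb n x)"


section \<open>Foliations\<close>

definition k_derivation :: "('k::field \<Rightarrow> 'K::field) \<Rightarrow> ('K \<Rightarrow> 'K) \<Rightarrow> bool" where
  "k_derivation emb \<delta> \<longleftrightarrow>
     (\<forall>a b. \<delta> (a + b) = \<delta> a + \<delta> b) \<and> (\<forall>a b. \<delta> (a * b) = a * \<delta> b + b * \<delta> a) \<and>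
     (\<forall>c. \<delta> (emb c) = 0)"

text \<open>A derivation of \<open>k(x\<^sub>1, \<dots>, x\<^sub>n)\<close> is determined by its values on the \<open>x\<^sub>i\<close>, so this is
  the derivation \<open>\<Sum>\<^sub>i \<alpha>\<^sub>i(s) x\<^sub>i \<partial>/\<partial>x\<^sub>i\<close>.\<close>

definition acts_as_derivation ::
    "('k::field \<Rightarrow> 'K::field) \<Rightarrow> nat \<Rightarrow> (nat \<Rightarrow> 'K) \<Rightarrow> (nat \<Rightarrow> 'g \<Rightarrow> 'k) \<Rightarrow>
     'g \<Rightarrow> ('K \<Rightarrow> 'K) \<Rightarrow> bool" where
  "acts_as_derivation emb n x \<alpha> s \<delta> \<longleftrightarrow>
     k_derivation emb \<delta> \<and> (\<forall>i<n. \<delta> (x i) = emb (\<alpha> i s) * x i)"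

definition foliation ::
    "('k::field \<Rightarrow> 'K::field) \<Rightarrow> nat \<Rightarrow> (nat \<Rightarrow> 'K) \<Rightarrow> (nat \<Rightarrow> 'g \<Rightarrow> 'k) \<Rightarrow> ('K \<Rightarrow> 'K) set" where
  "foliation emb n x \<alpha> =
     module.span (\<lambda>f \<delta> z. f * \<delta> z) {\<delta>. \<exists>s. acts_as_derivation emb n x \<alpha> s \<delta>}"

text \<open>The image of \<open>da\<close> in \<open>Hom\<^sub>K(L, K)\<close>; such functionals are encoded as functions on all of
  \<open>K \<Rightarrow> K\<close> that vanish outside \<open>L\<close>.\<close>

definition differential ::
    "('K::field \<Rightarrow> 'K) set \<Rightarrow> 'K \<Rightarrow> ('K \<Rightarrow> 'K) \<Rightarrow> 'K" where
  "differential L a = (\<lambda>\<delta>. if \<delta> \<in> L then \<delta> a else 0)"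

text \<open>The stalk of \<open>\<Omega>\<^sub>L\<close> at the point with local ring \<open>R\<close>: the \<open>R\<close>-module generated by the
  images of \<open>da\<close>, \<open>a \<in> R\<close>.\<close>

definition omega_stalk ::
    "('K::field \<Rightarrow> 'K) set \<Rightarrow> 'K set \<Rightarrow> (('K \<Rightarrow> 'K) \<Rightarrow> 'K) set" where
  "omega_stalk L R =
     {(\<lambda>\<delta>. \<Sum>a\<in>S. c a * differential L a \<delta>) | S c. finite S \<and> S \<subseteq> R \<and> c ` S \<subseteq> R}"

definition is_free_basis ::
    "'K::field set \<Rightarrow> ('d \<Rightarrow> 'K) set \<Rightarrow> nat \<Rightarrow> (nat \<Rightarrow> 'd \<Rightarrow> 'K) \<Rightarrow> bool" where
  "is_free_basis R M r w \<longleftrightarrow>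
     (\<forall>j<r. w j \<in> M) \<and>
     (\<forall>\<eta>\<in>M. \<exists>c. (\<forall>j<r. c j \<in> R) \<and> \<eta> = (\<lambda>\<delta>. \<Sum>j<r. c j * w j \<delta>)) \<and>
     (\<forall>c. (\<forall>j<r. c j \<in> R) \<and> (\<forall>\<delta>. (\<Sum>j<r. c j * w j \<delta>) = 0) \<longrightarrow> (\<forall>j<r. c j = 0))"

text \<open>\<open>\<Omega>\<^sub>L\<close> is locally free of rank \<open>r\<close>.  It is a subsheaf of a constant sheaf, so a section
  over \<open>U\<close> is an element of all the stalks at points of \<open>U\<close>.\<close>

definition nonsingular_foliation ::
    "('K::field \<Rightarrow> 'K) set \<Rightarrow> nat \<Rightarrow> 'K set set \<Rightarrow> bool" where
  "nonsingular_foliation L r X \<longleftrightarrow>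
     (\<forall>R\<in>X. \<exists>U w. zariski_open X U \<and> R \<in> U \<and>
        (\<forall>R'\<in>U. is_free_basis R' (omega_stalk L R') r w))"

definition torically_resolvable ::
    "('k::field \<Rightarrow> 'K::field) \<Rightarrow> nat \<Rightarrow> (nat \<Rightarrow> 'K) \<Rightarrow> ('K \<Rightarrow> 'K) set \<Rightarrow> nat \<Rightarrow> bool" where
  "torically_resolvable emb n x L r \<longleftrightarrow>
     (\<exists>X. toric_variety emb n x X \<and>
          locally_projective emb X (affine_space emb n x) \<and>
          nonsingular_foliation L r X)"

end

theory Submission
  imports Defs "HOL-Library.FuncSet"
begin

text \<open>
  On a toric variety \<open>\<Omega>\<^sub>L\<close> is generated by the logarithmic differentials \<open>mon a \<otimes> \<alpha>(a)\<close>, where \<open>a\<close> is the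
  exponent of a regular monomial and \<open>\<alpha>(a) = \<Sum>\<^sub>i a\<^sub>i \<alpha>\<^sub>i\<close>.  At the center of a monomial valuation, given
  by a total order on the exponents, some of these generators form a basis, with exponents
  \<open>a\<^sub>1, \<dots>, a\<^sub>r\<close>.  Then \<open>a - a\<^sub>j\<close> is again regular for every regular \<open>a\<close> for which \<open>\<alpha>(a)\<close> has a nonzero
  \<open>j\<close>-th coordinate with respect to \<open>\<alpha>(a\<^sub>1), \<dots>, \<alpha>(a\<^sub>r)\<close>, so all these coordinates are natural numbers.
  If \<open>\<alpha>\<^sub>i\<close> does not lie in the span of \<open>\<alpha>\<^sub>l\<close>, \<open>l \<in> I\<close>, and the order makes \<open>x\<^sub>l\<close>, \<open>l \<in> I\<close>, infinitely smaller
  than \<open>x\<^sub>i\<close> and \<open>x\<^sub>i\<close> infinitely smaller than the other variables, one of these coordinates vanishes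
  on \<open>\<alpha>\<^sub>l\<close>, \<open>l \<in> I\<close>, is \<open>1\<close> on \<open>\<alpha>\<^sub>i\<close>, and is a natural number on all roots.  Applied to a minimal dependent
  set of roots, this makes all quotients of coefficients negative integers, which is impossible for
  three elements, while for two it forces the roots to coincide.

  Conversely, if the distinct nonzero roots \<open>\<beta>\<^sub>1, \<dots>, \<beta>\<^sub>r\<close> form a basis then \<open>\<Omega>\<^sub>L = \<Oplus>\<^sub>j I\<^sub>j \<otimes> \<beta>\<^sub>j\<close>, where the
  ideal \<open>I\<^sub>j\<close> is generated by the \<open>x\<^sub>i\<close> with \<open>\<alpha>\<^sub>i = \<beta>\<^sub>j\<close>, and blowing up the product of the \<open>I\<^sub>j\<close> resolves
  the foliation.
\<close>

section \<open>Subalgebras and local rings of a field\<close>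

text \<open>Since \<open>mon a\<close> has the constant logarithmic differential
  \<open>\<alpha>(a)\<close>, expanding d(mon a) in the basis formed by the differentials of the
  \<open>mon a\<^sub>j\<close> forces the coefficients to be
  \<open>\<lambda>\<^sub>j * mon (a - a\<^sub>j)\<close>, where \<open>\<lambda>\<^sub>j\<close> are
  the coordinates of \<open>\<alpha>(a)\<close>; hence \<open>a - a\<^sub>j\<close> is regular as
  soon as \<open>\<lambda>\<^sub>j\<close> is nonzero. Subtracting \<open>a\<^sub>j\<close>
  repeatedly lowers \<open>\<lambda>\<^sub>j\<close> by one each time and can stop only when it
  reaches zero. That it must stop is the obstacle: the orders are not archimedean, so endless
  subtraction may be compatible with them. But the exponents of a chart are finitely generated, so
  the order can be replaced by a real weight that is still positive on the nonzero ones. The order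
  itself remains indispensable, because comparing infinitely small values is what makes a coordinate
  vanish or equal \<open>1\<close>. The center exists because a resolution is locally projective.
  The contradiction for three roots is one of sign and so rests on characteristic zero.\<close>

locale embedded_field =
  fixes emb :: "'k::field \<Rightarrow> 'K::field"
  assumes emb: "field_embedding emb"
begin

lemma emb_1 [simp]: "emb 1 = 1"
  and emb_add: "emb (a + b) = emb a + emb b"
  and emb_mult: "emb (a * b) = emb a * emb b"
  using emb by (auto simp: field_embedding_def)

lemma emb_0 [simp]: "emb 0 = 0"
  using emb_add[of 0 0] by (metis add_cancel_right_right add_0)

lemma emb_minus: "emb (- a) = - emb a"
  using emb_add[of a "- a"] by (simp add: eq_neg_iff_add_eq_0 add.commute)

lemma emb_diff: "emb (a - b) = emb a - emb b"
  using emb_add[of a "- b"] by (simp add: emb_minus)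

lemma emb_eq_0_iff [simp]: "emb a = 0 \<longleftrightarrow> a = 0"
proof
  assume "emb a = 0"
  then have "emb (a * inverse a) = 0" by (simp add: emb_mult)
  then show "a = 0" by (cases "a = 0") auto
qed simp

lemma emb_inverse: "emb (inverse a) = inverse (emb a)"
proof (cases "a = 0")
  case False
  then have "emb a * emb (inverse a) = 1" by (simp flip: emb_mult)
  then show ?thesis by (metis inverse_unique)
qed simp

lemma emb_eq_iff [simp]: "emb a = emb b \<longleftrightarrow> a = b"
  using emb_eq_0_iff[of "a - b"] by (simp add: emb_diff del: emb_eq_0_iff)

lemma emb_sum: "emb (sum f A) = (\<Sum>a\<in>A. emb (f a))"
  by (induct A rule: infinite_finite_induct) (simp_all add: emb_add)

lemma emb_of_nat: "emb (of_nat m) = of_nat m"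
  by (induct m) (simp_all add: emb_add)

sublocale kv: vector_space "\<lambda>c z. emb c * z"
  by unfold_locales (simp_all add: algebra_simps emb_add emb_mult)

declare kv.scale_scale [simp del]

lemma k_subalgebraD:
  assumes "k_subalgebra emb A"
  shows "emb c \<in> A" "0 \<in> A" "1 \<in> A"
    "a \<in> A \<Longrightarrow> b \<in> A \<Longrightarrow> a + b \<in> A"
    "a \<in> A \<Longrightarrow> b \<in> A \<Longrightarrow> a * b \<in> A"
    "a \<in> A \<Longrightarrow> - a \<in> A"
    "a \<in> A \<Longrightarrow> b \<in> A \<Longrightarrow> a - b \<in> A"
    "a \<in> A \<Longrightarrow> a ^ m \<in> A"
proof -
  have e: "emb c \<in> A" for c using assms by (auto simp: k_subalgebra_def)
  have m: "a * b \<in> A" if "a \<in> A" "b \<in> A" for a b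
    using that assms by (auto simp: k_subalgebra_def)
  have p: "a + b \<in> A" if "a \<in> A" "b \<in> A" for a b
    using that assms by (auto simp: k_subalgebra_def)
  have n: "- a \<in> A" if "a \<in> A" for a
    using m[OF e[of "- 1"] that] by (simp add: emb_minus)
  show "emb c \<in> A" "0 \<in> A" "1 \<in> A" using e[of c] e[of 0] e[of 1] by auto
  show "a \<in> A \<Longrightarrow> b \<in> A \<Longrightarrow> a + b \<in> A" "a \<in> A \<Longrightarrow> b \<in> A \<Longrightarrow> a * b \<in> A"
    "a \<in> A \<Longrightarrow> - a \<in> A"
    by (fact p m n)+
  show "a \<in> A \<Longrightarrow> b \<in> A \<Longrightarrow> a - b \<in> A"
    using p[of a "- b"] n[of b] by simp
  show "a \<in> A \<Longrightarrow> a ^ m \<in> A"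
    using e[of 1] by (induct m) (auto intro: m)
qed

lemma k_subalgebra_sum:
  assumes "k_subalgebra emb A" "\<And>i. i \<in> I \<Longrightarrow> f i \<in> A"
  shows "sum f I \<in> A"
  using assms(2) by (induct I rule: infinite_finite_induct) (auto intro: k_subalgebraD[OF assms(1)])

lemma k_subalgebra_prod:
  assumes "k_subalgebra emb A" "\<And>i. i \<in> I \<Longrightarrow> f i \<in> A"
  shows "prod f I \<in> A"
  using assms(2) by (induct I rule: infinite_finite_induct) (auto intro: k_subalgebraD[OF assms(1)])

lemma k_subalgebra_hull [simp]: "k_subalgebra emb (k_subalgebra emb hull F)"
  by (rule hull_in) (fastforce simp: k_subalgebra_def)

lemma k_subalgebra_subspace:
  assumes "k_subalgebra emb A"
  shows "kv.subspace A"
  by (rule kv.subspaceI) (use k_subalgebraD[OF assms] in auto)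

text \<open>For a local ring this is the maximal ideal. Zero is listed separately because
  \<open>inverse 0 = 0\<close> lies in every subalgebra.\<close>

definition nonunits :: "'K set \<Rightarrow> 'K set" where
  "nonunits R = {z \<in> R. z = 0 \<or> inverse z \<notin> R}"

definition local_algebra :: "'K set \<Rightarrow> bool" where
  "local_algebra R \<longleftrightarrow> k_subalgebra emb R \<and> (\<forall>a\<in>nonunits R. \<forall>b\<in>nonunits R. a + b \<in> nonunits R)"

text \<open>The local ring of the point of \<open>Spec A\<close> to which the closed point of
  \<open>Spec R\<close> is mapped, when \<open>R\<close> is local and contains
  \<open>A\<close>.\<close>

definition center :: "'K set \<Rightarrow> 'K set \<Rightarrow> 'K set" where
  "center R A = localization_at A (A \<inter> nonunits R)"

lemma local_algebraD:
  assumes "local_algebra R"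
  shows "k_subalgebra emb R"
    "a \<in> nonunits R \<Longrightarrow> b \<in> nonunits R \<Longrightarrow> a + b \<in> nonunits R"
  using assms by (auto simp: local_algebra_def)

lemma nonunits_mult:
  assumes "k_subalgebra emb R" "a \<in> R" "b \<in> nonunits R"
  shows "a * b \<in> nonunits R"
proof (cases "a * b = 0")
  case True
  then show ?thesis using k_subalgebraD[OF assms(1)] by (auto simp: nonunits_def)
next
  case False
  have "inverse (a * b) \<notin> R"
  proof
    assume "inverse (a * b) \<in> R"
    then have "a * inverse (a * b) \<in> R" using k_subalgebraD(5)[OF assms(1,2)] by blast
    moreover have "a * inverse (a * b) = inverse b" using False by (simp add: field_simps)
    ultimately have "inverse b \<in> R" by (simp only:)
    then show False using assms(3) False by (auto simp: nonunits_def)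
  qed
  then show ?thesis
    using assms k_subalgebraD(5)[OF assms(1,2)] by (auto simp: nonunits_def)
qed

lemma unit_mult:
  assumes "k_subalgebra emb R" "a \<in> R" "b \<in> R" "a \<notin> nonunits R" "b \<notin> nonunits R"
  shows "a * b \<in> R" "a * b \<notin> nonunits R"
  using assms k_subalgebraD(5)[OF assms(1)] by (auto simp: nonunits_def)

lemma one_notin_nonunits: "1 \<notin> nonunits R"
  by (auto simp: nonunits_def)

lemma prime_ideal_nonunits:
  assumes "local_algebra R" "k_subalgebra emb A" "A \<subseteq> R"
  shows "prime_ideal_of A (A \<inter> nonunits R)"
proof -
  note R = local_algebraD(1)[OF assms(1)]
  show ?thesis
    unfolding prime_ideal_of_def
  proof (intro conjI ballI impI)
    show "0 \<in> A \<inter> nonunits R"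
      using k_subalgebraD[OF assms(2)] assms(3) by (auto simp: nonunits_def)
    show "1 \<notin> A \<inter> nonunits R" using one_notin_nonunits by auto
    show "a + b \<in> A \<inter> nonunits R" if "a \<in> A \<inter> nonunits R" "b \<in> A \<inter> nonunits R" for a b
      using that local_algebraD(2)[OF assms(1)] k_subalgebraD(4)[OF assms(2)] by auto
    show "a * b \<in> A \<inter> nonunits R" if "a \<in> A" "b \<in> A \<inter> nonunits R" for a b
      using that nonunits_mult[OF R, of a b] k_subalgebraD(5)[OF assms(2)] assms(3) by auto
    show "a \<in> A \<inter> nonunits R \<or> b \<in> A \<inter> nonunits R"
      if "a \<in> A" "b \<in> A" "a * b \<in> A \<inter> nonunits R" for a b
      using that unit_mult(2)[OF R, of a b] assms(3) by auto
  qed auto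
qed

lemma center_subset:
  assumes "k_subalgebra emb R" "A \<subseteq> R"
  shows "center R A \<subseteq> R"
proof
  fix z assume "z \<in> center R A"
  then obtain a b where "z = a / b" "a \<in> A" "b \<in> A" "b \<notin> nonunits R"
    by (auto simp: center_def localization_at_def)
  then show "z \<in> R"
    using k_subalgebraD(5)[OF assms(1), of a "inverse b"] assms(2)
    by (auto simp: nonunits_def field_simps)
qed

lemma center_in_local_rings:
  assumes "local_algebra R" "k_subalgebra emb A" "A \<subseteq> R"
  shows "center R A \<in> local_rings A"
  using prime_ideal_nonunits[OF assms] by (auto simp: center_def local_rings_def)

lemma dominates_center:
  assumes "local_algebra R" "A \<subseteq> R"
  shows "dominates R (center R A)"
  unfolding dominates_def
proof (intro conjI ballI impI)
  note R = local_algebraD(1)[OF assms(1)]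
  show "center R A \<subseteq> R" by (rule center_subset[OF R assms(2)])
  fix z assume "z \<in> center R A" "inverse z \<in> R"
  then obtain a b where z: "z = a / b" "a \<in> A" "b \<in> A" "b \<notin> nonunits R"
    by (auto simp: center_def localization_at_def)
  show "inverse z \<in> center R A"
  proof (cases "z = 0")
    case True
    then show ?thesis using \<open>z \<in> center R A\<close> by simp
  next
    case False
    have "a \<notin> nonunits R"
    proof
      assume "a \<in> nonunits R"
      then have "inverse z * a \<in> nonunits R" by (rule nonunits_mult[OF R \<open>inverse z \<in> R\<close>])
      moreover have "inverse z * a = b" using False z(1) by (auto simp: field_simps)
      ultimately show False using z by simp
    qed
    moreover have "inverse z = b / a" using z(1) by (simp add: field_simps)
    ultimately show ?thesis using z by (auto simp: center_def localization_at_def)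
  qed
qed

lemma subset_localization_at:
  assumes "k_subalgebra emb A" "prime_ideal_of A P"
  shows "A \<subseteq> localization_at A P"
proof
  fix a assume "a \<in> A"
  moreover have "1 \<in> A - P"
    using k_subalgebraD(3)[OF assms(1)] assms(2) by (auto simp: prime_ideal_of_def)
  moreover have "a = a / 1" by simp
  ultimately show "a \<in> localization_at A P"
    unfolding localization_at_def by blast
qed

text \<open>A fraction is a nonunit exactly if its numerator can be taken in \<open>P\<close>. As
  every localization is its own center on \<open>A\<close>, the points of \<open>Spec A\<close> can
  from here on be handled without prime ideals.\<close>

lemma localization_at_local:
  assumes A: "k_subalgebra emb A" and P: "prime_ideal_of A P"
  shows "local_algebra (localization_at A P)" "A \<inter> nonunits (localization_at A P) = P"
    "center (localization_at A P) A = localization_at A P"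
proof -
  let ?R = "localization_at A P"
  note AD = k_subalgebraD[OF A]
  have P0: "0 \<in> P" "P \<subseteq> A" "1 \<notin> P"
    and Padd: "\<And>a b. a \<in> P \<Longrightarrow> b \<in> P \<Longrightarrow> a + b \<in> P"
    and Pmult: "\<And>a b. a \<in> A \<Longrightarrow> b \<in> P \<Longrightarrow> a * b \<in> P"
    and Pprime: "\<And>a b. a \<in> A \<Longrightarrow> b \<in> A \<Longrightarrow> a * b \<in> P \<Longrightarrow> a \<in> P \<or> b \<in> P"
    using P by (auto simp: prime_ideal_of_def)
  have AR: "A \<subseteq> ?R" by (rule subset_localization_at[OF A P])
  have sub: "k_subalgebra emb ?R"
    unfolding k_subalgebra_def
  proof (intro conjI ballI)
    show "range emb \<subseteq> ?R" using AD(1) AR by auto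
    fix z w assume "z \<in> ?R" "w \<in> ?R"
    then obtain a b c d where *: "z = a / b" "w = c / d" "a \<in> A" "b \<in> A - P" "c \<in> A" "d \<in> A - P"
      by (auto simp: localization_at_def)
    have nz: "b \<noteq> 0" "d \<noteq> 0" using * P0 by auto
    have bd: "b * d \<in> A - P" using * Pprime AD(5) by blast
    show "z + w \<in> ?R"
      unfolding localization_at_def
    proof (intro CollectI exI conjI)
      show "z + w = (a * d + c * b) / (b * d)" using nz * by (simp add: field_simps)
      show "a * d + c * b \<in> A" using * by (auto intro: AD)
    qed (fact bd)
    show "z * w \<in> ?R"
      unfolding localization_at_def
    proof (intro CollectI exI conjI)
      show "z * w = (a * c) / (b * d)" using * by simp
      show "a * c \<in> A" using * by (auto intro: AD)
    qed (fact bd)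
  qed
  have nu: "nonunits ?R = {a / b | a b. a \<in> P \<and> b \<in> A - P}"
  proof (intro set_eqI iffI)
    fix z assume z: "z \<in> nonunits ?R"
    then obtain a b where *: "z = a / b" "a \<in> A" "b \<in> A - P"
      by (auto simp: localization_at_def nonunits_def)
    have "a \<in> P"
    proof (rule ccontr)
      assume a: "a \<notin> P"
      then have "inverse z \<in> ?R"
        using * by (auto simp: localization_at_def field_simps)
      then have "z = 0" using z by (auto simp: nonunits_def)
      then have "a = 0" using * P0 by auto
      then show False using a P0 by simp
    qed
    then show "z \<in> {a / b | a b. a \<in> P \<and> b \<in> A - P}" using * by auto
  next
    fix z assume "z \<in> {a / b | a b. a \<in> P \<and> b \<in> A - P}"
    then obtain a b where *: "z = a / b" "a \<in> P" "b \<in> A - P" by auto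
    have "z \<in> ?R" using * P0 by (auto simp: localization_at_def)
    moreover have "inverse z \<notin> ?R" if "z \<noteq> 0"
    proof
      assume "inverse z \<in> ?R"
      then obtain c d where **: "inverse z = c / d" "c \<in> A" "d \<in> A - P"
        by (auto simp: localization_at_def)
      have "b \<noteq> 0" "d \<noteq> 0" "a \<noteq> 0" using * ** P0 that by auto
      moreover from this have "b / a = c / d" using *(1) **(1) by simp
      ultimately have "d * b = c * a" by (simp add: divide_simps mult.commute)
      moreover have "c * a \<in> P" using * ** Pmult by auto
      ultimately show False using Pprime[of d b] * ** by auto
    qed
    ultimately show "z \<in> nonunits ?R" by (auto simp: nonunits_def)
  qed
  show "local_algebra ?R"
    unfolding local_algebra_def nu
  proof (intro conjI sub ballI)
    fix z w assume "z \<in> {a / b | a b. a \<in> P \<and> b \<in> A - P}" "w \<in> {a / b | a b. a \<in> P \<and> b \<in> A - P}"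
    then obtain a b c d where *: "z = a / b" "w = c / d" "a \<in> P" "b \<in> A - P" "c \<in> P" "d \<in> A - P"
      by auto
    have nz: "b \<noteq> 0" "d \<noteq> 0" using * P0 by auto
    show "z + w \<in> {a / b | a b. a \<in> P \<and> b \<in> A - P}"
    proof (intro CollectI exI conjI)
      show "z + w = (d * a + b * c) / (b * d)" using nz * by (simp add: field_simps)
      show "d * a + b * c \<in> P" using * by (auto intro!: Padd Pmult)
      show "b * d \<in> A - P" using * Pprime AD(5) by blast
    qed
  qed
  show eq: "A \<inter> nonunits ?R = P"
  proof (intro set_eqI iffI)
    fix a assume "a \<in> A \<inter> nonunits ?R"
    then obtain c b where *: "a = c / b" "c \<in> P" "b \<in> A - P" "a \<in> A" by (auto simp: nu)
    then have "b \<noteq> 0" using P0 by auto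
    then have "a * b \<in> P" using * by simp
    then show "a \<in> P" using Pprime[of a b] * by auto
  next
    fix a assume a: "a \<in> P"
    moreover have "1 \<in> A - P" "a = a / 1" using P0 AD(3) by auto
    ultimately have "a \<in> nonunits ?R" unfolding nu by blast
    then show "a \<in> A \<inter> nonunits ?R" using P0 a by auto
  qed
  show "center ?R A = ?R" unfolding center_def eq ..
qed

lemma local_ringsD:
  assumes "k_subalgebra emb A" "R \<in> local_rings A"
  shows "local_algebra R" "k_subalgebra emb R" "A \<subseteq> R" "center R A = R"
proof -
  obtain P where P: "prime_ideal_of A P" "R = localization_at A P"
    using assms by (auto simp: local_rings_def)
  note L = localization_at_local[OF assms(1) P(1), folded P(2)]
  show "local_algebra R" "k_subalgebra emb R" "A \<subseteq> R" "center R A = R"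
    using L subset_localization_at[OF assms(1) P(1), folded P(2)] by (auto simp: local_algebra_def)
qed

lemma local_rings_denominator:
  assumes "k_subalgebra emb A" "R \<in> local_rings A" "z \<in> R"
  obtains a b where "a \<in> A" "b \<in> A" "b \<noteq> 0" "inverse b \<in> R" "z = a / b"
proof -
  have "z \<in> center R A" using local_ringsD[OF assms(1,2)] assms(3) by auto
  then obtain a b where "z = a / b" "a \<in> A" "b \<in> A" "b \<notin> nonunits R"
    by (auto simp: center_def localization_at_def)
  moreover then have "b \<noteq> 0" "inverse b \<in> R"
    using local_ringsD[OF assms(1,2)] by (auto simp: nonunits_def)
  ultimately show ?thesis using that by blast
qed

text \<open>The center of \<open>R\<close> on \<open>C\<close> is squeezed between its center on
  \<open>A\<close>, which is \<open>R\<close>, and \<open>R\<close> itself.\<close>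

lemma local_rings_refine:
  assumes A: "k_subalgebra emb A" and R: "R \<in> local_rings A"
    and C: "k_subalgebra emb C" "A \<subseteq> C" "C \<subseteq> R"
  shows "R \<in> local_rings C"
proof -
  note RD = local_ringsD[OF A R]
  have "center R A \<subseteq> center R C"
    using C(2) unfolding center_def localization_at_def by blast
  then have "center R C = R" using center_subset[OF RD(2) C(3)] RD(4) by auto
  then show ?thesis using center_in_local_rings[OF RD(1) C(1) C(3)] by simp
qed

text \<open>The hypothesis on fractions says that \<open>C\<close> is a localization of
  \<open>A\<close>, so this is the inclusion of an open subscheme. It is what places the torus
  inside each chart.\<close>

lemma local_rings_coarsen:
  assumes A: "k_subalgebra emb A" and C: "k_subalgebra emb C" "A \<subseteq> C"
    and frac: "\<And>c. c \<in> C \<Longrightarrow> \<exists>a\<in>A. \<exists>b\<in>A. b \<noteq> 0 \<and> c = a / b \<and> inverse b \<in> C"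
    and R: "R \<in> local_rings C"
  shows "R \<in> local_rings A"
proof -
  note RD = local_ringsD[OF C(1) R]
  have AR: "A \<subseteq> R" using C RD by auto
  have "R \<subseteq> center R A"
  proof
    fix z assume "z \<in> R"
    then obtain c d where cd: "c \<in> C" "d \<in> C" "d \<noteq> 0" "inverse d \<in> R" "z = c / d"
      using local_rings_denominator[OF C(1) R] by blast
    obtain a b where ab: "a \<in> A" "b \<in> A" "b \<noteq> 0" "c = a / b" "inverse b \<in> C"
      using frac[OF cd(1)] by auto
    obtain a' b' where ab': "a' \<in> A" "b' \<in> A" "b' \<noteq> 0" "d = a' / b'" "inverse b' \<in> C"
      using frac[OF cd(2)] by auto
    have "a' \<noteq> 0" using ab' cd by auto
    have "inverse (b * a') = inverse b * (inverse d * inverse b')"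
      using ab' by (simp add: field_simps)
    also have "\<dots> \<in> R"
      using ab ab' cd RD(3) by (intro k_subalgebraD(5)[OF RD(2)]) auto
    finally have "b * a' \<notin> nonunits R"
      using \<open>a' \<noteq> 0\<close> ab by (auto simp: nonunits_def)
    moreover have "z = (a * b') / (b * a')"
      using ab(3,4) ab'(3,4) cd(3,5) \<open>a' \<noteq> 0\<close> by simp
    ultimately show "z \<in> center R A"
      using ab ab' k_subalgebraD(5)[OF A] by (auto simp: center_def localization_at_def)
  qed
  then have "center R A = R" using center_subset[OF RD(2) AR] by auto
  then show ?thesis using center_in_local_rings[OF RD(1) A AR] by simp
qed

section \<open>Charts of projective models\<close>

definition chart :: "'K set \<Rightarrow> 'K set \<Rightarrow> 'K \<Rightarrow> 'K set" where
  "chart B F f = k_subalgebra emb hull (B \<union> (\<lambda>g. g / f) ` F)"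

lemma projective_model_chart: "projective_model emb B F = (\<Union>f\<in>F. local_rings (chart B F f))"
  by (simp add: projective_model_def chart_def)

lemma k_subalgebra_chart [simp]: "k_subalgebra emb (chart B F f)"
  by (simp add: chart_def)

lemma chart_subset_iff: "k_subalgebra emb C \<Longrightarrow>
    chart B F f \<subseteq> C \<longleftrightarrow> B \<subseteq> C \<and> (\<forall>g\<in>F. g / f \<in> C)"
  by (auto simp: chart_def subset_hull)

lemma chartI: "b \<in> B \<Longrightarrow> b \<in> chart B F f" "g \<in> F \<Longrightarrow> g / f \<in> chart B F f"
  by (auto simp: chart_def intro: hull_inc)

text \<open>If \<open>S\<close> contains two charts then \<open>g / f\<close> is a unit of \<open>S\<close>, hence of every local ring that it
  dominates; so each of the two local rings contains both charts.\<close>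

lemma separated_projective_model:
  assumes "0 \<notin> F"
  shows "separated (projective_model emb B F)"
  unfolding separated_def
proof (intro ballI impI, elim exE conjE)
  fix R R' S
  assume R: "R \<in> projective_model emb B F" "R' \<in> projective_model emb B F"
    and S: "local_subring S" "dominates S R" "dominates S R'"
  obtain f g where f: "f \<in> F" "R \<in> local_rings (chart B F f)"
    and g: "g \<in> F" "R' \<in> local_rings (chart B F g)"
    using R by (auto simp: projective_model_chart)
  have sub: "Q' \<subseteq> Q" if f: "f \<in> F" "Q \<in> local_rings (chart B F f)"
    and g: "g \<in> F" "Q' \<in> local_rings (chart B F g)"
    and S: "dominates S Q" "dominates S Q'" for Q Q' f g
  proof -
    note Q = local_ringsD[OF k_subalgebra_chart f(2)]
    note Q' = local_ringsD[OF k_subalgebra_chart g(2)]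
    have nz: "f \<noteq> 0" "g \<noteq> 0" using f g assms by auto
    have "f / g \<in> S" using chartI(2)[of f F g B] f Q'(3) S(2) by (auto simp: dominates_def)
    moreover have gf: "g / f \<in> Q" using chartI(2)[of g F f B] f g Q(3) by auto
    ultimately have fg: "f / g \<in> Q" using S(1) by (auto simp: dominates_def)
    have cg: "chart B F g \<subseteq> Q"
      unfolding chart_subset_iff[OF Q(2)]
    proof (intro conjI ballI)
      show "B \<subseteq> Q" using chartI(1) Q(3) by auto
      fix h assume "h \<in> F"
      then have "(h / f) * (f / g) \<in> Q"
        using chartI(2)[where B=B and f=f, OF \<open>h \<in> F\<close>] Q(3) fg by (intro k_subalgebraD(5)[OF Q(2)]) auto
      then show "h / g \<in> Q" using nz by (simp add: field_simps)
    qed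
    show "Q' \<subseteq> Q"
    proof
      fix z assume "z \<in> Q'"
      then obtain a b where ab: "a \<in> chart B F g" "b \<in> chart B F g" "b \<noteq> 0" "inverse b \<in> Q'" "z = a / b"
        using local_rings_denominator[OF k_subalgebra_chart g(2)] by blast
      then have "inverse b \<in> Q" using cg S by (auto simp: dominates_def)
      then show "z \<in> Q"
        using ab cg k_subalgebraD(5)[OF Q(2), of a "inverse b"] by (auto simp: field_simps)
    qed
  qed
  show "R = R'" using sub[OF f g S(2,3)] sub[OF g f S(3,2)] by auto
qed

end

section \<open>Monomials and monomial valuations\<close>

locale rational_functions = embedded_field emb
  for emb :: "'k::field \<Rightarrow> 'K::field" +
  fixes n :: nat and x :: "nat \<Rightarrow> 'K"
  assumes rat: "rational_function_field emb n x"
begin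

definition exps :: "(nat \<Rightarrow> int) set" where
  "exps = {a. \<forall>i\<ge>n. a i = 0}"

definition mon :: "(nat \<Rightarrow> int) \<Rightarrow> 'K" where
  "mon a = (\<Prod>i<n. x i powi a i)"

definition unit_exp :: "nat \<Rightarrow> nat \<Rightarrow> int" where
  "unit_exp i = (\<lambda>j. if j = i then 1 else 0)"

lemma unit_exp_simps [simp]: "unit_exp i i = 1" "j \<noteq> i \<Longrightarrow> unit_exp i j = 0"
  by (auto simp: unit_exp_def)

lemma indep: "algebraically_independent emb n x"
  using rat by (simp add: rational_function_field_def)

lemma exps_zero [simp, intro]: "0 \<in> exps"
  and exps_add [intro]: "a \<in> exps \<Longrightarrow> b \<in> exps \<Longrightarrow> a + b \<in> exps"
  and exps_diff [intro]: "a \<in> exps \<Longrightarrow> b \<in> exps \<Longrightarrow> a - b \<in> exps"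
  and exps_minus [intro]: "a \<in> exps \<Longrightarrow> - a \<in> exps"
  and exps_unit [simp, intro]: "i < n \<Longrightarrow> unit_exp i \<in> exps"
  by (auto simp: exps_def unit_exp_def)

lemma prod_nonzero_exponent:
  fixes e :: "nat \<Rightarrow> nat"
  assumes "e \<in> {e. \<forall>i\<ge>n. e i = 0}"
  shows "(\<Prod>i<n. x i ^ e i) \<noteq> 0"
proof
  assume "(\<Prod>i<n. x i ^ e i) = 0"
  then have "(\<Sum>e\<in>{e}. emb ((\<lambda>_. 1) e) * (\<Prod>i<n. x i ^ e i)) = 0" by simp
  then have "\<forall>e\<in>{e}. (\<lambda>_. 1) e = (0::'k)"
    using assms indep[unfolded algebraically_independent_def, rule_format, of "{e}" "\<lambda>_. 1"] by auto
  then show False by simp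
qed

lemma x_nonzero [simp]: "i < n \<Longrightarrow> x i \<noteq> 0"
proof
  assume i: "i < n" "x i = 0"
  have "(\<Prod>j<n. x j ^ (if j = i then 1 else 0)) \<noteq> 0"
    by (rule prod_nonzero_exponent) (use i in auto)
  moreover have "(\<Prod>j<n. x j ^ (if j = i then 1 else 0)) = 0"
    using i by (intro prod_zero) auto
  ultimately show False by simp
qed

lemma mon_nonzero [simp]: "mon a \<noteq> 0"
  by (auto simp: mon_def)

lemma mon_0 [simp]: "mon 0 = 1"
  by (simp add: mon_def)

lemma mon_add: "mon (a + b) = mon a * mon b"
  by (simp add: mon_def power_int_add flip: prod.distrib)

lemma mon_minus: "mon (- a) = inverse (mon a)"
  by (simp add: mon_def power_int_minus flip: prod_inversef)

lemma mon_diff: "mon (a - b) = mon a / mon b"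
  using mon_add[of a "- b"] by (simp add: mon_minus field_simps)

lemma mon_unit [simp]: "i < n \<Longrightarrow> mon (unit_exp i) = x i"
  unfolding mon_def by (subst prod.remove[of _ i]) (auto intro!: prod.neutral)

text \<open>Algebraic independence speaks of ordinary polynomials only. Multiplying by
  \<open>mon N\<close>, where \<open>N\<close> bounds the absolute values of all exponents in
  \<open>E\<close>, turns a Laurent relation into a polynomial one.\<close>

lemma mon_indep:
  assumes "finite E" "E \<subseteq> exps" "(\<Sum>a\<in>E. emb (c a) * mon a) = 0" "a \<in> E"
  shows "c a = 0"
proof -
  define N :: "nat \<Rightarrow> int" where "N = (\<lambda>i. \<Sum>a\<in>E. \<bar>a i\<bar>)"
  define \<phi> where "\<phi> = (\<lambda>a i. nat (a i + N i))"
  have N: "a i + N i \<ge> 0" if "a \<in> E" for a i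
  proof -
    have "\<bar>a i\<bar> \<le> N i"
      unfolding N_def by (rule member_le_sum) (use that assms in auto)
    then show ?thesis by linarith
  qed
  have inj: "inj_on \<phi> E"
  proof (rule inj_onI)
    fix a b assume ab: "a \<in> E" "b \<in> E" "\<phi> a = \<phi> b"
    have "a i = b i" for i
      using fun_cong[OF ab(3), of i] N[OF ab(1), of i] N[OF ab(2), of i] by (simp add: \<phi>_def)
    then show "a = b" by auto
  qed
  have mon: "(\<Prod>i<n. x i ^ \<phi> a i) = mon N * mon a" if "a \<in> E" for a
  proof -
    have "mon N * mon a = mon (a + N)" by (simp add: mon_add)
    also have "\<dots> = (\<Prod>i<n. x i ^ \<phi> a i)"
      unfolding mon_def
    proof (rule prod.cong[OF refl])
      fix i
      show "x i powi (a + N) i = x i ^ \<phi> a i"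
        using N[OF that, of i] by (simp add: \<phi>_def power_int_def)
    qed
    finally show ?thesis by simp
  qed
  have sub: "\<phi> ` E \<subseteq> {e. \<forall>i\<ge>n. e i = 0}"
  proof (clarsimp)
    fix a i assume "a \<in> E" "n \<le> i"
    moreover from this have "N i = 0"
      using assms(2) unfolding N_def by (intro sum.neutral) (auto simp: exps_def)
    ultimately show "\<phi> a i = 0" using assms(2) by (auto simp: \<phi>_def exps_def)
  qed
  define c' where "c' = c \<circ> inv_into E \<phi>"
  have c': "c' (\<phi> a) = c a" if "a \<in> E" for a using inj that by (simp add: c'_def)
  have "(\<Sum>e\<in>\<phi> ` E. emb (c' e) * (\<Prod>i<n. x i ^ e i)) = (\<Sum>a\<in>E. emb (c a) * (mon N * mon a))"
    using inj by (subst sum.reindex) (auto simp: c' mon intro!: sum.cong)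
  also have "\<dots> = mon N * (\<Sum>a\<in>E. emb (c a) * mon a)"
    by (simp add: sum_distrib_left algebra_simps)
  finally have "(\<Sum>e\<in>\<phi> ` E. emb (c' e) * (\<Prod>i<n. x i ^ e i)) = 0" using assms by simp
  then have "\<forall>e\<in>\<phi> ` E. c' e = 0"
    using sub assms(1) indep[unfolded algebraically_independent_def, rule_format, of "\<phi> ` E" c'] by blast
  then show ?thesis using assms(4) c' by auto
qed

lemma inj_on_mon: "inj_on mon exps"
proof (rule inj_onI)
  fix a b assume ab: "a \<in> exps" "b \<in> exps" "mon a = mon b"
  show "a = b"
  proof (rule ccontr)
    assume ne: "a \<noteq> b"
    have "(\<lambda>e. if e = a then 1 else - 1) a = (0::'k)"
      by (rule mon_indep[of "{a, b}"]) (use ab ne in \<open>auto simp: emb_minus\<close>)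
    then show False by simp
  qed
qed

lemma characters_eq: "characters n x = mon ` exps"
proof -
  have "mon m \<in> mon ` exps" for m
    by (rule image_eqI[of _ _ "\<lambda>i. if i < n then m i else 0"]) (auto simp: mon_def exps_def)
  moreover have "characters n x = range mon"
    by (simp add: characters_def mon_def[abs_def])
  ultimately show ?thesis by auto
qed

lemma span_mon_explicit:
  assumes "f \<in> kv.span (mon ` S)"
  obtains E c where "finite E" "E \<subseteq> S" "\<And>a. a \<in> E \<Longrightarrow> c a \<noteq> 0" "f = (\<Sum>a\<in>E. emb (c a) * mon a)"
    "inj_on mon E"
proof -
  obtain T r where T: "finite T" "T \<subseteq> mon ` S" "f = (\<Sum>t\<in>T. emb (r t) * t)"
    using assms unfolding kv.span_explicit by blast
  define T' where "T' = {t \<in> T. r t \<noteq> 0}"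
  have T': "finite T'" "T' \<subseteq> mon ` S" using T by (auto simp: T'_def)
  have f: "f = (\<Sum>t\<in>T'. emb (r t) * t)"
    unfolding T(3) T'_def using T(1) by (intro sum.mono_neutral_right) auto
  obtain E where E: "E \<subseteq> S" "inj_on mon E" "T' = mon ` E"
    using T'(2) by (metis subset_image_inj)
  show ?thesis
  proof
    show "finite E" using E T' finite_image_iff by metis
    show "f = (\<Sum>a\<in>E. emb ((r \<circ> mon) a) * mon a)" unfolding f E(3) by (simp add: sum.reindex[OF E(2)])
    show "(r \<circ> mon) a \<noteq> 0" if "a \<in> E" for a
      using that E(3) by (auto simp: T'_def)
  qed (fact E)+
qed

lemma span_mon_mult:
  assumes f: "f \<in> kv.span (mon ` S)" and g: "g \<in> kv.span (mon ` T)"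
    and U: "\<And>a b. a \<in> S \<Longrightarrow> b \<in> T \<Longrightarrow> a + b \<in> U"
  shows "f * g \<in> kv.span (mon ` U)"
proof -
  obtain E c where E: "finite E" "E \<subseteq> S" "f = (\<Sum>a\<in>E. emb (c a) * mon a)"
    using span_mon_explicit[OF f] by metis
  obtain E' c' where E': "finite E'" "E' \<subseteq> T" "g = (\<Sum>a\<in>E'. emb (c' a) * mon a)"
    using span_mon_explicit[OF g] by metis
  have "f * g = (\<Sum>a\<in>E. \<Sum>b\<in>E'. emb (c a * c' b) * mon (a + b))"
    unfolding E(3) E'(3) sum_product by (simp add: emb_mult mon_add mult_ac)
  also have "\<dots> \<in> kv.span (mon ` U)"
    using E(2) E'(2) by (intro kv.span_sum kv.span_scale kv.span_base imageI U) auto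
  finally show ?thesis .
qed

lemma mon_notin_span:
  assumes "a \<in> exps" "S \<subseteq> exps" "a \<notin> S"
  shows "mon a \<notin> kv.span (mon ` S)"
proof
  assume "mon a \<in> kv.span (mon ` S)"
  then obtain E c where E: "finite E" "E \<subseteq> S" "mon a = (\<Sum>a\<in>E. emb (c a) * mon a)"
    using span_mon_explicit by metis
  define d where "d = (\<lambda>e. if e = a then - 1 else c e)"
  have a: "a \<notin> E" using E assms by auto
  have "(\<Sum>e\<in>E. emb (d e) * mon e) = (\<Sum>e\<in>E. emb (c e) * mon e)"
    using a by (intro sum.cong) (auto simp: d_def)
  then have "(\<Sum>e\<in>insert a E. emb (d e) * mon e) = 0"
    using E a by (simp add: d_def emb_minus)
  then have "d a = 0" by (intro mon_indep[of "insert a E"]) (use E assms in auto)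
  then show False by (simp add: d_def)
qed

lemma mon_in_span_iff:
  "a \<in> exps \<Longrightarrow> S \<subseteq> exps \<Longrightarrow> mon a \<in> kv.span (mon ` S) \<longleftrightarrow> a \<in> S"
  using mon_notin_span[of a S] kv.span_base[of "mon a" "mon ` S"] by auto

lemma k_subalgebra_span_mon:
  assumes "0 \<in> S" "\<And>a b. a \<in> S \<Longrightarrow> b \<in> S \<Longrightarrow> a + b \<in> S"
  shows "k_subalgebra emb (kv.span (mon ` S))"
  unfolding k_subalgebra_def
proof (intro conjI ballI)
  have "emb c * mon 0 \<in> kv.span (mon ` S)" for c
    using assms by (intro kv.span_scale kv.span_base imageI)
  then show "range emb \<subseteq> kv.span (mon ` S)" by auto
qed (auto intro: kv.span_add span_mon_mult assms)

abbreviation "B \<equiv> affine_coordinate_ring emb n x"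
abbreviation "laurent \<equiv> kv.span (mon ` exps)"

lemma k_subalgebra_B [simp]: "k_subalgebra emb B"
  by (simp add: affine_coordinate_ring_def)

lemma x_in_B [simp]: "i < n \<Longrightarrow> x i \<in> B"
  by (auto simp: affine_coordinate_ring_def intro: hull_inc)

lemma B_subset_iff: "k_subalgebra emb A \<Longrightarrow> B \<subseteq> A \<longleftrightarrow> (\<forall>i<n. x i \<in> A)"
  unfolding affine_coordinate_ring_def by (subst subset_hull) auto

lemma k_subalgebra_laurent [simp]: "k_subalgebra emb laurent"
  by (intro k_subalgebra_span_mon) auto

lemma mon_in_laurent [simp]: "a \<in> exps \<Longrightarrow> mon a \<in> laurent"
  by (auto intro: kv.span_base)

lemma B_subset_laurent: "B \<subseteq> laurent"
  unfolding B_subset_iff[OF k_subalgebra_laurent]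
proof (intro allI impI)
  fix i assume "i < n"
  then show "x i \<in> laurent" using mon_in_laurent[of "unit_exp i"] by simp
qed

lemma fraction:
  obtains f g where "f \<in> B" "g \<in> B" "g \<noteq> 0" "z = f / g"
  using rat unfolding rational_function_field_def has_fraction_field_UNIV_def by blast

end

section \<open>The valuation ring of a monomial valuation\<close>

locale monomial_valuation = rational_functions emb n x
  for emb :: "'k::field \<Rightarrow> 'K::field" and n x +
  fixes v :: "(nat \<Rightarrow> int) \<Rightarrow> 'o::linordered_ab_group_add"
  assumes v_add: "v (a + b) = v a + v b"
    and v_inj: "a \<in> exps \<Longrightarrow> v a = 0 \<Longrightarrow> a = 0"
begin

lemma v_0 [simp]: "v 0 = 0"
  using v_add[of 0 0] by (metis add_cancel_right_right add_0)

lemma v_minus: "v (- a) = - v a"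
  using v_add[of a "- a"] by (simp add: eq_neg_iff_add_eq_0 add.commute)

lemma v_diff: "v (a - b) = v a - v b"
  using v_add[of a "- b"] by (simp add: v_minus)

definition pos :: "'K set" where
  "pos = kv.span (mon ` {a \<in> exps. v a > 0})"

definition nonneg :: "'K set" where
  "nonneg = kv.span (mon ` {a \<in> exps. v a \<ge> 0})"

text \<open>Dividing numerator and denominator of a fraction by the leading term of the denominator
  makes the latter an element of \<open>1 + pos\<close>. So the ring is described through Laurent
  polynomials alone, before any valuation of a quotient is defined.\<close>

definition valring :: "'K set" where
  "valring = {p / q | p q. p \<in> nonneg \<and> q - 1 \<in> pos}"

lemma pos_subset_nonneg: "pos \<subseteq> nonneg"
  unfolding pos_def nonneg_def by (intro kv.span_mono image_mono) auto

lemma nonneg_subalgebra: "k_subalgebra emb nonneg"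
  unfolding nonneg_def by (rule k_subalgebra_span_mon) (auto simp: v_add)

lemma pos_mult: "f \<in> nonneg \<Longrightarrow> g \<in> pos \<Longrightarrow> f * g \<in> pos"
  unfolding pos_def nonneg_def by (erule span_mon_mult) (auto simp: v_add add_nonneg_pos)

lemma pos_add: "f \<in> pos \<Longrightarrow> g \<in> pos \<Longrightarrow> f + g \<in> pos"
  and pos_diff: "f \<in> pos \<Longrightarrow> g \<in> pos \<Longrightarrow> f - g \<in> pos"
  and pos_0: "0 \<in> pos"
  and pos_scale: "f \<in> pos \<Longrightarrow> emb c * f \<in> pos"
  unfolding pos_def by (auto intro: kv.span_add kv.span_diff kv.span_zero kv.span_scale)

lemma one_notin_pos: "1 \<notin> pos"
  using mon_notin_span[of 0 "{a \<in> exps. v a > 0}"] by (auto simp: pos_def)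

text \<open>By injectivity of \<open>v\<close> the only exponent of value zero is \<open>0\<close>;
  in other words the residue field is \<open>k\<close>.\<close>

lemma nonneg_decomp: "p \<in> nonneg \<Longrightarrow> \<exists>c. p - emb c \<in> pos"
proof -
  assume p: "p \<in> nonneg"
  have "{a \<in> exps. v a \<ge> 0} = insert 0 {a \<in> exps. v a > 0}"
  proof (intro set_eqI iffI)
    fix a assume "a \<in> {a \<in> exps. v a \<ge> 0}"
    then have a: "a \<in> exps" "v a = 0 \<or> v a > 0" by (auto simp: order_le_less)
    then have "a = 0 \<or> v a > 0" using v_inj by blast
    then show "a \<in> insert 0 {a \<in> exps. v a > 0}" using a(1) by blast
  qed (auto simp: order_le_less)
  then have "mon ` {a \<in> exps. v a \<ge> 0} = insert 1 (mon ` {a \<in> exps. v a > 0})"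
    by (simp only: image_insert mon_0)
  then show ?thesis using p
    by (simp only: nonneg_def pos_def kv.span_breakdown_eq mult_1_right)
qed

lemma principal_unit:
  assumes "q - 1 \<in> pos"
  shows "q \<noteq> 0" "q \<in> nonneg"
proof -
  show "q \<noteq> 0"
  proof
    assume "q = 0"
    then have "0 - (q - 1) \<in> pos" using assms pos_diff pos_0 by blast
    then show False using \<open>q = 0\<close> one_notin_pos by simp
  qed
  show "q \<in> nonneg"
    using k_subalgebraD(4)[OF nonneg_subalgebra _ k_subalgebraD(3)[OF nonneg_subalgebra], of "q - 1"]
      pos_subset_nonneg assms by auto
qed

lemma principal_unit_mult:
  assumes "p - 1 \<in> pos" "q - 1 \<in> pos"
  shows "p * q - 1 \<in> pos"
proof -
  have "p * (q - 1) + (p - 1) \<in> pos"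
    by (intro pos_add pos_mult principal_unit assms)
  then show ?thesis by (simp add: algebra_simps)
qed

lemma valring_subalgebra: "k_subalgebra emb valring"
  unfolding k_subalgebra_def
proof (intro conjI ballI)
  have "emb c = emb c / 1" "emb c \<in> nonneg" "1 - 1 \<in> pos" for c
    using k_subalgebraD[OF nonneg_subalgebra] pos_0 by auto
  then show "range emb \<subseteq> valring" unfolding valring_def by blast
  fix z w assume "z \<in> valring" "w \<in> valring"
  then obtain p q p' q' where *: "z = p / q" "p \<in> nonneg" "q - 1 \<in> pos"
    "w = p' / q'" "p' \<in> nonneg" "q' - 1 \<in> pos"
    by (auto simp: valring_def)
  note u = principal_unit[OF *(3)] principal_unit[OF *(6)]
  have "z + w = (p * q' + p' * q) / (q * q')" using * u by (simp add: field_simps)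
  moreover have "p * q' + p' * q \<in> nonneg"
    using * u by (auto intro!: k_subalgebraD[OF nonneg_subalgebra])
  ultimately show "z + w \<in> valring"
    unfolding valring_def using principal_unit_mult[OF *(3,6)] by blast
  have "z * w = (p * p') / (q * q')" using * by simp
  moreover have "p * p' \<in> nonneg" using * by (auto intro!: k_subalgebraD[OF nonneg_subalgebra])
  ultimately show "z * w \<in> valring"
    unfolding valring_def using principal_unit_mult[OF *(3,6)] by blast
qed

lemma nonneg_subset_valring: "nonneg \<subseteq> valring"
proof
  fix p assume "p \<in> nonneg"
  moreover have "1 - 1 \<in> pos" "p = p / 1" using pos_0 by auto
  ultimately show "p \<in> valring" unfolding valring_def by blast
qed

lemma inverse_principal_unit: "q - 1 \<in> pos \<Longrightarrow> inverse q \<in> valring"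
proof -
  assume "q - 1 \<in> pos"
  moreover have "1 \<in> nonneg" "inverse q = 1 / q"
    using k_subalgebraD(3)[OF nonneg_subalgebra] by (auto simp: inverse_eq_divide)
  ultimately show "inverse q \<in> valring" unfolding valring_def by blast
qed

text \<open>The constant term \<open>c\<close> of the numerator decides: if it is nonzero, dividing
  by it gives an element of \<open>1 + pos\<close>, which is invertible.\<close>

lemma valring_unit_or_pos:
  assumes "z \<in> valring"
  shows "inverse z \<in> valring \<or> (\<exists>p q. p \<in> pos \<and> q - 1 \<in> pos \<and> z = p / q)"
proof -
  obtain p q where *: "z = p / q" "p \<in> nonneg" "q - 1 \<in> pos"
    using assms by (auto simp: valring_def)
  obtain c where c: "p - emb c \<in> pos" using nonneg_decomp[OF *(2)] by blast
  show ?thesis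
  proof (cases "c = 0")
    case True
    then show ?thesis using c * by auto
  next
    case False
    have "emb (inverse c) * (p - emb c) \<in> pos" using c by (rule pos_scale)
    then have p': "emb (inverse c) * p - 1 \<in> pos"
      using False by (simp add: algebra_simps emb_inverse)
    have "inverse z = emb (inverse c) * (q * inverse (emb (inverse c) * p))"
      using * False by (simp add: emb_inverse field_simps)
    also have "\<dots> \<in> valring"
      using nonneg_subset_valring principal_unit[OF *(3)] inverse_principal_unit[OF p']
      by (intro k_subalgebraD[OF valring_subalgebra]) auto
    finally show ?thesis by simp
  qed
qed

text \<open>If \<open>p' / q'\<close> were the inverse, then \<open>q' * q = p' * p\<close> would
  lie both in \<open>1 + pos\<close> and in \<open>pos\<close>.\<close>

lemma quotient_pos_nonunit:
  assumes "p \<in> pos" "q - 1 \<in> pos"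
  shows "p / q \<in> nonunits valring"
proof -
  have "inverse (p / q) \<notin> valring" if nz: "p / q \<noteq> 0"
  proof
    assume "inverse (p / q) \<in> valring"
    then obtain p' q' where *: "inverse (p / q) = p' / q'" "p' \<in> nonneg" "q' - 1 \<in> pos"
      by (auto simp: valring_def)
    have "q' * q = p' * p"
      using * nz principal_unit[OF *(3)] principal_unit[OF assms(2)] by (simp add: field_simps)
    moreover have "p' * p \<in> pos" using * assms pos_mult by auto
    moreover have "q' * q - 1 \<in> pos" using * assms principal_unit_mult by auto
    ultimately have "q' * q - (q' * q - 1) \<in> pos" using pos_diff by metis
    then show False using one_notin_pos by simp
  qed
  moreover have "p / q \<in> valring" using assms pos_subset_nonneg unfolding valring_def by blast
  ultimately show ?thesis unfolding nonunits_def by blast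
qed

lemma nonunits_valring: "nonunits valring = {p / q | p q. p \<in> pos \<and> q - 1 \<in> pos}"
proof (intro set_eqI iffI)
  fix z assume z: "z \<in> nonunits valring"
  show "z \<in> {p / q | p q. p \<in> pos \<and> q - 1 \<in> pos}"
  proof (cases "z = 0")
    case True
    then have "z = 0 / 1" "0 \<in> pos" "1 - 1 \<in> pos" using pos_0 by auto
    then show ?thesis by blast
  next
    case False
    then show ?thesis using z valring_unit_or_pos[of z] by (auto simp: nonunits_def)
  qed
qed (auto intro: quotient_pos_nonunit)

lemma local_algebra_valring: "local_algebra valring"
  unfolding local_algebra_def nonunits_valring
proof (intro conjI ballI valring_subalgebra)
  fix z w assume "z \<in> {p / q | p q. p \<in> pos \<and> q - 1 \<in> pos}" "w \<in> {p / q | p q. p \<in> pos \<and> q - 1 \<in> pos}"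
  then obtain p q p' q' where *: "z = p / q" "p \<in> pos" "q - 1 \<in> pos"
    "w = p' / q'" "p' \<in> pos" "q' - 1 \<in> pos"
    by auto
  note u = principal_unit[OF *(3)] principal_unit[OF *(6)]
  have "z + w = (q' * p + q * p') / (q * q')" using * u by (simp add: field_simps)
  moreover have "q' * p + q * p' \<in> pos"
    using * u by (auto intro!: pos_add pos_mult)
  ultimately show "z + w \<in> {p / q | p q. p \<in> pos \<and> q - 1 \<in> pos}"
    using principal_unit_mult[OF *(3,6)] by blast
qed

lemma pos_subset_nonunits: "pos \<subseteq> nonunits valring"
proof
  fix p assume "p \<in> pos"
  moreover have "1 - 1 \<in> pos" "p = p / 1" using pos_0 by auto
  ultimately show "p \<in> nonunits valring" using quotient_pos_nonunit[of p 1] by simp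
qed

lemma mon_in_valring_iff: "a \<in> exps \<Longrightarrow> mon a \<in> valring \<longleftrightarrow> v a \<ge> 0"
proof
  assume a: "a \<in> exps" "mon a \<in> valring"
  show "v a \<ge> 0"
  proof (rule ccontr)
    assume "\<not> v a \<ge> 0"
    then have "mon (- a) \<in> pos"
      using a by (auto simp: pos_def v_minus intro!: kv.span_base)
    then have "mon (- a) \<in> nonunits valring" using pos_subset_nonunits by auto
    then show False using a by (simp add: mon_minus nonunits_def)
  qed
next
  assume "a \<in> exps" "v a \<ge> 0"
  then have "mon a \<in> nonneg" by (auto simp: nonneg_def intro: kv.span_base)
  then show "mon a \<in> valring" using nonneg_subset_valring by auto
qed

section \<open>Leading exponents of rational functions\<close>

definition lead :: "'K \<Rightarrow> (nat \<Rightarrow> int) \<Rightarrow> bool" where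
  "lead z a \<longleftrightarrow> a \<in> exps \<and>
     (\<exists>c p q. c \<noteq> 0 \<and> p - 1 \<in> pos \<and> q - 1 \<in> pos \<and> z = emb c * mon a * (p / q))"

text \<open>Factor out the term of least value. All other exponents in the support have strictly
  larger value since \<open>v\<close> is injective, so the cofactor lies in
  \<open>1 + pos\<close>.\<close>

lemma lead_span:
  assumes "f \<in> kv.span (mon ` S)" "S \<subseteq> exps" "f \<noteq> 0"
  obtains a c p where "a \<in> S" "c \<noteq> 0" "p - 1 \<in> pos" "f = emb c * mon a * p"
proof -
  obtain E c where E: "finite E" "E \<subseteq> S" "\<And>a. a \<in> E \<Longrightarrow> c a \<noteq> 0" "f = (\<Sum>a\<in>E. emb (c a) * mon a)"
    using span_mon_explicit[OF assms(1)] by metis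
  have "E \<noteq> {}" using E assms by auto
  then have "Min (v ` E) \<in> v ` E" using E by simp
  then obtain a where a: "a \<in> E" "v a = Min (v ` E)" by auto
  have min: "v a \<le> v b" if "b \<in> E" for b using that E a by simp
  have lt: "v (b - a) > 0" if "b \<in> E - {a}" for b
  proof -
    have "b - a \<in> exps" "b - a \<noteq> 0" using that E assms a by auto
    then have "v (b - a) \<noteq> 0" using v_inj by blast
    then show ?thesis using min[of b] that by (auto simp: v_diff order_le_less)
  qed
  define p where "p = 1 + (\<Sum>b\<in>E - {a}. emb (c b / c a) * mon (b - a))"
  have "(\<Sum>b\<in>E - {a}. emb (c b / c a) * mon (b - a)) \<in> pos"
    unfolding pos_def
  proof (intro kv.span_sum kv.span_scale kv.span_base imageI CollectI conjI)
    fix b assume "b \<in> E - {a}"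
    then show "b - a \<in> exps" "0 < v (b - a)" using lt E(2) assms(2) a(1) by auto
  qed
  then have p: "p - 1 \<in> pos" by (simp add: p_def)
  have "emb (c a) * mon a * p = emb (c a) * mon a + (\<Sum>b\<in>E - {a}. emb (c b) * mon b)"
  proof -
    have "emb (c a) * mon a * (emb (c b / c a) * mon (b - a)) = emb (c b) * mon b" for b
    proof -
      have "emb (c b / c a) = emb (c b) / emb (c a)"
        by (simp add: divide_inverse emb_mult emb_inverse)
      then show ?thesis using E(3)[OF a(1)] by (simp add: mon_diff)
    qed
    then show ?thesis by (simp add: p_def distrib_left sum_distrib_left)
  qed
  also have "\<dots> = f" unfolding E(4) using E a by (subst (2) sum.remove[of _ a]) auto
  finally show ?thesis using that[of a "c a" p] p a E by auto
qed

lemma lead_exists: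
  assumes "z \<noteq> 0"
  obtains a where "lead z a"
proof -
  obtain f g where fg: "f \<in> B" "g \<in> B" "g \<noteq> 0" "z = f / g" using fraction by blast
  have "f \<in> laurent" "g \<in> laurent" "f \<noteq> 0" using fg B_subset_laurent assms by auto
  obtain a c p where a: "a \<in> exps" "c \<noteq> 0" "p - 1 \<in> pos" "f = emb c * mon a * p"
    using lead_span[OF \<open>f \<in> laurent\<close> _ \<open>f \<noteq> 0\<close>] by blast
  obtain a' c' p' where a': "a' \<in> exps" "c' \<noteq> 0" "p' - 1 \<in> pos" "g = emb c' * mon a' * p'"
    using lead_span[OF \<open>g \<in> laurent\<close> _ \<open>g \<noteq> 0\<close>] by blast
  have "z = emb (c / c') * mon (a - a') * (p / p')"
    using a a' fg by (simp add: mon_diff divide_inverse emb_mult emb_inverse)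
  then have "lead z (a - a')" unfolding lead_def using a a'
    by (intro conjI exI[of _ "c / c'"] exI[of _ p] exI[of _ p']) auto
  then show ?thesis using that by blast
qed

lemma lead_mult:
  assumes "lead z a" "lead w b"
  shows "lead (z * w) (a + b)"
proof -
  obtain c p q c' p' q' where *: "c \<noteq> 0" "p - 1 \<in> pos" "q - 1 \<in> pos" "z = emb c * mon a * (p / q)"
    "c' \<noteq> 0" "p' - 1 \<in> pos" "q' - 1 \<in> pos" "w = emb c' * mon b * (p' / q')"
    "a \<in> exps" "b \<in> exps"
    using assms by (auto simp: lead_def)
  have "z * w = emb (c * c') * mon (a + b) * ((p * p') / (q * q'))"
    using * by (simp add: emb_mult mon_add)
  then show ?thesis
    using * unfolding lead_def
    by (intro conjI exI[of _ "c * c'"] exI[of _ "p * p'"] exI[of _ "q * q'"])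
      (auto intro: principal_unit_mult)
qed

lemma lead_nonneg:
  assumes "lead z a" "z \<in> valring"
  shows "v a \<ge> 0"
proof -
  obtain c p q where *: "c \<noteq> 0" "p - 1 \<in> pos" "q - 1 \<in> pos" "z = emb c * mon a * (p / q)" "a \<in> exps"
    using assms by (auto simp: lead_def)
  have "mon a = emb (inverse c) * (z * (q * inverse p))"
    using *(1,4) principal_unit(1)[OF *(2)] principal_unit(1)[OF *(3)] by (simp add: emb_inverse)
  also have "\<dots> \<in> valring"
    using nonneg_subset_valring principal_unit[OF *(3)] inverse_principal_unit[OF *(2)] assms
    by (intro k_subalgebraD[OF valring_subalgebra]) auto
  finally show ?thesis using mon_in_valring_iff * by auto
qed

lemma lead_inverse:
  assumes "lead z a"
  shows "lead (inverse z) (- a)"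
proof -
  obtain c p q where *: "c \<noteq> 0" "p - 1 \<in> pos" "q - 1 \<in> pos" "z = emb c * mon a * (p / q)" "a \<in> exps"
    using assms by (auto simp: lead_def)
  have "inverse z = emb (inverse c) * mon (- a) * (q / p)"
    unfolding *(4) by (simp add: emb_inverse mon_minus divide_inverse mult_ac)
  then show ?thesis unfolding lead_def using *
    by (intro conjI exI[of _ "inverse c"] exI[of _ q] exI[of _ p]) auto
qed

lemma lead_1: "lead 1 0"
  unfolding lead_def using pos_0
  by (intro conjI exI[of _ 1]) auto

lemma lead_nonzero: "lead z a \<Longrightarrow> z \<noteq> 0"
  using principal_unit by (auto simp: lead_def)

text \<open>Both \<open>a - b\<close> and \<open>b - a\<close> are leading exponents of
  \<open>1\<close>, hence have nonnegative value.\<close>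

lemma lead_unique:
  assumes "lead z a" "lead z b"
  shows "a = b"
proof -
  have "lead 1 (a + - b)" "lead 1 (b + - a)"
    using lead_mult[OF assms(1) lead_inverse[OF assms(2)]] lead_nonzero[OF assms(1)]
      lead_mult[OF assms(2) lead_inverse[OF assms(1)]] by auto
  then have "v (a + - b) \<ge> 0" "v (b + - a) \<ge> 0"
    using lead_nonneg k_subalgebraD(3)[OF valring_subalgebra] by auto
  then have "v (a - b) = 0" by (simp add: v_diff)
  moreover have "a - b \<in> exps" using assms by (auto simp: lead_def)
  ultimately have "a - b = 0" using v_inj by blast
  then show ?thesis by simp
qed

lemma lead_power:
  assumes "lead z a"
  shows "lead (z ^ m) (\<lambda>i. int m * a i)"
proof (induct m)
  case 0
  then show ?case using lead_1 by (simp add: zero_fun_def)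
next
  case (Suc m)
  have "(\<lambda>i. int (Suc m) * a i) = a + (\<lambda>i. int m * a i)" by (auto simp: algebra_simps)
  then show ?case using lead_mult[OF assms Suc] by (simp only: power_Suc)
qed

lemma lead_in_span:
  assumes "lead f a" "f \<in> kv.span (mon ` S)" "S \<subseteq> exps"
  shows "a \<in> S"
proof -
  obtain b c p where b: "b \<in> S" "c \<noteq> 0" "p - 1 \<in> pos" "f = emb c * mon b * p"
    using lead_span[OF assms(2,3) lead_nonzero[OF assms(1)]] by blast
  have "lead f b"
    unfolding lead_def using b assms pos_0
    by (intro conjI exI[of _ c] exI[of _ p] exI[of _ 1]) auto
  then show ?thesis using lead_unique[OF assms(1)] b by auto
qed

text \<open>The factors \<open>p\<close> and \<open>q\<close> differ by an element of
  \<open>pos\<close>, so removing the leading term leaves zero or something of larger value.\<close>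

lemma lead_step:
  assumes "lead z a"
  obtains c where "z = emb c * mon a"
  | c b where "lead (z - emb c * mon a) b" "v a < v b"
proof -
  obtain c p q where *: "c \<noteq> 0" "p - 1 \<in> pos" "q - 1 \<in> pos" "z = emb c * mon a * (p / q)" "a \<in> exps"
    using assms by (auto simp: lead_def)
  note q = principal_unit[OF *(3)]
  have pq: "p - q \<in> pos" using pos_diff[OF *(2,3)] by simp
  have eq: "z - emb c * mon a = emb c * mon a * ((p - q) / q)"
    unfolding *(4) diff_divide_distrib right_diff_distrib using q(1) by simp
  show ?thesis
  proof (cases "p - q = 0")
    case True
    then show ?thesis using that(1)[of c] eq by simp
  next
    case False
    obtain b c' p' where b: "b \<in> exps" "v b > 0" "c' \<noteq> 0" "p' - 1 \<in> pos" "p - q = emb c' * mon b * p'"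
      using lead_span[OF pq[unfolded pos_def] _ False] by blast
    have "z - emb c * mon a = emb (c * c') * mon (a + b) * (p' / q)"
      unfolding eq b by (simp add: emb_mult mon_add)
    then have "lead (z - emb c * mon a) (a + b)"
      unfolding lead_def using b *
      by (intro conjI exI[of _ "c * c'"] exI[of _ p'] exI[of _ q]) auto
    then show ?thesis using that(2) b by (auto simp: v_add)
  qed
qed

text \<open>Through this a center exists on a projective model: one of finitely many homogeneous
  coordinates divides all the others.\<close>

lemma valring_total: "z \<in> valring \<or> inverse z \<in> valring"
proof (cases "z = 0")
  case True
  then show ?thesis using k_subalgebraD(2)[OF valring_subalgebra] by auto
next
  case False
  have *: "z \<in> valring" if lead: "lead z a" and "v a \<ge> 0" for z a
  proof -
    obtain c p q where *: "p - 1 \<in> pos" "q - 1 \<in> pos" "z = emb c * mon a * (p / q)" "a \<in> exps"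
      using lead by (auto simp: lead_def)
    have "mon a \<in> nonneg" using * that by (auto simp: nonneg_def intro: kv.span_base)
    then have "emb c * mon a * p \<in> nonneg"
      using principal_unit[OF *(1)] by (intro k_subalgebraD[OF nonneg_subalgebra]) auto
    moreover have "z = (emb c * mon a * p) / q" using * by simp
    ultimately show ?thesis using * unfolding valring_def by blast
  qed
  obtain a where a: "lead z a" using lead_exists[OF False] .
  show ?thesis
  proof (cases "v a \<ge> 0")
    case False
    then have "v (- a) \<ge> 0" by (simp add: v_minus)
    then show ?thesis using *[OF lead_inverse[OF a]] by simp
  qed (use * a in auto)
qed

text \<open>The leading exponent \<open>a\<close> of \<open>z\<close> satisfies \<open>b + m a \<in> S\<close> for all \<open>m\<close>, where \<open>b\<close> is that of \<open>d\<close>.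
  So the leading term of \<open>z\<close> lies in the algebra and can be subtracted, and this stops.\<close>

lemma completely_integrally_closed:
  assumes S: "S \<subseteq> exps" "0 \<in> S" "\<And>a b. a \<in> S \<Longrightarrow> b \<in> S \<Longrightarrow> a + b \<in> S"
    and sat: "\<And>a b. a \<in> exps \<Longrightarrow> b \<in> S \<Longrightarrow> (\<And>m. b + (\<lambda>i. int m * a i) \<in> S) \<Longrightarrow> a \<in> S"
    and fin: "\<And>a. a \<in> S \<Longrightarrow> finite {b \<in> S. v a \<le> v b}"
    and d: "d \<noteq> 0" "\<And>m. d * z ^ m \<in> kv.span (mon ` S)"
  shows "z \<in> kv.span (mon ` S)"
proof -
  note A = k_subalgebraD[OF k_subalgebra_span_mon[OF S(2,3)]]
  have inS: "a \<in> S" if z: "lead z a" "\<And>m. d * z ^ m \<in> kv.span (mon ` S)" for a z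
  proof -
    obtain b where b: "lead d b" using lead_exists[OF d(1)] .
    have "b + (\<lambda>i. int m * a i) \<in> S" for m
      by (rule lead_in_span[OF lead_mult[OF b lead_power[OF z(1)]] z(2) S(1)])
    moreover from this[of 0] have "b \<in> S" by (simp add: zero_fun_def[symmetric])
    ultimately show ?thesis using sat[of a b] z(1) by (auto simp: lead_def)
  qed
  have "z \<in> kv.span (mon ` S)" if "lead z a" "\<And>m. d * z ^ m \<in> kv.span (mon ` S)" for a z
    using that
  proof (induction "card {b \<in> S. v a \<le> v b}" arbitrary: a z rule: less_induct)
    case less
    have a: "a \<in> S" by (rule inS[OF less.prems])
    have ma: "mon a \<in> kv.span (mon ` S)" using a by (auto intro: kv.span_base)
    from less.prems(1) show ?case
    proof (cases rule: lead_step)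
      case (1 c)
      then show ?thesis using ma by (auto intro: kv.span_scale)
    next
      case (2 c b)
      define t where "t = emb c * mon a"
      have t: "t \<in> kv.span (mon ` S)" using ma by (auto simp: t_def intro: kv.span_scale)
      \<comment> \<open>The same \<open>d\<close> is a common denominator for the powers of
        \<open>z - t\<close>, by the binomial expansion; so the induction hypothesis applies to
        \<open>z - t\<close>.\<close>
      have "d * (z - t) ^ m \<in> kv.span (mon ` S)" for m
      proof -
        have "d * (z + - t) ^ m = (\<Sum>k\<le>m. emb (of_nat (m choose k)) * ((d * z ^ k) * (- t) ^ (m - k)))"
          unfolding binomial_ring sum_distrib_left by (simp add: emb_of_nat mult_ac)
        also have "\<dots> \<in> kv.span (mon ` S)"
          by (intro kv.span_sum A less.prems(2) t)
        finally show ?thesis by simp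
      qed
      note zt = this
      have l: "lead (z - t) b" using 2 by (simp add: t_def)
      have "a \<in> {e \<in> S. v a \<le> v e} - {e \<in> S. v b \<le> v e}" using a 2 by auto
      moreover have "{e \<in> S. v b \<le> v e} \<subseteq> {e \<in> S. v a \<le> v e}" using 2 by auto
      ultimately have "{e \<in> S. v b \<le> v e} \<subset> {e \<in> S. v a \<le> v e}" by blast
      then have "card {e \<in> S. v b \<le> v e} < card {e \<in> S. v a \<le> v e}"
        by (intro psubset_card_mono fin a)
      then have "z - t \<in> kv.span (mon ` S)" using l zt by (rule less.hyps)
      then have "z - t + t \<in> kv.span (mon ` S)" using t by (rule kv.span_add)
      then show ?thesis by simp
    qed
  qed
  then show ?thesis
    using lead_exists[of z] kv.span_zero[of "mon ` S"] d by metis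
qed

end

text \<open>Used with two fields: for derivations as a space over \<open>K\<close>, and for
  functionals on \<open>G\<close> as a space over \<open>k\<close>.\<close>

interpretation fnv: vector_space "\<lambda>(c::'a::field) (f::'d \<Rightarrow> 'a) z. c * f z"
  by unfold_locales (auto simp: algebra_simps)

declare fnv.scale_scale [simp del]

section \<open>Derivations and the stalks of the differentials\<close>

context embedded_field
begin

lemma emb_of_int: "emb (of_int m) = of_int m"
  by (cases m) (simp_all add: emb_of_nat emb_minus emb_diff)

lemma derivationD:
  assumes "k_derivation emb \<delta>"
  shows "\<delta> (a + b) = \<delta> a + \<delta> b" "\<delta> (a * b) = a * \<delta> b + b * \<delta> a" "\<delta> (emb c) = 0"
    "\<delta> 0 = 0" "\<delta> 1 = 0"
  using assms emb_0 emb_1 unfolding k_derivation_def by metis+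

lemma derivation_divide:
  assumes d: "k_derivation emb \<delta>" and b: "b \<noteq> 0"
  shows "\<delta> (a / b) = inverse b * \<delta> a + (- a * inverse b * inverse b) * \<delta> b"
proof -
  have "\<delta> a = \<delta> ((a / b) * b)" using b by simp
  also have "\<dots> = (a / b) * \<delta> b + b * \<delta> (a / b)" by (rule derivationD(2)[OF d])
  finally show ?thesis using b by (simp add: divide_simps algebra_simps)
qed

lemma log_derivation_mult:
  assumes "k_derivation emb \<delta>" "a \<noteq> 0" "b \<noteq> 0"
  shows "\<delta> (a * b) / (a * b) = \<delta> a / a + \<delta> b / b"
  using assms by (simp add: derivationD(2)[OF assms(1)] divide_simps)

lemma log_derivation_inverse:
  assumes "k_derivation emb \<delta>" "a \<noteq> 0"
  shows "\<delta> (inverse a) / inverse a = - (\<delta> a / a)"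
  using log_derivation_mult[OF assms(1), of a "inverse a"] assms derivationD(5)[OF assms(1)]
  by (simp add: eq_neg_iff_add_eq_0 add.commute)

lemma log_derivation_power:
  assumes "k_derivation emb \<delta>" "a \<noteq> 0"
  shows "\<delta> (a ^ m) / a ^ m = of_nat m * (\<delta> a / a)"
proof (induct m)
  case (Suc m)
  have "\<delta> (a * a ^ m) / (a * a ^ m) = \<delta> a / a + of_nat m * (\<delta> a / a)"
    using log_derivation_mult[OF assms(1,2), of "a ^ m"] assms(2) Suc by simp
  then show ?case by (simp add: distrib_right del: times_divide_eq_right)
qed (use derivationD[OF assms(1)] in simp)

lemma log_derivation_powi:
  assumes "k_derivation emb \<delta>" "a \<noteq> 0"
  shows "\<delta> (a powi m) / (a powi m) = of_int m * (\<delta> a / a)"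
  using log_derivation_power[OF assms, of "nat m"]
    log_derivation_power[OF assms(1), of "inverse a" "nat (- m)"]
    log_derivation_inverse[OF assms] assms
  by (cases "m \<ge> 0") (simp_all add: power_int_def of_nat_nat del: times_divide_eq_right)

lemma log_derivation_prod:
  assumes "k_derivation emb \<delta>" "\<And>i. i \<in> I \<Longrightarrow> f i \<noteq> 0"
  shows "\<delta> (prod f I) / prod f I = (\<Sum>i\<in>I. \<delta> (f i) / f i)"
  using assms(2)
proof (induct I rule: infinite_finite_induct)
  case (insert i I)
  then show ?case using log_derivation_mult[OF assms(1), of "f i" "prod f I"] by simp
qed (simp_all add: derivationD[OF assms(1)])

section \<open>Modules over a local subring, and the stalks of the differentials\<close>

inductive_set submodule_span :: "'K set \<Rightarrow> ('d \<Rightarrow> 'K) set \<Rightarrow> ('d \<Rightarrow> 'K) set"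
  for R :: "'K set" and E :: "('d \<Rightarrow> 'K) set" where
  zero: "(\<lambda>_. 0) \<in> submodule_span R E"
| step: "c \<in> R \<Longrightarrow> e \<in> E \<Longrightarrow> y \<in> submodule_span R E \<Longrightarrow> (\<lambda>\<delta>. c * e \<delta> + y \<delta>) \<in> submodule_span R E"

lemma submodule_span_add:
  assumes "y \<in> submodule_span R E" "y' \<in> submodule_span R E"
  shows "(\<lambda>\<delta>. y \<delta> + y' \<delta>) \<in> submodule_span R E"
  using assms
proof (induct rule: submodule_span.induct)
  case (step c e y)
  then show ?case using submodule_span.step[of c R e E "\<lambda>\<delta>. y \<delta> + y' \<delta>"] by (simp add: add.assoc)
qed simp

lemma submodule_span_scale:
  assumes "k_subalgebra emb R" "a \<in> R" "y \<in> submodule_span R E"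
  shows "(\<lambda>\<delta>. a * y \<delta>) \<in> submodule_span R E"
  using assms(3)
proof (induct rule: submodule_span.induct)
  case zero
  then show ?case using submodule_span.zero by simp
next
  case (step c e y)
  then show ?case
    using submodule_span.step[of "a * c" R e E "\<lambda>\<delta>. a * y \<delta>"] k_subalgebraD(5)[OF assms(1,2)]
    by (simp add: algebra_simps)
qed

lemma submodule_span_base:
  assumes "k_subalgebra emb R" "e \<in> E"
  shows "e \<in> submodule_span R E"
  using submodule_span.step[OF k_subalgebraD(3)[OF assms(1)] assms(2) submodule_span.zero] by simp

lemma submodule_span_sum:
  assumes "k_subalgebra emb R" "\<And>i. i \<in> I \<Longrightarrow> c i \<in> R" "\<And>i. i \<in> I \<Longrightarrow> y i \<in> submodule_span R E"
  shows "(\<lambda>\<delta>. \<Sum>i\<in>I. c i * y i \<delta>) \<in> submodule_span R E"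
  using assms(2,3)
proof (induct I rule: infinite_finite_induct)
  case (insert i I)
  have "(\<lambda>\<delta>. c i * y i \<delta>) \<in> submodule_span R E"
    using insert by (intro submodule_span_scale[OF assms(1)]) auto
  moreover have "(\<lambda>\<delta>. \<Sum>i\<in>I. c i * y i \<delta>) \<in> submodule_span R E" using insert by auto
  ultimately show ?case using submodule_span_add insert by fastforce
qed (simp_all add: submodule_span.zero)

lemma is_free_basisD:
  assumes "is_free_basis R M r w"
  shows "j < r \<Longrightarrow> w j \<in> M"
    "\<eta> \<in> M \<Longrightarrow> \<exists>c. (\<forall>j<r. c j \<in> R) \<and> \<eta> = (\<lambda>\<delta>. \<Sum>j<r. c j * w j \<delta>)"
    "(\<And>j. j < r \<Longrightarrow> c j \<in> R) \<Longrightarrow> (\<And>\<delta>. (\<Sum>j<r. c j * w j \<delta>) = 0) \<Longrightarrow> i < r \<Longrightarrow> c i = 0"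
  using assms unfolding is_free_basis_def by blast+

lemma free_basis_coeffs_unique:
  assumes R: "k_subalgebra emb R" and w: "is_free_basis R M r w"
    and c: "\<And>j. j < r \<Longrightarrow> c j \<in> R" "\<And>j. j < r \<Longrightarrow> c' j \<in> R"
    and eq: "\<And>\<delta>. (\<Sum>j<r. c j * w j \<delta>) = (\<Sum>j<r. c' j * w j \<delta>)" and i: "i < r"
  shows "c i = c' i"
proof -
  have "c i - c' i = 0"
  proof (rule is_free_basisD(3)[OF w _ _ i, of "\<lambda>j. c j - c' j"])
    show "(\<Sum>j<r. (c j - c' j) * w j \<delta>) = 0" for \<delta>
      using eq by (simp add: left_diff_distrib sum_subtractf)
  qed (use c k_subalgebraD(7)[OF R] in blast)
  then show ?thesis by simp
qed

text \<open>If all generators had a nonunit as \<open>m\<close>-th coefficient, then so would \<open>w m\<close>.\<close>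

lemma free_basis_exchange:
  assumes loc: "local_algebra R" and w: "is_free_basis R M r w"
    and E: "E \<subseteq> M" "M \<subseteq> submodule_span R E" and m: "m < r"
  obtains e where "e \<in> E" "is_free_basis R M r (w(m := e))"
proof -
  note R = local_algebraD(1)[OF loc]
  note RD = k_subalgebraD[OF R]
  have "\<exists>e\<in>E. \<exists>d. (\<forall>j<r. d j \<in> R) \<and> e = (\<lambda>\<delta>. \<Sum>j<r. d j * w j \<delta>) \<and> d m \<notin> nonunits R"
  proof (rule ccontr)
    assume no: "\<not> ?thesis"
    have "\<exists>c. (\<forall>j<r. c j \<in> R) \<and> y = (\<lambda>\<delta>. \<Sum>j<r. c j * w j \<delta>) \<and> c m \<in> nonunits R"
      if "y \<in> submodule_span R E" for y
      using that
    proof (induct rule: submodule_span.induct)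
      case zero
      then show ?case using RD(2) by (intro exI[of _ "\<lambda>_. 0"]) (auto simp: nonunits_def)
    next
      case (step a e y)
      obtain c where c: "\<forall>j<r. c j \<in> R" "y = (\<lambda>\<delta>. \<Sum>j<r. c j * w j \<delta>)" "c m \<in> nonunits R"
        using step by blast
      obtain d where d: "\<forall>j<r. d j \<in> R" "e = (\<lambda>\<delta>. \<Sum>j<r. d j * w j \<delta>)"
        using is_free_basisD(2)[OF w, of e] step E by blast
      have "d m \<in> nonunits R" using no step d by blast
      then have "a * d m + c m \<in> nonunits R"
        using step c by (intro local_algebraD(2)[OF loc] nonunits_mult[OF R])
      then show ?case
        using c d step by (intro exI[of _ "\<lambda>j. a * d j + c j"])
          (auto simp: sum_distrib_left sum.distrib algebra_simps intro!: RD)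
    qed
    then obtain c where c: "\<forall>j<r. c j \<in> R" "w m = (\<lambda>\<delta>. \<Sum>j<r. c j * w j \<delta>)" "c m \<in> nonunits R"
      using is_free_basisD(1)[OF w m] E by blast
    have "c m = (if m = m then 1 else 0)"
    proof (rule free_basis_coeffs_unique[OF R w _ _ _ m, of c "\<lambda>j. if j = m then 1 else 0"])
      show "(\<Sum>j<r. c j * w j \<delta>) = (\<Sum>j<r. (if j = m then 1 else 0) * w j \<delta>)" for \<delta>
        using fun_cong[OF c(2), of \<delta>] m by (simp add: if_distrib[of "\<lambda>a. a * _"] cong: if_cong)
    qed (use c RD(2,3) in auto)
    then show False using c one_notin_nonunits by simp
  qed
  then obtain e d where e: "e \<in> E" and d: "\<forall>j<r. d j \<in> R" "e = (\<lambda>\<delta>. \<Sum>j<r. d j * w j \<delta>)" "d m \<notin> nonunits R"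
    by blast
  have dm: "d m \<noteq> 0" "inverse (d m) \<in> R" using d m by (auto simp: nonunits_def)
  \<comment> \<open>Here \<open>e\<close> is \<open>d m * w m\<close> plus multiples of the other
    \<open>w j\<close>, with \<open>d m\<close> a unit. The passage between old and new coordinates
    is therefore triangular; it is inverted by the \<open>c\<close> defined further down.\<close>
  have split: "(\<Sum>j<r. c j * (w(m := e)) j \<delta>) =
      (\<Sum>j<r. (if j = m then c m * d m else c j + c m * d j) * w j \<delta>)" for c \<delta>
  proof -
    have "(\<Sum>j<r. c j * (w(m := e)) j \<delta>) = c m * e \<delta> + (\<Sum>j\<in>{..<r} - {m}. c j * w j \<delta>)"
      using m by (subst sum.remove[of _ m]) (auto intro!: sum.cong)
    also have "e \<delta> = d m * w m \<delta> + (\<Sum>j\<in>{..<r} - {m}. d j * w j \<delta>)"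
      using m d by (simp add: sum.remove[of _ m])
    also have "c m * \<dots> + (\<Sum>j\<in>{..<r} - {m}. c j * w j \<delta>) =
        c m * d m * w m \<delta> + (\<Sum>j\<in>{..<r} - {m}. (c j + c m * d j) * w j \<delta>)"
      by (simp add: distrib_left distrib_right sum.distrib sum_distrib_left mult.assoc)
    also have "\<dots> = (\<Sum>j<r. (if j = m then c m * d m else c j + c m * d j) * w j \<delta>)"
      using m by (subst (2) sum.remove[of _ m]) (auto intro!: sum.cong)
    finally show ?thesis .
  qed
  have "is_free_basis R M r (w(m := e))"
    unfolding is_free_basis_def
  proof (intro conjI allI impI ballI)
    show "(w(m := e)) j \<in> M" if "j < r" for j
      using that is_free_basisD(1)[OF w] e E by auto
    show "\<exists>c. (\<forall>j<r. c j \<in> R) \<and> \<eta> = (\<lambda>\<delta>. \<Sum>j<r. c j * (w(m := e)) j \<delta>)" if "\<eta> \<in> M" for \<eta>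
    proof -
      obtain b where b: "\<forall>j<r. b j \<in> R" "\<eta> = (\<lambda>\<delta>. \<Sum>j<r. b j * w j \<delta>)"
        using is_free_basisD(2)[OF w \<open>\<eta> \<in> M\<close>] by blast
      define c where "c = (\<lambda>j. if j = m then b m * inverse (d m) else b j - b m * inverse (d m) * d j)"
      have "(if j = m then c m * d m else c j + c m * d j) = b j" for j
        using dm by (auto simp: c_def)
      then have "\<eta> = (\<lambda>\<delta>. \<Sum>j<r. c j * (w(m := e)) j \<delta>)" unfolding split b by simp
      moreover have "\<forall>j<r. c j \<in> R" using b d dm m by (auto simp: c_def intro!: RD)
      ultimately show ?thesis by blast
    qed
    fix c j assume c: "(\<forall>j<r. c j \<in> R) \<and> (\<forall>\<delta>. (\<Sum>j<r. c j * (w(m := e)) j \<delta>) = 0)" and j: "j < r"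
    define b where "b = (\<lambda>j. if j = m then c m * d m else c j + c m * d j)"
    have b: "b i = 0" if "i < r" for i
    proof (rule is_free_basisD(3)[OF w _ _ that])
      show "b j \<in> R" if "j < r" for j using that c d m by (auto simp: b_def intro!: RD)
      show "(\<Sum>j<r. b j * w j \<delta>) = 0" for \<delta> using c split by (simp add: b_def)
    qed
    have "c m = 0" using b[OF m] dm by (simp add: b_def)
    then show "c j = 0" using b[OF j] by (auto simp: b_def split: if_splits)
  qed
  then show ?thesis using that e by blast
qed

text \<open>Steinitz exchange over a local ring: step \<open>m\<close> changes position
  \<open>m\<close> only, so the earlier replacements survive.\<close>

lemma free_basis_from_generators:
  assumes loc: "local_algebra R" and w: "is_free_basis R M r w"
    and E: "E \<subseteq> M" "M \<subseteq> submodule_span R E"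
  obtains w' where "is_free_basis R M r w'" "\<And>j. j < r \<Longrightarrow> w' j \<in> E"
proof -
  have "m \<le> r \<Longrightarrow> \<exists>w'. is_free_basis R M r w' \<and> (\<forall>j<m. w' j \<in> E)" for m
  proof (induct m)
    case 0
    then show ?case using w by auto
  next
    case (Suc m)
    then obtain w' where w': "is_free_basis R M r w'" "\<forall>j<m. w' j \<in> E" by auto
    have "m < r" using Suc by simp
    obtain e where e: "e \<in> E" "is_free_basis R M r (w'(m := e))"
      using free_basis_exchange[OF loc w'(1) E \<open>m < r\<close>] by blast
    have "\<forall>j<Suc m. (w'(m := e)) j \<in> E" using w' e by (auto simp: less_Suc_eq)
    then show ?case using e by blast
  qed
  then show ?thesis using that by blast
qed

lemma omega_stalkI:
  assumes "k_subalgebra emb R" "a \<in> R"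
  shows "differential L a \<in> omega_stalk L R"
  unfolding omega_stalk_def using assms k_subalgebraD(3)[OF assms(1)]
  by (intro CollectI exI[of _ "{a}"] exI[of _ "\<lambda>_. 1"]) auto

lemma omega_stalk_subset:
  assumes R: "k_subalgebra emb R"
    and *: "\<And>a. a \<in> R \<Longrightarrow> differential L a \<in> submodule_span R E"
  shows "omega_stalk L R \<subseteq> submodule_span R E"
  unfolding omega_stalk_def
  by (auto intro!: submodule_span_sum[OF R] *)

text \<open>By the sum and product rules, the elements of \<open>R\<close> whose differential lies
  in the span form an algebra. It contains \<open>F\<close>, hence \<open>A\<close>, and the
  quotient rule with unit denominators extends this to \<open>R\<close>.\<close>

lemma differential_in_submodule_span:
  assumes R: "R \<in> local_rings A" and A: "A = k_subalgebra emb hull F"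
    and L: "\<And>\<delta>. \<delta> \<in> L \<Longrightarrow> k_derivation emb \<delta>"
    and gen: "\<And>a. a \<in> F \<Longrightarrow> differential L a \<in> submodule_span R E"
    and a: "a \<in> R"
  shows "differential L a \<in> submodule_span R E"
proof -
  have subA: "k_subalgebra emb A" by (simp add: A)
  note RD = local_ringsD[OF subA R]
  define N where "N = {a \<in> R. differential L a \<in> submodule_span R E}"
  have comb: "differential L z \<in> submodule_span R E"
    if "a \<in> N" "b \<in> N" "c \<in> R" "d \<in> R" "\<And>\<delta>. k_derivation emb \<delta> \<Longrightarrow> \<delta> z = c * \<delta> a + d * \<delta> b"
    for a b c d z
  proof -
    have "differential L z = (\<lambda>\<delta>. c * differential L a \<delta> + d * differential L b \<delta>)"
      using that(5) L by (auto simp: differential_def)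
    then show ?thesis
      using that by (auto simp: N_def intro!: submodule_span_add submodule_span_scale[OF RD(2)])
  qed
  have "k_subalgebra emb N"
    unfolding k_subalgebra_def
  proof (intro conjI ballI)
    have "differential L (emb c) = (\<lambda>_. 0)" for c
      using L derivationD(3) by (auto simp: differential_def)
    then show "range emb \<subseteq> N"
      using k_subalgebraD(1)[OF RD(2)] submodule_span.zero by (auto simp: N_def)
    fix a b assume ab: "a \<in> N" "b \<in> N"
    then have "a \<in> R" "b \<in> R" by (auto simp: N_def)
    then show "a + b \<in> N" "a * b \<in> N"
      using comb[of a b 1 1 "a + b"] comb[of a b b a "a * b"] ab
        k_subalgebraD(3,4,5)[OF RD(2)] derivationD(1,2)
      by (auto simp: N_def add.commute)
  qed
  moreover have "F \<subseteq> N" using gen RD(3) A by (auto simp: N_def intro: hull_inc)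
  ultimately have AN: "A \<subseteq> N" unfolding A by (simp add: subset_hull)
  obtain p q where pq: "p \<in> A" "q \<in> A" "q \<noteq> 0" "inverse q \<in> R" "a = p / q"
    using local_rings_denominator[OF subA R a] .
  show ?thesis
    using pq AN RD(3) derivation_divide
    by (intro comb[of p q "inverse q" "- p * inverse q * inverse q"])
      (auto intro!: k_subalgebraD[OF RD(2)])
qed

end

section \<open>Derivations of the function field, and weights of monomials\<close>

context rational_functions
begin

definition weight :: "(nat \<Rightarrow> 'g \<Rightarrow> 'k) \<Rightarrow> (nat \<Rightarrow> int) \<Rightarrow> 'g \<Rightarrow> 'k" where
  "weight \<alpha> a s = (\<Sum>i<n. of_int (a i) * \<alpha> i s)"

lemma weight_add: "weight \<alpha> (a + b) s = weight \<alpha> a s + weight \<alpha> b s"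
  by (simp add: weight_def sum.distrib distrib_right)

lemma weight_diff: "weight \<alpha> (a - b) s = weight \<alpha> a s - weight \<alpha> b s"
  by (simp add: weight_def sum_subtractf left_diff_distrib)

lemma weight_unit: "i < n \<Longrightarrow> weight \<alpha> (unit_exp i) s = \<alpha> i s"
  unfolding weight_def by (subst sum.remove[of _ i]) (auto intro!: sum.neutral)

lemma derivation_mon:
  assumes "k_derivation emb \<delta>"
  shows "\<delta> (mon a) / mon a = (\<Sum>i<n. of_int (a i) * (\<delta> (x i) / x i))"
proof -
  have "\<delta> (mon a) / mon a = (\<Sum>i<n. \<delta> (x i powi a i) / (x i powi a i))"
    unfolding mon_def by (rule log_derivation_prod[OF assms]) auto
  also have "\<dots> = (\<Sum>i<n. of_int (a i) * (\<delta> (x i) / x i))"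
    by (rule sum.cong[OF refl], rule log_derivation_powi[OF assms]) auto
  finally show ?thesis .
qed

lemma acts_mon:
  assumes "acts_as_derivation emb n x \<alpha> s \<delta>"
  shows "\<delta> (mon a) / mon a = emb (weight \<alpha> a s)"
proof -
  have d: "k_derivation emb \<delta>" and x: "\<And>i. i < n \<Longrightarrow> \<delta> (x i) = emb (\<alpha> i s) * x i"
    using assms by (auto simp: acts_as_derivation_def)
  show ?thesis
    unfolding derivation_mon[OF d] weight_def emb_sum
    by (intro sum.cong refl) (simp add: x emb_mult emb_of_int)
qed

lemma independent_mon: "kv.independent (mon ` exps)"
proof
  assume "kv.dependent (mon ` exps)"
  then obtain a where a: "a \<in> exps" "mon a \<in> kv.span (mon ` exps - {mon a})"
    by (auto simp: kv.dependent_def)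
  have "mon ` exps - {mon a} = mon ` (exps - {a})"
    using inj_on_mon a(1) by (auto simp: inj_on_def)
  then show False using a mon_notin_span[of a "exps - {a}"] by auto
qed

text \<open>The monomials are independent over \<open>k\<close>, so \<open>D\<close> can be
  prescribed on them and extended linearly to all of \<open>K\<close>. The Leibniz rule is claimed
  only on \<open>laurent\<close>, where bilinearity reduces it to pairs of monomials.\<close>

lemma laurent_derivation:
  obtains D :: "'K \<Rightarrow> 'K" where
    "\<And>f g. D (f + g) = D f + D g" "\<And>c f. D (emb c * f) = emb c * D f"
    "\<And>a. a \<in> exps \<Longrightarrow> D (mon a) = emb (\<Sum>i<n. of_int (a i) * c i) * mon a"
    "\<And>f g. f \<in> laurent \<Longrightarrow> g \<in> laurent \<Longrightarrow> D (f * g) = f * D g + g * D f"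
proof -
  interpret kp: vector_space_pair "\<lambda>c z. emb c * z" "\<lambda>c z. emb c * z"
    by unfold_locales
  define t where "t = (\<lambda>a. emb (\<Sum>i<n. of_int (a i) * c i) * mon a)"
  obtain D where D: "Vector_Spaces.linear (\<lambda>c z. emb c * z) (\<lambda>c z. emb c * z) D"
    "\<And>z. z \<in> mon ` exps \<Longrightarrow> D z = t (inv_into exps mon z)"
    using kp.linear_independent_extend[OF independent_mon, of "\<lambda>z. t (inv_into exps mon z)"] by blast
  have add: "D (f + g) = D f + D g" and sc: "D (emb c * f) = emb c * D f" for f g c
    using kp.linear_add[OF D(1)] kp.linear_scale[OF D(1)] by auto
  have z: "D 0 = 0" using add[of 0 0] by (metis add_cancel_right_right add_0)
  have m: "D (mon a) = t a" if "a \<in> exps" for a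
    using D(2)[of "mon a"] inj_on_mon that by simp
  have sub: "kv.subspace {g. D (f * g) = f * D g + g * D f}" for f
  proof (rule kv.subspaceI)
    fix c g assume g: "g \<in> {g. D (f * g) = f * D g + g * D f}"
    have "D (f * (emb c * g)) = emb c * (f * D g + g * D f)"
      using g sc[of c "f * g"] by (simp only: mem_Collect_eq mult.left_commute[of f])
    also have "\<dots> = f * D (emb c * g) + (emb c * g) * D f"
      unfolding sc by (simp only: distrib_left mult.assoc mult.left_commute[of f])
    finally show "emb c * g \<in> {g. D (f * g) = f * D g + g * D f}" by simp
  next
    fix g h assume "g \<in> {g. D (f * g) = f * D g + g * D f}" "h \<in> {g. D (f * g) = f * D g + g * D f}"
    then show "g + h \<in> {g. D (f * g) = f * D g + g * D f}"
      unfolding mem_Collect_eq distrib_left add by (simp only: distrib_left distrib_right add_ac)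
  qed (simp add: z)
  have L1: "D (mon a * g) = mon a * D g + g * D (mon a)" if "a \<in> exps" "g \<in> laurent" for a g
    using that(2)
  proof (induct rule: kv.span_induct)
    case base
    show ?case by (rule sub)
  next
    case (step w)
    then obtain b where b: "b \<in> exps" "w = mon b" by auto
    have "D (mon a * w) = D (mon (a + b))" by (simp add: b mon_add)
    also have "\<dots> = t (a + b)" using that b by (intro m) auto
    also have "\<dots> = mon a * t b + mon b * t a"
    proof -
      have "(\<Sum>i<n. of_int ((a + b) i) * c i) = (\<Sum>i<n. of_int (a i) * c i) + (\<Sum>i<n. of_int (b i) * c i)"
        by (simp add: distrib_right sum.distrib)
      then show ?thesis unfolding t_def mon_add by (simp only: emb_add distrib_right) (simp add: mult_ac add.commute)
    qed
    finally show ?case using that b by (simp add: m)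
  qed
  have "D (f * g) = f * D g + g * D f" if "f \<in> laurent" "g \<in> laurent" for f g
    using that(1)
  proof (induct rule: kv.span_induct)
    case base
    show ?case using sub[of g] by (simp add: mult.commute add.commute)
  next
    case (step w)
    then show ?case using L1 that by auto
  qed
  then show ?thesis using that[of D] add sc m by (simp add: t_def)
qed

text \<open>The foliation is spanned by derivations of the whole field. Each prescription on the
  variables has to be realized there, or the span could be too small for the differentials to be
  independent.\<close>

lemma derivation_exists:
  obtains \<delta> where "k_derivation emb \<delta>" "\<And>i. i < n \<Longrightarrow> \<delta> (x i) = emb (c i) * x i"
proof -
  obtain D :: "'K \<Rightarrow> 'K" where D: "\<And>f g. D (f + g) = D f + D g" "\<And>c f. D (emb c * f) = emb c * D f"
    "\<And>a. a \<in> exps \<Longrightarrow> D (mon a) = emb (\<Sum>i<n. of_int (a i) * c i) * mon a"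
    "\<And>f g. f \<in> laurent \<Longrightarrow> g \<in> laurent \<Longrightarrow> D (f * g) = f * D g + g * D f"
    by (rule laurent_derivation[of c]) (rule that)
  note LD = k_subalgebraD[OF k_subalgebra_laurent]
  \<comment> \<open>One value that fits every Laurent denominator \<open>h\<close> is requested, so
    that the quotient rule can later be applied with any convenient denominator, such as
    \<open>g * g'\<close> for a sum or product.\<close>
  have "\<exists>\<delta>. \<forall>z h. h \<in> laurent \<and> h \<noteq> 0 \<and> z * h \<in> laurent \<longrightarrow> \<delta> z = (D (z * h) - z * D h) / h"
  proof (intro choice allI)
    fix z
    obtain f g where fg: "f \<in> B" "g \<in> B" "g \<noteq> 0" "z = f / g" by (rule fraction)
    then have g: "g \<in> laurent" "z * g \<in> laurent" using B_subset_laurent by auto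
    have "(D (z * g) - z * D g) / g = (D (z * h) - z * D h) / h"
      if h: "h \<in> laurent" "h \<noteq> 0" "z * h \<in> laurent" for h
    proof -
      \<comment> \<open>The Leibniz rule for the two factorizations \<open>(z * g) * h\<close> and
        \<open>(z * h) * g\<close> of one Laurent polynomial.\<close>
      have "(z * g) * D h + h * D (z * g) = (z * h) * D g + g * D (z * h)"
        using D(4)[OF g(2) h(1)] D(4)[OF h(3) g(1)] by (simp add: mult_ac)
      then have "h * (D (z * g) - z * D g) = g * (D (z * h) - z * D h)"
        by (simp add: algebra_simps)
      then show ?thesis using h(2) fg(3) by (simp add: divide_simps mult.commute)
    qed
    then show "\<exists>y. \<forall>h. h \<in> laurent \<and> h \<noteq> 0 \<and> z * h \<in> laurent \<longrightarrow> y = (D (z * h) - z * D h) / h"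
      by blast
  qed
  then obtain \<delta> where \<delta>: "\<And>z h. h \<in> laurent \<Longrightarrow> h \<noteq> 0 \<Longrightarrow> z * h \<in> laurent \<Longrightarrow> \<delta> z = (D (z * h) - z * D h) / h"
    by blast
  have D1: "D 1 = 0" using D(3)[of 0] by simp
  have on_laurent: "\<delta> f = D f" if "f \<in> laurent" for f
    using \<delta>[of 1 f] that LD(3) D1 by simp
  have sum_prod: "\<delta> (z + w) = \<delta> z + \<delta> w" "\<delta> (z * w) = z * \<delta> w + w * \<delta> z" for z w
  proof -
    obtain f g where fg: "f \<in> B" "g \<in> B" "g \<noteq> 0" "z = f / g" by (rule fraction)
    then have g: "g \<in> laurent" "z * g \<in> laurent" using B_subset_laurent by auto
    obtain f' g' where fg': "f' \<in> B" "g' \<in> B" "g' \<noteq> 0" "w = f' / g'" by (rule fraction)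
    then have g': "g' \<in> laurent" "w * g' \<in> laurent" using B_subset_laurent by auto
    have gg: "g * g' \<in> laurent" "g * g' \<noteq> 0" using g g' fg fg' LD(5) by auto
    have 1: "(z + w) * (g * g') = (z * g) * g' + (w * g') * g"
      and 2: "(z * w) * (g * g') = (z * g) * (w * g')" by (auto simp: algebra_simps)
    have l: "(z * g) * g' \<in> laurent" "(w * g') * g \<in> laurent" "(z * g) * (w * g') \<in> laurent"
      using g g' by (auto intro: LD(5))
    have "\<delta> (z + w) = (D ((z + w) * (g * g')) - (z + w) * D (g * g')) / (g * g')"
      by (rule \<delta>[OF gg]) (use 1 l LD(4) in auto)
    also have "\<dots> = (D (z * g) - z * D g) / g + (D (w * g') - w * D g') / g'"
      unfolding 1 D(1) D(4)[OF g(2) g'(1)] D(4)[OF g'(2) g(1)] D(4)[OF g(1) g'(1)]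
      using fg(3) fg'(3) by (simp add: divide_simps) (simp add: algebra_simps)
    finally show "\<delta> (z + w) = \<delta> z + \<delta> w" using \<delta>[OF g(1) fg(3) g(2)] \<delta>[OF g'(1) fg'(3) g'(2)] by simp
    have "\<delta> (z * w) = (D ((z * w) * (g * g')) - (z * w) * D (g * g')) / (g * g')"
      by (rule \<delta>[OF gg]) (simp only: 2 l(3))
    also have "\<dots> = z * ((D (w * g') - w * D g') / g') + w * ((D (z * g) - z * D g) / g)"
      unfolding 2 D(4)[OF g(2) g'(2)] D(4)[OF g(1) g'(1)]
      using fg(3) fg'(3) by (simp add: divide_simps) (simp add: algebra_simps)
    finally show "\<delta> (z * w) = z * \<delta> w + w * \<delta> z"
      using \<delta>[OF g(1) fg(3) g(2)] \<delta>[OF g'(1) fg'(3) g'(2)] by simp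
  qed
  show ?thesis
  proof
    show "k_derivation emb \<delta>"
      unfolding k_derivation_def
      using sum_prod on_laurent[OF LD(1)] D(2)[of _ 1] D1 by auto
    show "\<delta> (x i) = emb (c i) * x i" if "i < n" for i
    proof -
      have "(\<Sum>j<n. of_int (unit_exp i j) * c j) = c i"
        using that by (subst sum.remove[of _ i]) (auto intro!: sum.neutral)
      then show ?thesis
        using D(3)[of "unit_exp i"] on_laurent[OF mon_in_laurent[of "unit_exp i"]] that by simp
    qed
  qed
qed

lemma foliation_derivation_exists:
  obtains \<delta> where "acts_as_derivation emb n x \<alpha> s \<delta>" "\<delta> \<in> foliation emb n x \<alpha>"
proof -
  obtain \<delta> where "k_derivation emb \<delta>" "\<And>i. i < n \<Longrightarrow> \<delta> (x i) = emb (\<alpha> i s) * x i"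
    using derivation_exists[of "\<lambda>i. \<alpha> i s"] by metis
  then have "acts_as_derivation emb n x \<alpha> s \<delta>" by (simp add: acts_as_derivation_def)
  moreover from this have "\<delta> \<in> foliation emb n x \<alpha>"
    unfolding foliation_def by (intro fnv.span_base) auto
  ultimately show ?thesis using that by blast
qed

lemma foliation_derivation:
  assumes "\<delta> \<in> foliation emb n x \<alpha>"
  shows "k_derivation emb \<delta>"
  using assms unfolding foliation_def
proof (induct rule: fnv.span_induct)
  case base
  show ?case
    by (rule fnv.subspaceI) (auto simp: k_derivation_def algebra_simps)
qed (auto simp: acts_as_derivation_def)

text \<open>The claim is \<open>K\<close>-linear in \<delta>, and on the derivation of
  \<open>s\<close> the logarithmic derivative of a monomial is its weight at
  \<open>s\<close>.\<close>

lemma foliation_relation: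
  assumes "\<delta> \<in> foliation emb n x \<alpha>"
    and "\<And>s. (\<Sum>j\<in>J. \<mu> j * weight \<alpha> (a j) s) = 0"
  shows "(\<Sum>j\<in>J. emb (\<mu> j) * (\<delta> (mon (a j)) / mon (a j))) = 0"
  using assms(1) unfolding foliation_def
proof (induct rule: fnv.span_induct)
  case base
  show ?case
  proof (rule fnv.subspaceI)
    fix c \<delta> assume "\<delta> \<in> {\<delta>. (\<Sum>j\<in>J. emb (\<mu> j) * (\<delta> (mon (a j)) / mon (a j))) = 0}"
    then have "c * (\<Sum>j\<in>J. emb (\<mu> j) * (\<delta> (mon (a j)) / mon (a j))) = 0" by simp
    then show "(\<lambda>z. c * \<delta> z) \<in> {\<delta>. (\<Sum>j\<in>J. emb (\<mu> j) * (\<delta> (mon (a j)) / mon (a j))) = 0}"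
      unfolding sum_distrib_left by (simp add: mult_ac)
  qed (auto simp: add_divide_distrib distrib_left sum.distrib)
next
  case (step \<delta>)
  then obtain s where "acts_as_derivation emb n x \<alpha> s \<delta>" by auto
  then have "(\<Sum>j\<in>J. emb (\<mu> j) * (\<delta> (mon (a j)) / mon (a j))) = emb (\<Sum>j\<in>J. \<mu> j * weight \<alpha> (a j) s)"
    by (simp add: acts_mon emb_sum emb_mult)
  then show ?case using assms(2) by simp
qed

end

section \<open>Toric resolutions give natural coordinates of the roots\<close>

lemma sum_fun_apply: "(\<Sum>i\<in>I. f i) t = (\<Sum>i\<in>I. f i t)"
  by (induct I rule: infinite_finite_induct) auto

text \<open>Only terms with nonzero coefficient are required to lie in the span. Read
  contrapositively, this finds an index with nonzero coefficient whose function lies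
  outside.\<close>

lemma span_fun_image:
  fixes f :: "'i \<Rightarrow> 'd \<Rightarrow> 'a::field"
  assumes "\<And>t. g t = (\<Sum>i\<in>I. c i * f i t)" "\<And>i. i \<in> I \<Longrightarrow> c i \<noteq> 0 \<Longrightarrow> f i \<in> fnv.span F"
  shows "g \<in> fnv.span F"
proof -
  have "g = (\<Sum>i\<in>I. (\<lambda>t. c i * f i t))" using assms(1) by (auto simp: sum_fun_apply)
  also have "\<dots> \<in> fnv.span F"
  proof (rule fnv.span_sum)
    fix i assume "i \<in> I"
    then show "(\<lambda>t. c i * f i t) \<in> fnv.span F"
    proof (cases "c i = 0")
      case True
      then have "(\<lambda>t. c i * f i t) = 0" by auto
      then show ?thesis by (simp only: fnv.span_zero)
    qed (use assms(2) fnv.span_scale in auto)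
  qed
  finally show ?thesis .
qed

section \<open>Functionals on \<open>G\<close> and dual bases\<close>

context finite_dimensional_vector_space
begin

lemma dual_spaceD:
  assumes "f \<in> dual_space scale"
  shows "f (a + b) = f a + f b" "f (c *s a) = c * f a" "f 0 = 0"
    "f (\<Sum>i\<in>I. y i) = (\<Sum>i\<in>I. f (y i))"
proof -
  have f: "Vector_Spaces.linear (*s) (*) f" using assms by (simp add: dual_space_def)
  show "f (a + b) = f a + f b" "f (c *s a) = c * f a" using f by (auto simp: Vector_Spaces.linear_iff)
  interpret additive f by unfold_locales (use f in \<open>auto simp: Vector_Spaces.linear_iff\<close>)
  show "f 0 = 0" "f (\<Sum>i\<in>I. y i) = (\<Sum>i\<in>I. f (y i))" by (rule zero, rule sum)
qed

lemma dual_space_expand: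
  assumes "f \<in> dual_space scale"
  shows "f t = (\<Sum>b\<in>Basis. f b * representation Basis t b)"
proof -
  have "t = (\<Sum>b\<in>Basis. representation Basis t b *s b)"
    using sum_representation_eq[OF independent_Basis _ finite_Basis, of t] span_Basis by auto
  then have "f t = f (\<Sum>b\<in>Basis. representation Basis t b *s b)" by simp
  then show ?thesis by (simp add: dual_spaceD[OF assms] mult.commute)
qed

lemma coordinate_dual_space: "(\<lambda>t. representation Basis t b) \<in> dual_space scale"
  using linear_representation[OF independent_Basis span_Basis] by (simp add: dual_space_def)

lemma dual_space_subspace: "fnv.subspace (dual_space scale)"
proof -
  have "vector_space ((*) :: 'a \<Rightarrow> 'a \<Rightarrow> 'a)" by unfold_locales (auto simp: algebra_simps)
  then show ?thesis
    using vector_space_axioms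
    by (intro fnv.subspaceI) (auto simp: dual_space_def Vector_Spaces.linear_iff algebra_simps)
qed

lemma independent_dual_card:
  assumes "F \<subseteq> dual_space scale" "fnv.independent F"
  shows "finite F" "card F \<le> card Basis"
proof -
  define C where "C = (\<lambda>b t. representation Basis t b) ` Basis"
  have "F \<subseteq> fnv.span C"
  proof
    fix f assume "f \<in> F"
    then have "f \<in> dual_space scale" using assms by auto
    from dual_space_expand[OF this] show "f \<in> fnv.span C"
      by (rule span_fun_image) (auto simp: C_def intro: fnv.span_base)
  qed
  then have "finite F \<and> card F \<le> card C"
    using finite_Basis assms by (intro fnv.independent_span_bound) (auto simp: C_def)
  moreover have "card C \<le> card Basis" unfolding C_def by (rule card_image_le[OF finite_Basis])
  ultimately show "finite F" "card F \<le> card Basis" by auto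
qed

text \<open>A functional outside the span of the \<open>b j\<close> would give \<open>r + 1\<close>
  independent ones. So the coordinate functionals are combinations of the \<open>b j\<close>, and
  the columns of the matrix \<open>M\<close> of coefficients are the coordinate vectors of the
  \<open>s j\<close>.\<close>

lemma dual_basis_exists:
  assumes dim: "r = card Basis"
    and b: "\<And>j. j < r \<Longrightarrow> b j \<in> dual_space scale"
    and indep: "\<And>\<mu> j. (\<And>t. (\<Sum>j<r. \<mu> j * b j t) = 0) \<Longrightarrow> j < r \<Longrightarrow> \<mu> j = 0"
  obtains s where "\<And>f t. f \<in> dual_space scale \<Longrightarrow> f t = (\<Sum>j<r. f (s j) * b j t)"
    "\<And>i j. i < r \<Longrightarrow> j < r \<Longrightarrow> b i (s j) = (if j = i then 1 else 0)"
proof -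
  have inj: "inj_on b {..<r}"
  proof (rule inj_onI)
    fix i j assume ij: "i \<in> {..<r}" "j \<in> {..<r}" "b i = b j"
    show "i = j"
    proof (rule ccontr)
      assume "i \<noteq> j"
      define \<mu> where "\<mu> = (\<lambda>l. if l = i then 1 else if l = j then - 1 else (0::'a))"
      have "(\<Sum>l<r. \<mu> l * b l t) = (\<Sum>l\<in>{i, j}. \<mu> l * b l t)" for t
        using ij by (intro sum.mono_neutral_right) (auto simp: \<mu>_def)
      then have "(\<Sum>l<r. \<mu> l * b l t) = 0" for t
        using ij \<open>i \<noteq> j\<close> by (simp add: \<mu>_def)
      then have "\<mu> i = 0" using indep ij by blast
      then show False by (simp add: \<mu>_def)
    qed
  qed
  have ind: "fnv.independent (b ` {..<r})"
  proof (rule fnv.independent_if_scalars_zero)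
    fix u f assume *: "(\<Sum>f\<in>b ` {..<r}. (\<lambda>z. u f * f z)) = 0" "f \<in> b ` {..<r}"
    have "(\<Sum>j<r. u (b j) * b j t) = 0" for t
      using fun_cong[OF *(1), of t] by (simp add: sum.reindex[OF inj] sum_fun_apply)
    then have "u (b j) = 0" if "j < r" for j using indep[of "\<lambda>j. u (b j)" j] that by blast
    then show "u f = 0" using * by auto
  qed simp
  have expand: "\<exists>\<mu>. \<forall>t. f t = (\<Sum>j<r. \<mu> j * b j t)" if f: "f \<in> dual_space scale" for f
  proof -
    have "f \<in> fnv.span (b ` {..<r})"
    proof (rule ccontr)
      assume nf: "f \<notin> fnv.span (b ` {..<r})"
      then have "fnv.independent (insert f (b ` {..<r}))" using ind by (rule fnv.independent_insertI)
      then have "card (insert f (b ` {..<r})) \<le> card Basis"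
        using f b by (intro independent_dual_card) auto
      moreover have "f \<notin> b ` {..<r}" using nf fnv.span_base[of f "b ` {..<r}"] by metis
      ultimately show False using dim card_image[OF inj] by simp
    qed
    then obtain u where "f = (\<Sum>g\<in>b ` {..<r}. (\<lambda>z. u g * g z))"
      by (auto simp: fnv.span_finite)
    then have "f t = (\<Sum>j<r. u (b j) * b j t)" for t
      by (simp add: sum.reindex[OF inj] sum_fun_apply)
    then show ?thesis by (intro exI[of _ "\<lambda>j. u (b j)"] allI)
  qed
  have "\<exists>M. \<forall>\<beta>. \<forall>t. representation Basis t \<beta> = (\<Sum>j<r. M \<beta> j * b j t)"
    by (rule choice) (intro allI expand coordinate_dual_space)
  then obtain M where M: "\<And>\<beta> t. representation Basis t \<beta> = (\<Sum>j<r. M \<beta> j * b j t)" by blast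
  define s where "s = (\<lambda>j. \<Sum>\<beta>\<in>Basis. M \<beta> j *s \<beta>)"
  have 1: "f t = (\<Sum>j<r. f (s j) * b j t)" if f: "f \<in> dual_space scale" for f t
  proof -
    have "f t = (\<Sum>\<beta>\<in>Basis. \<Sum>j<r. f \<beta> * (M \<beta> j * b j t))"
      unfolding dual_space_expand[OF f, of t] M sum_distrib_left ..
    also have "\<dots> = (\<Sum>j<r. \<Sum>\<beta>\<in>Basis. f \<beta> * (M \<beta> j * b j t))" by (rule sum.swap)
    also have "\<dots> = (\<Sum>j<r. f (s j) * b j t)"
      by (simp add: s_def dual_spaceD[OF f] sum_distrib_right sum_distrib_left mult_ac)
    finally show ?thesis .
  qed
  have "b i (s j) = (if j = i then 1 else 0)" if ij: "i < r" "j < r" for i j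
  proof -
    have "(\<Sum>l<r. (b i (s l) - (if l = i then 1 else 0)) * b l t) = 0" for t
      using 1[OF b[OF ij(1)], of t] ij
      by (simp add: left_diff_distrib sum_subtractf if_distrib[of "\<lambda>a. a * _"] cong: if_cong)
    then have "b i (s j) - (if j = i then 1 else 0) = 0"
      using indep[of "\<lambda>l. b i (s l) - (if l = i then 1 else 0)" j] ij by blast
    then show ?thesis by simp
  qed
  then show ?thesis using that 1 by blast
qed

end

section \<open>Real polynomials, ordered by leading coefficient, as a value group\<close>

lemma pos_polyI: "0 < coeff p d \<Longrightarrow> degree p \<le> d \<Longrightarrow> 0 < p"
  using le_degree[of p d] by (auto simp: less_poly_def pos_poly_def)

lemma pos_poly_lead_coeff: "0 < p \<longleftrightarrow> 0 < lead_coeff p"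
  by (simp add: less_poly_def pos_poly_def)

lemma less_poly_degree: "0 < p \<Longrightarrow> degree q < degree p \<Longrightarrow> q < p"
  using lead_coeff_add_le[of "- q" p] by (simp add: less_poly_def pos_poly_def)

text \<open>At all large arguments a positive polynomial is at least its leading coefficient, so one
  argument serves finitely many of them. As evaluation is additive, it turns a polynomial-valued
  order into a real weight.\<close>

lemma pos_polys_eval:
  fixes P :: "real poly set"
  assumes "finite P" "\<And>p. p \<in> P \<Longrightarrow> 0 < p"
  obtains N where "\<And>p. p \<in> P \<Longrightarrow> 0 < poly p N"
proof -
  have "\<exists>M. \<forall>y\<ge>M. \<forall>p\<in>P. 0 < poly p y"
    using assms
  proof (induct P)
    case (insert p P)
    obtain M where M: "\<forall>y\<ge>M. \<forall>p\<in>P. 0 < poly p y" using insert by auto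
    have "0 < lead_coeff p" using insert by (simp add: pos_poly_lead_coeff)
    then obtain M' where M': "\<forall>y\<ge>M'. lead_coeff p \<le> poly p y" using poly_pinfty_gt_lc by blast
    have "\<forall>y\<ge>max M M'. \<forall>p\<in>insert p P. 0 < poly p y"
      using M M' \<open>0 < lead_coeff p\<close> by fastforce
    then show ?case by blast
  qed auto
  then show ?thesis using that by blast
qed

context rational_functions
begin

text \<open>The variable \<open>x i\<close> gets the value \<open>monom 1 (key i)\<close>. For
  injective \<open>key\<close> this is a lexicographic order, in which a larger key means an
  infinitely larger value.\<close>

definition order_val :: "(nat \<Rightarrow> nat) \<Rightarrow> (nat \<Rightarrow> int) \<Rightarrow> real poly" where
  "order_val key a = (\<Sum>i<n. monom (of_int (a i)) (key i))"

lemma order_val_coeff: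
  assumes "inj_on key {..<n}" "i < n"
  shows "coeff (order_val key a) (key i) = of_int (a i)"
proof -
  have "coeff (order_val key a) (key i) = (\<Sum>j<n. if j = i then of_int (a j) else 0)"
    unfolding order_val_def coeff_sum
    by (rule sum.cong) (use assms in \<open>auto simp: inj_on_def\<close>)
  then show ?thesis using assms by simp
qed

lemma order_val_unit: "i < n \<Longrightarrow> order_val key (unit_exp i) = monom 1 (key i)"
  unfolding order_val_def by (subst sum.remove[of _ i]) (auto intro!: sum.neutral)

lemma order_val_degree:
  assumes "inj_on key {..<n}" "i < n" "a i \<noteq> 0"
  shows "key i \<le> degree (order_val key a)"
  using order_val_coeff[OF assms(1,2), of a] assms(3) by (intro le_degree) auto

lemma order_valuation:
  assumes "inj_on key {..<n}"
  shows "monomial_valuation emb n x (order_val key)"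
proof
  show "order_val key (a + b) = order_val key a + order_val key b" for a b
    by (simp add: order_val_def sum.distrib flip: add_monom)
  show "a = 0" if "a \<in> exps" "order_val key a = 0" for a
  proof
    fix i show "a i = 0 i"
      using order_val_coeff[OF assms, of i a] that by (cases "i < n") (auto simp: exps_def)
  qed
qed

text \<open>\<open>T\<close> collects the supports of the algebra generators. That it generates the
  monoid \<open>S\<close> is expressed by a universal property: a submonoid of \<open>exps\<close>
  containing \<open>T\<close> contains \<open>S\<close>.\<close>

lemma finitely_generated_exponents:
  assumes S: "S \<subseteq> exps" and F: "finite F" "kv.span (mon ` S) = k_subalgebra emb hull F"
  obtains T where "finite T" "T \<subseteq> S"
    "\<And>U. T \<subseteq> U \<Longrightarrow> U \<subseteq> exps \<Longrightarrow> 0 \<in> U \<Longrightarrow> (\<And>a b. a \<in> U \<Longrightarrow> b \<in> U \<Longrightarrow> a + b \<in> U) \<Longrightarrow> S \<subseteq> U"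
proof -
  have "\<exists>E. finite E \<and> E \<subseteq> S \<and> f \<in> kv.span (mon ` E)" if "f \<in> F" for f
  proof -
    have "f \<in> kv.span (mon ` S)" using that F by (auto intro: hull_inc)
    then obtain E c where E: "finite E" "E \<subseteq> S" "f = (\<Sum>a\<in>E. emb (c a) * mon a)"
      using span_mon_explicit by metis
    moreover have "f \<in> kv.span (mon ` E)"
      unfolding E(3) by (intro kv.span_sum kv.span_scale kv.span_base) auto
    ultimately show ?thesis by blast
  qed
  then obtain E where E: "\<And>f. f \<in> F \<Longrightarrow> finite (E f) \<and> E f \<subseteq> S \<and> f \<in> kv.span (mon ` E f)"
    by metis
  show ?thesis
  proof
    show "finite (\<Union>f\<in>F. E f)" "(\<Union>f\<in>F. E f) \<subseteq> S" using E F by auto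
    fix U assume U: "(\<Union>f\<in>F. E f) \<subseteq> U" "U \<subseteq> exps" "0 \<in> U" "\<And>a b. a \<in> U \<Longrightarrow> b \<in> U \<Longrightarrow> a + b \<in> U"
    have "f \<in> kv.span (mon ` U)" if "f \<in> F" for f
      using E[OF that] kv.span_mono[of "mon ` E f" "mon ` U"] U(1) that by blast
    then have *: "kv.span (mon ` S) \<subseteq> kv.span (mon ` U)"
      unfolding F(2) by (intro hull_minimal k_subalgebra_span_mon U(3,4)) auto
    show "S \<subseteq> U"
    proof
      fix a assume "a \<in> S"
      then have "mon a \<in> kv.span (mon ` U)" using * kv.span_base[of "mon a" "mon ` S"] by auto
      then show "a \<in> U" using mon_in_span_iff[of a U] U(2) S \<open>a \<in> S\<close> by auto
    qed
  qed
qed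

text \<open>Turns coefficients in \<open>K\<close> into coefficients in \<open>B\<close>, so that
  independence over a local ring containing \<open>B\<close> becomes independence over
  \<open>K\<close>.\<close>

lemma common_denominator:
  fixes m :: nat
  obtains d where "d \<in> B" "d \<noteq> 0" "\<And>j. j < m \<Longrightarrow> d * c j \<in> B"
proof -
  have "\<exists>d\<in>B. d \<noteq> 0 \<and> (\<forall>j<m. d * c j \<in> B)"
  proof (induct m)
    case 0
    then show ?case using k_subalgebraD(3)[OF k_subalgebra_B] by (intro bexI[of _ 1]) auto
  next
    case (Suc m)
    then obtain d where d: "d \<in> B" "d \<noteq> 0" "\<forall>j<m. d * c j \<in> B" by blast
    obtain f g where fg: "f \<in> B" "g \<in> B" "g \<noteq> 0" "c m = f / g" by (rule fraction)
    note mult = k_subalgebraD(5)[OF k_subalgebra_B]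
    have "(g * d) * c j \<in> B" if "j < Suc m" for j
    proof (cases "j = m")
      case True
      then have "(g * d) * c j = d * f" using fg by simp
      then show ?thesis using mult[OF d(1) fg(1)] by (simp only:)
    next
      case False
      then have "g * (d * c j) \<in> B" using that d fg mult by auto
      then show ?thesis by (simp add: mult.assoc)
    qed
    then show ?case using d fg mult by (intro bexI[of _ "g * d"]) auto
  qed
  then show ?thesis using that by blast
qed

end

section \<open>The center of a monomial valuation on a resolution\<close>

context monomial_valuation
begin

text \<open>Two affine neighborhoods of the center \<open>R\<close> play different roles. The chart
  of a projective model, which need not be monomial, shows that \<open>R\<close> exists, as in the
  valuative criterion; a torus-stable one from the toric cover then provides the monoid
  \<open>S\<close>.\<close>

lemma toric_center:
  assumes X: "toric_variety emb n x X" "locally_projective emb X (affine_space emb n x)"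
    and v: "\<And>i. i < n \<Longrightarrow> 0 \<le> v (unit_exp i)"
  obtains R S F where "R \<in> X" "finite F" "S \<subseteq> exps" "kv.span (mon ` S) = k_subalgebra emb hull F"
    "R \<in> local_rings (kv.span (mon ` S))" "B \<subseteq> R" "\<And>i. i < n \<Longrightarrow> unit_exp i \<in> S"
    "\<And>a. a \<in> S \<Longrightarrow> 0 \<le> v a" "\<And>a. a \<in> exps \<Longrightarrow> mon a \<in> R \<Longrightarrow> a \<in> S"
proof -
  note O = local_algebra_valring valring_subalgebra
  have "x i \<in> valring" if "i < n" for i
    using mon_in_valring_iff[of "unit_exp i"] v that by simp
  then have BO: "B \<subseteq> valring" by (simp add: B_subset_iff[OF O(2)])
  then have "center valring B \<in> affine_space emb n x"
    unfolding affine_space_def by (intro center_in_local_rings O) auto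
  then obtain C F where C: "affine_model emb C" "center valring B \<in> local_rings C"
    and F: "finite F" "F \<noteq> {}" "0 \<notin> F"
      "{R \<in> X. \<exists>Q'\<in>local_rings C. dominates R Q'} = projective_model emb C F"
    using X(2) unfolding locally_projective_def by blast
  have subC: "k_subalgebra emb C" using C(1) by (auto simp: affine_model_def)
  have CO: "C \<subseteq> valring"
    using local_ringsD(3)[OF subC C(2)] center_subset[OF O(2) BO] by auto
  \<comment> \<open>A homogeneous coordinate of least value, found by comparing two at a
    time.\<close>
  have "\<exists>f\<in>F. \<forall>g\<in>F. g / f \<in> valring"
    using F(1,2,3)
  proof (induct rule: finite_ne_induct)
    case (singleton f)
    then show ?case using k_subalgebraD(3)[OF O(2)] by auto
  next
    case (insert h F)
    then obtain f where f: "f \<in> F" "\<forall>g\<in>F. g / f \<in> valring" by auto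
    have nz: "f \<noteq> 0" "h \<noteq> 0" using insert f by auto
    show ?case
    proof (cases "h / f \<in> valring")
      case False
      then have fh: "f / h \<in> valring" using valring_total[of "h / f"] by simp
      have "g / h \<in> valring" if "g \<in> F" for g
        using k_subalgebraD(5)[OF O(2) _ fh, of "g / f"] f that nz by simp
      then show ?thesis using k_subalgebraD(3)[OF O(2)] nz by (intro bexI[of _ h]) auto
    qed (use f in auto)
  qed
  then obtain f where f: "f \<in> F" "\<forall>g\<in>F. g / f \<in> valring" by blast
  have chart: "chart C F f \<subseteq> valring" using f CO by (simp add: chart_subset_iff[OF O(2)])
  define R where "R = center valring (chart C F f)"
  have "R \<in> projective_model emb C F"
    using center_in_local_rings[OF O(1) k_subalgebra_chart chart] f
    by (auto simp: projective_model_chart R_def)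
  then have RX: "R \<in> X" using F(4) by auto
  have dom: "dominates valring R" unfolding R_def by (rule dominates_center[OF O(1) chart])
  then have RO: "R \<subseteq> valring" by (simp add: dominates_def)
  obtain \<A> where \<A>: "variety_covered_by emb \<A> X" "\<forall>A\<in>\<A>. torus_stable emb n x A"
    using X(1) by (auto simp: toric_variety_def)
  then obtain A where A: "A \<in> \<A>" "R \<in> local_rings A" using RX by (auto simp: variety_covered_by_def)
  then obtain F' where F': "finite F'" "A = k_subalgebra emb hull F'"
    using \<A>(1) by (auto simp: variety_covered_by_def affine_model_def)
  have subA: "k_subalgebra emb A" by (simp add: F')
  define S where "S = {a \<in> exps. mon a \<in> A}"
  have "A \<inter> characters n x = mon ` S" by (auto simp: characters_eq S_def)
  then have AS: "A = kv.span (mon ` S)"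
    using \<A>(2) A(1) unfolding torus_stable_def by metis
  note RD = local_ringsD[OF subA A(2)]
  have Sexps: "S \<subseteq> exps" by (auto simp: S_def)
  have v_nonneg: "0 \<le> v a" if "a \<in> S" for a
    using that RD(3) RO mon_in_valring_iff by (auto simp: S_def)
  have S_add: "a + b \<in> S" if "a \<in> S" "b \<in> S" for a b
    using that k_subalgebraD(5)[OF subA] by (auto simp: S_def mon_add)
  have S0: "0 \<in> S" using k_subalgebraD(3)[OF subA] by (auto simp: S_def)
  \<comment> \<open>Write \<open>mon a = p / q\<close>. The denominator has a nonzero constant term
    \<open>c\<close>, for otherwise all its monomials have positive value and it cannot be a unit.
    Then \<open>mon a\<close> occurs in \<open>p = mon a * q\<close> with coefficient
    \<open>c\<close>, the other terms of the product having exponents different from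
    \<open>a\<close>, so \<open>a\<close> belongs to the support of \<open>p\<close>.\<close>
  have mon_R: "a \<in> S" if a: "a \<in> exps" "mon a \<in> R" for a
  proof (rule ccontr)
    assume na: "a \<notin> S"
    obtain p q where pq: "p \<in> A" "q \<in> A" "q \<noteq> 0" "inverse q \<in> R" "mon a = p / q"
      using local_rings_denominator[OF subA A(2) a(2)] .
    have "S = insert 0 (S - {0})" using S0 by auto
    then have "mon ` S = insert 1 (mon ` (S - {0}))" by (metis image_insert mon_0)
    then obtain c where c: "q - emb c * 1 \<in> kv.span (mon ` (S - {0}))"
      using pq(2) unfolding AS by (auto simp only: kv.span_breakdown_eq)
    have "kv.span (mon ` (S - {0})) \<subseteq> pos"
      unfolding pos_def
    proof (intro kv.span_mono image_mono subsetI CollectI conjI)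
      fix b assume b: "b \<in> S - {0}"
      then show "b \<in> exps" using Sexps by auto
      then have "v b \<noteq> 0" using v_inj b by blast
      then show "0 < v b" using v_nonneg[of b] b by (simp add: order_le_less)
    qed
    have "c \<noteq> 0"
    proof
      assume "c = 0"
      then have "q \<in> pos" using c \<open>kv.span (mon ` (S - {0})) \<subseteq> pos\<close> by auto
      then have "q \<in> nonunits valring" using pos_subset_nonunits by auto
      then show False using pq RO by (auto simp: nonunits_def)
    qed
    have "mon a * (q - emb c * 1) \<in> kv.span (mon ` (exps - {a}))"
    proof (rule span_mon_mult[of _ "{a}", OF _ c])
      show "mon a \<in> kv.span (mon ` {a})" by (rule kv.span_base) simp
      show "b + b' \<in> exps - {a}" if "b \<in> {a}" "b' \<in> S - {0}" for b b'
        using that a Sexps by auto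
    qed
    moreover have "p \<in> kv.span (mon ` (exps - {a}))"
      using pq(1) kv.span_mono[of "mon ` S" "mon ` (exps - {a})"] na Sexps unfolding AS by blast
    ultimately have "emb (inverse c) * (p - mon a * (q - emb c * 1)) \<in> kv.span (mon ` (exps - {a}))"
      by (intro kv.span_scale kv.span_diff)
    moreover have "emb (inverse c) * (p - mon a * (q - emb c * 1)) = mon a"
    proof -
      have "p = mon a * q" using pq by simp
      then have "p - mon a * (q - emb c * 1) = emb c * mon a" by (simp add: algebra_simps)
      then show ?thesis using \<open>c \<noteq> 0\<close> by (simp add: emb_inverse)
    qed
    ultimately show False using mon_notin_span[of a "exps - {a}"] a by auto
  qed
  have BR: "B \<subseteq> R"
  proof -
    obtain Q where Q: "Q \<in> affine_space emb n x" "dominates R Q"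
      using X(2) RX unfolding locally_projective_def birational_morphism_def by blast
    then have "B \<subseteq> Q" using local_ringsD(3)[OF k_subalgebra_B] by (auto simp: affine_space_def)
    then show ?thesis using Q by (auto simp: dominates_def)
  qed
  have "unit_exp i \<in> S" if "i < n" for i
    using mon_R[of "unit_exp i"] subsetD[OF BR x_in_B[OF that]] that by auto
  then show ?thesis
    using that[of R F' S] RX F' Sexps A v_nonneg mon_R BR unfolding AS by auto
qed

end

section \<open>Bases of the stalk at the center, and the functionals they yield\<close>

locale toral_foliation = rational_functions emb n x + G: finite_dimensional_vector_space scaleG BG
  for emb :: "'k::field_char_0 \<Rightarrow> 'K::field" and n x
    and scaleG :: "'k \<Rightarrow> 'g::ab_group_add \<Rightarrow> 'g" and BG +
  fixes \<alpha> :: "nat \<Rightarrow> 'g \<Rightarrow> 'k" and r :: nat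
  assumes roots: "i < n \<Longrightarrow> \<alpha> i \<in> dual_space scaleG" and dim: "card BG = r"
begin

abbreviation "L \<equiv> foliation emb n x \<alpha>"

lemma weight_dual_space: "weight \<alpha> a \<in> dual_space scaleG"
proof -
  have "weight \<alpha> a = (\<Sum>i<n. (\<lambda>s. of_int (a i) * \<alpha> i s))"
    by (auto simp: weight_def sum_fun_apply)
  also have "\<dots> \<in> dual_space scaleG"
    by (intro fnv.subspace_sum[OF G.dual_space_subspace] fnv.subspace_scale[OF G.dual_space_subspace] roots) auto
  finally show ?thesis .
qed

text \<open>The differentials of the monomials \<open>mon (a j)\<close> form a basis of the stalk, and \<open>s\<close> is dual to their
  weights.\<close>

lemma free_basis_functionals:
  assumes S: "S \<subseteq> exps" "R \<in> local_rings (kv.span (mon ` S))" "k_subalgebra emb (kv.span (mon ` S))"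
    and BR: "B \<subseteq> R" and RS: "\<And>a. a \<in> exps \<Longrightarrow> mon a \<in> R \<Longrightarrow> a \<in> S"
    and w: "is_free_basis R (omega_stalk L R) r w"
  obtains a s where "\<And>j. j < r \<Longrightarrow> a j \<in> S"
    "\<And>f t. f \<in> dual_space scaleG \<Longrightarrow> f t = (\<Sum>j<r. f (s j) * weight \<alpha> (a j) t)"
    "\<And>i j. i < r \<Longrightarrow> j < r \<Longrightarrow> weight \<alpha> (a i) (s j) = (if j = i then 1 else 0)"
    "\<And>c j. c \<in> S \<Longrightarrow> j < r \<Longrightarrow> weight \<alpha> c (s j) \<noteq> 0 \<Longrightarrow> c - a j \<in> S"
proof -
  let ?A = "kv.span (mon ` S)" and ?E = "differential L ` mon ` S"
  note RD = local_ringsD[OF S(3,2)]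
  note Rk = k_subalgebraD[OF RD(2)]
  have monR: "mon c \<in> R" if "c \<in> S" for c
    using RD(3) kv.span_base[of "mon c" "mon ` S"] that by auto
  have hull: "?A = k_subalgebra emb hull (mon ` S)"
  proof
    show "?A \<subseteq> k_subalgebra emb hull (mon ` S)"
      by (intro kv.span_minimal hull_subset k_subalgebra_subspace) simp
    show "k_subalgebra emb hull (mon ` S) \<subseteq> ?A"
      by (intro hull_minimal kv.span_superset S(3))
  qed
  have "omega_stalk L R \<subseteq> submodule_span R ?E"
  proof (rule omega_stalk_subset[OF RD(2)])
    fix z assume "z \<in> R"
    show "differential L z \<in> submodule_span R ?E"
    proof (rule differential_in_submodule_span[OF S(2) hull _ _ \<open>z \<in> R\<close>])
      show "differential L b \<in> submodule_span R ?E" if "b \<in> mon ` S" for b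
        using that by (intro submodule_span_base[OF RD(2)]) auto
    qed (rule foliation_derivation)
  qed
  moreover have "?E \<subseteq> omega_stalk L R" using omega_stalkI[OF RD(2)] monR by auto
  ultimately obtain w' where w': "is_free_basis R (omega_stalk L R) r w'" "\<And>j. j < r \<Longrightarrow> w' j \<in> ?E"
    using free_basis_from_generators[OF RD(1) w] by metis
  then have "\<exists>a. \<forall>j. j < r \<longrightarrow> a j \<in> S \<and> w' j = differential L (mon (a j))"
    by (intro choice) (auto simp: image_iff)
  then obtain a where a: "\<And>j. j < r \<Longrightarrow> a j \<in> S" "\<And>j. j < r \<Longrightarrow> w' j = differential L (mon (a j))"
    by blast
  have indep: "c j = 0" if c: "\<And>\<delta>. \<delta> \<in> L \<Longrightarrow> (\<Sum>j<r. c j * \<delta> (mon (a j))) = 0" and j: "j < r" for c j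
  proof -
    obtain d where d: "d \<in> B" "d \<noteq> 0" "\<And>j. j < r \<Longrightarrow> d * c j \<in> B"
      by (rule common_denominator[of r c]) (rule that)
    have "d * c j = 0"
    proof (rule is_free_basisD(3)[OF w'(1) _ _ j])
      show "d * c j \<in> R" if "j < r" for j using d BR that by auto
      fix \<delta> show "(\<Sum>j<r. d * c j * w' j \<delta>) = 0"
      proof (cases "\<delta> \<in> L")
        case True
        have "(\<Sum>j<r. d * c j * w' j \<delta>) = d * (\<Sum>j<r. c j * \<delta> (mon (a j)))"
          unfolding sum_distrib_left using True by (intro sum.cong) (auto simp: a differential_def)
        then show ?thesis using c True by simp
      qed (simp add: a differential_def)
    qed
    then show ?thesis using d by simp
  qed
  \<comment> \<open>A relation among the weights would be one among the logarithmic differentials,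
    that is, among the differentials with coefficients
    \<open>emb (\<mu> j) / mon (a j)\<close>.\<close>
  have wt_indep: "\<mu> j = 0" if \<mu>: "\<And>t. (\<Sum>j<r. \<mu> j * weight \<alpha> (a j) t) = 0" and j: "j < r" for \<mu> j
  proof -
    have "emb (\<mu> j) / mon (a j) = 0"
    proof (rule indep[OF _ j])
      fix \<delta> assume "\<delta> \<in> L"
      then show "(\<Sum>j<r. emb (\<mu> j) / mon (a j) * \<delta> (mon (a j))) = 0"
        using foliation_relation[where \<delta>=\<delta> and \<alpha>=\<alpha> and J="{..<r}" and \<mu>=\<mu> and a=a] \<mu> by simp
    qed
    then show ?thesis by simp
  qed
  obtain s where s: "\<And>f t. f \<in> dual_space scaleG \<Longrightarrow> f t = (\<Sum>j<r. f (s j) * weight \<alpha> (a j) t)"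
    "\<And>i j. i < r \<Longrightarrow> j < r \<Longrightarrow> weight \<alpha> (a i) (s j) = (if j = i then 1 else 0)"
    by (rule G.dual_basis_exists[OF dim[symmetric], of "\<lambda>j. weight \<alpha> (a j)"])
      (use weight_dual_space wt_indep in blast)+
  have "c - a j \<in> S" if c: "c \<in> S" and j: "j < r" and nz: "weight \<alpha> c (s j) \<noteq> 0" for c j
  proof -
    define lam where "lam = (\<lambda>j. weight \<alpha> c (s j))"
    obtain d where d: "\<forall>j<r. d j \<in> R" "differential L (mon c) = (\<lambda>\<delta>. \<Sum>j<r. d j * w' j \<delta>)"
      using is_free_basisD(2)[OF w'(1) omega_stalkI[OF RD(2) monR[OF c]]] by blast
    \<comment> \<open>The differential of \<open>mon c\<close> is expanded twice, with coefficients
      from \<open>R\<close> and with logarithmic ones; independence over \<open>K\<close> identifies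
      the two.\<close>
    have "d j - emb (lam j) * mon c / mon (a j) = 0"
    proof (rule indep[OF _ j])
      fix \<delta> assume \<delta>: "\<delta> \<in> L"
      have 1: "\<delta> (mon c) = (\<Sum>j<r. d j * \<delta> (mon (a j)))"
        using fun_cong[OF d(2), of \<delta>] \<delta> by (simp add: differential_def a)
      \<comment> \<open>The additional index \<open>r\<close> carries \<open>c\<close> itself, with
        coefficient \<open>- 1\<close>.\<close>
      have "(\<Sum>j<Suc r. (if j < r then lam j else - 1) * weight \<alpha> ((a(r := c)) j) t) = 0" for t
        using s(1)[OF weight_dual_space, of c t] by (simp add: lam_def)
      from foliation_relation[OF \<delta> this]
      have "(\<Sum>j<r. emb (lam j) * (\<delta> (mon (a j)) / mon (a j))) = \<delta> (mon c) / mon c"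
        by (simp add: emb_minus)
      then have "\<delta> (mon c) = mon c * (\<Sum>j<r. emb (lam j) * (\<delta> (mon (a j)) / mon (a j)))" by simp
      also have "\<dots> = (\<Sum>j<r. emb (lam j) * mon c / mon (a j) * \<delta> (mon (a j)))"
        unfolding sum_distrib_left by (intro sum.cong) auto
      finally show "(\<Sum>j<r. (d j - emb (lam j) * mon c / mon (a j)) * \<delta> (mon (a j))) = 0"
        using 1 unfolding left_diff_distrib sum_subtractf by simp
    qed
    then have "mon (c - a j) = emb (inverse (lam j)) * d j"
      using nz by (simp add: lam_def emb_inverse mon_diff)
    also have "\<dots> \<in> R" using d(1) j by (intro Rk) auto
    finally show ?thesis using RS S(1) c a(1)[OF j] by blast
  qed
  then show ?thesis using that a s by blast
qed

lemma resolution_basis: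
  assumes res: "torically_resolvable emb n x L r" and inj: "inj_on key {..<n}"
  obtains S a s where "S \<subseteq> exps" "\<And>l. l < n \<Longrightarrow> unit_exp l \<in> S"
    "\<And>b. b \<in> S \<Longrightarrow> 0 \<le> order_val key b" "\<And>j. j < r \<Longrightarrow> a j \<in> S"
    "\<And>f t. f \<in> dual_space scaleG \<Longrightarrow> f t = (\<Sum>j<r. f (s j) * weight \<alpha> (a j) t)"
    "\<And>i j. i < r \<Longrightarrow> j < r \<Longrightarrow> weight \<alpha> (a i) (s j) = (if j = i then 1 else 0)"
    "\<And>c j. c \<in> S \<Longrightarrow> j < r \<Longrightarrow> weight \<alpha> c (s j) \<noteq> 0 \<Longrightarrow> c - a j \<in> S"
    "\<And>c j. c \<in> S \<Longrightarrow> j < r \<Longrightarrow> weight \<alpha> c (s j) \<in> \<nat>"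
proof -
  define v where "v = order_val key"
  interpret v: monomial_valuation emb n x v
    unfolding v_def by (rule order_valuation[OF inj])
  obtain X where X: "toric_variety emb n x X" "locally_projective emb X (affine_space emb n x)"
    "nonsingular_foliation L r X"
    using res by (auto simp: torically_resolvable_def)
  have v_unit: "v (unit_exp l) = monom 1 (key l)" if "l < n" for l
    using that by (simp add: v_def order_val_unit)
  have "0 \<le> v (unit_exp l)" if "l < n" for l
    unfolding v_unit[OF that]
    by (rule less_imp_le, rule pos_polyI[of _ "key l"]) (auto simp: degree_monom_eq)
  then obtain R S F where RS: "R \<in> X" "finite F" "S \<subseteq> exps" "kv.span (mon ` S) = k_subalgebra emb hull F"
    "R \<in> local_rings (kv.span (mon ` S))" "B \<subseteq> R" "\<And>i. i < n \<Longrightarrow> unit_exp i \<in> S"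
    "\<And>a. a \<in> S \<Longrightarrow> 0 \<le> v a" "\<And>a. a \<in> exps \<Longrightarrow> mon a \<in> R \<Longrightarrow> a \<in> S"
    using v.toric_center[OF X(1,2)] by metis
  obtain w where "is_free_basis R (omega_stalk L R) r w"
    using X(3) RS(1) unfolding nonsingular_foliation_def by blast
  then obtain a s where a: "\<And>j. j < r \<Longrightarrow> a j \<in> S"
    and s: "\<And>f t. f \<in> dual_space scaleG \<Longrightarrow> f t = (\<Sum>j<r. f (s j) * weight \<alpha> (a j) t)"
      "\<And>i j. i < r \<Longrightarrow> j < r \<Longrightarrow> weight \<alpha> (a i) (s j) = (if j = i then 1 else 0)"
    and minus: "\<And>c j. c \<in> S \<Longrightarrow> j < r \<Longrightarrow> weight \<alpha> c (s j) \<noteq> 0 \<Longrightarrow> c - a j \<in> S"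
    using free_basis_functionals[OF RS(3,5) k_subalgebra_hull[of F, folded RS(4)] RS(6,9)] by blast
  obtain T where T: "finite T" "T \<subseteq> S"
    "\<And>U. T \<subseteq> U \<Longrightarrow> U \<subseteq> exps \<Longrightarrow> 0 \<in> U \<Longrightarrow> (\<And>a b. a \<in> U \<Longrightarrow> b \<in> U \<Longrightarrow> a + b \<in> U) \<Longrightarrow> S \<subseteq> U"
    using finitely_generated_exponents[OF RS(3,2,4)] by blast
  have v_pos: "0 < v b" if "b \<in> S" "b \<noteq> 0" for b
  proof -
    have "v b \<noteq> 0" using v.v_inj that RS(3) by blast
    then show ?thesis using RS(8)[OF that(1)] by (simp add: order_le_less)
  qed
  \<comment> \<open>Evaluating at \<open>N\<close> replaces the order by the real weight
    \<open>u\<close>. Being additive and positive on the nonzero generators in \<open>T\<close>, it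
    is positive on all nonzero exponents in \<open>S\<close>.\<close>
  obtain N where N: "\<And>p. p \<in> v ` (T - {0}) \<Longrightarrow> 0 < poly p N"
    by (rule pos_polys_eval[of "v ` (T - {0})"]) (use T v_pos in auto)
  define u where "u = (\<lambda>b. poly (v b) N)"
  have u_add: "u (b + c) = u b + u c" for b c by (simp add: u_def v.v_add)
  have u_diff: "u (b - c) = u b - u c" for b c by (simp add: u_def v.v_diff)
  have u_0: "u 0 = 0" by (simp add: u_def)
  have "S \<subseteq> {b \<in> exps. b = 0 \<or> 0 < u b}"
  proof (rule T(3))
    show "T \<subseteq> {b \<in> exps. b = 0 \<or> 0 < u b}" using T(2) RS(3) N by (auto simp: u_def)
  qed (auto simp: u_add u_0)
  then have u: "0 \<le> u b" "b \<noteq> 0 \<Longrightarrow> 0 < u b" if "b \<in> S" for b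
    using that u_0 by fastforce+
  have nat: "weight \<alpha> c (s j) \<in> \<nat>" if c: "c \<in> S" and j: "j < r" for c j
  proof (rule ccontr)
    assume nn: "weight \<alpha> c (s j) \<notin> \<nat>"
    \<comment> \<open>A coordinate that is not a natural number never becomes zero on being lowered
      by one, so \<open>a j\<close> can be subtracted forever. But each time \<open>u\<close> drops
      by the fixed positive amount \<open>u (a j)\<close>.\<close>
    have *: "\<exists>d\<in>S. weight \<alpha> d (s j) = weight \<alpha> c (s j) - of_nat m \<and> u d = u c - of_nat m * u (a j)" for m
    proof (induct m)
      case 0
      then show ?case using c by auto
    next
      case (Suc m)
      then obtain d where d: "d \<in> S" "weight \<alpha> d (s j) = weight \<alpha> c (s j) - of_nat m"
        "u d = u c - of_nat m * u (a j)" by blast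
      have "weight \<alpha> d (s j) \<noteq> 0"
      proof
        assume "weight \<alpha> d (s j) = 0"
        then have "weight \<alpha> c (s j) = of_nat m" using d by simp
        then show False using nn by simp
      qed
      then have "d - a j \<in> S" using minus d j by blast
      moreover have "weight \<alpha> (d - a j) (s j) = weight \<alpha> c (s j) - of_nat (Suc m)"
        using d s(2)[OF j j] by (simp add: weight_diff)
      moreover have "u (d - a j) = u c - of_nat (Suc m) * u (a j)"
        using d by (simp add: u_diff algebra_simps)
      ultimately show ?case by blast
    qed
    have "a j \<noteq> 0" using s(2)[OF j j] by (auto simp: weight_def)
    then have "0 < u (a j)" using u a j by blast
    then obtain m where "u c < of_nat m * u (a j)" using reals_Archimedean3 by blast
    then show False using *[of m] u(1) by fastforce
  qed
  then show ?thesis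
    using that[of S a s] RS(3,7,8) a s minus nat by (simp add: v_def)
qed

text \<open>The functional is evaluation at some \<open>s j\<close> for which \<open>a j\<close>
  involves a variable outside \<open>I\<close>, so that \<open>v (a j)\<close> has degree at least
  \<open>n\<close>. A nonzero value on a root from \<open>I\<close> would make
  \<open>unit_exp l - a j\<close> regular although \<open>x l\<close> has the smaller value. A value
  on \<alpha> i other than \<open>0\<close> and \<open>1\<close> would allow subtracting
  \<open>a j\<close> twice from \<open>unit_exp i\<close>, which is once too often.\<close>

lemma resolution_functional:
  assumes res: "torically_resolvable emb n x L r"
    and I: "I \<subseteq> {..<n}" and i: "i < n" "\<alpha> i \<notin> fnv.span (\<alpha> ` I)"
  obtains s where "\<And>l. l \<in> I \<Longrightarrow> \<alpha> l s = 0" "\<alpha> i s = 1" "\<And>l. l < n \<Longrightarrow> \<alpha> l s \<in> \<nat>"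
proof -
  have iI: "i \<notin> I" using i(2) fnv.span_base[of "\<alpha> i" "\<alpha> ` I"] by auto
  \<comment> \<open>Degrees below \<open>n\<close> for \<open>I\<close>, exactly \<open>n\<close>
    for \<open>i\<close>, and above \<open>n\<close> for all others.\<close>
  define key where "key = (\<lambda>l. if l \<in> I then l else if l = i then n else n + 1 + l)"
  have inj: "inj_on key {..<n}"
    using I by (auto simp: inj_on_def key_def split: if_splits)
  define v where "v = order_val key"
  interpret v: monomial_valuation emb n x v
    unfolding v_def by (rule order_valuation[OF inj])
  have v_unit: "v (unit_exp l) = monom 1 (key l)" if "l < n" for l
    using that by (simp add: v_def order_val_unit)
  obtain S a s where S: "S \<subseteq> exps" "\<And>l. l < n \<Longrightarrow> unit_exp l \<in> S" "\<And>b. b \<in> S \<Longrightarrow> 0 \<le> v b"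
    and a: "\<And>j. j < r \<Longrightarrow> a j \<in> S"
    and s: "\<And>f t. f \<in> dual_space scaleG \<Longrightarrow> f t = (\<Sum>j<r. f (s j) * weight \<alpha> (a j) t)"
      "\<And>i j. i < r \<Longrightarrow> j < r \<Longrightarrow> weight \<alpha> (a i) (s j) = (if j = i then 1 else 0)"
    and minus: "\<And>c j. c \<in> S \<Longrightarrow> j < r \<Longrightarrow> weight \<alpha> c (s j) \<noteq> 0 \<Longrightarrow> c - a j \<in> S"
    and nat: "\<And>c j. c \<in> S \<Longrightarrow> j < r \<Longrightarrow> weight \<alpha> c (s j) \<in> \<nat>"
    by (rule resolution_basis[OF res inj, folded v_def]) (rule that)
  \<comment> \<open>Otherwise every term of the expansion of \<alpha> i with nonzero coefficient
    would lie in the span of the roots from \<open>I\<close>.\<close>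
  have "\<exists>j<r. \<alpha> i (s j) \<noteq> 0 \<and> weight \<alpha> (a j) \<notin> fnv.span (\<alpha> ` I)"
  proof (rule ccontr)
    assume "\<not> ?thesis"
    then have "\<alpha> i \<in> fnv.span (\<alpha> ` I)"
      by (intro span_fun_image[OF s(1)[OF roots[OF i(1)]]]) auto
    then show False using i(2) by simp
  qed
  then obtain j where j: "j < r" "\<alpha> i (s j) \<noteq> 0" "weight \<alpha> (a j) \<notin> fnv.span (\<alpha> ` I)"
    by blast
  obtain t where t: "t < n" "t \<notin> I" "a j t \<noteq> 0"
  proof -
    have "\<exists>t<n. t \<notin> I \<and> a j t \<noteq> 0"
    proof (rule ccontr)
      assume no: "\<not> ?thesis"
      have "weight \<alpha> (a j) \<in> fnv.span (\<alpha> ` I)"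
        by (rule span_fun_image[where I="{..<n}" and c="\<lambda>t. of_int (a j t)" and f=\<alpha>])
          (use no in \<open>auto simp: weight_def intro!: fnv.span_base\<close>)
      then show False using j by simp
    qed
    then show ?thesis using that by blast
  qed
  have "a j \<noteq> 0" using t by auto
  then have "v (a j) \<noteq> 0" using v.v_inj a[OF j(1)] S(1) by blast
  then have vpos: "0 < v (a j)" using S(3)[OF a[OF j(1)]] by (simp add: order_le_less)
  have deg: "n \<le> degree (v (a j))"
    using order_val_degree[OF inj t(1), of "a j"] t by (auto simp: v_def key_def split: if_splits)
  show ?thesis
  proof
    show "\<alpha> l (s j) \<in> \<nat>" if "l < n" for l
      using nat[OF S(2)[OF that] j(1)] that by (simp add: weight_unit)
    show "\<alpha> l (s j) = 0" if l: "l \<in> I" for l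
    proof (rule ccontr)
      have ln: "l < n" using l I by auto
      assume "\<alpha> l (s j) \<noteq> 0"
      then have "unit_exp l - a j \<in> S"
        using minus[OF S(2)[OF ln] j(1)] ln by (simp add: weight_unit)
      then have "v (a j) \<le> v (unit_exp l)" using S(3) by (fastforce simp: v.v_diff)
      moreover have "degree (v (unit_exp l)) < degree (v (a j))"
        using v_unit[OF ln] l ln deg by (simp add: degree_monom_eq key_def)
      ultimately show False using less_poly_degree[OF vpos] by fastforce
    qed
    show "\<alpha> i (s j) = 1"
    proof (rule ccontr)
      assume ne: "\<alpha> i (s j) \<noteq> 1"
      have 1: "unit_exp i - a j \<in> S"
        using minus[OF S(2)[OF i(1)] j(1)] j(2) i(1) by (simp add: weight_unit)
      then have "unit_exp i - a j - a j \<in> S"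
        using minus[OF 1 j(1)] ne s(2)[OF j(1) j(1)] i(1) by (simp add: weight_unit weight_diff)
      then have "0 \<le> v (unit_exp i - a j - a j)" by (rule S(3))
      then have "0 \<le> monom 1 n - v (a j) - v (a j)"
        using v_unit[OF i(1)] iI by (simp only: v.v_diff key_def if_True if_False refl)
      then have le: "v (a j) + v (a j) \<le> monom 1 n" by (simp only: le_diff_eq add_0)
      have vpos2: "0 < v (a j) + v (a j)" using vpos by simp
      have degree2: "degree (v (a j) + v (a j)) = degree (v (a j))"
        by (metis degree_smult_eq smult_add_left smult_1_left one_add_one zero_neq_numeral)
      show False
      \<comment> \<open>In degree exactly \<open>n\<close> the leading coefficient is the integer
        \<open>a j i\<close>, hence at least \<open>1\<close>, and its double exceeds the
        coefficient \<open>1\<close> of \<open>monom 1 n\<close>. In higher degree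
        \<open>v (a j)\<close> is already too large.\<close>
      proof (cases "degree (v (a j)) = n")
        case True
        have "coeff (v (a j)) n = of_int (a j i)"
          using order_val_coeff[OF inj i(1), of "a j"] iI by (simp add: v_def key_def)
        moreover have "0 < coeff (v (a j)) n" using vpos True by (simp add: pos_poly_lead_coeff)
        ultimately have "1 \<le> coeff (v (a j)) n" by simp
        then have "0 < coeff (v (a j) + v (a j) - monom 1 n) n" by (simp only: coeff_diff coeff_add coeff_monom) simp
        then have "0 < v (a j) + v (a j) - monom 1 n"
          using True degree2 by (intro pos_polyI[of _ n]) (auto intro!: degree_diff_le degree_monom_le)
        then show False using le by simp
      next
        case False
        then have "degree (monom (1::real) n) < degree (v (a j) + v (a j))"
          using deg degree2 by (simp add: degree_monom_eq)
        then show False using less_poly_degree[OF vpos2] le by fastforce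
      qed
    qed
  qed
qed

section \<open>From the functionals to a basis of the dual\<close>

lemma resolvable_imp_basis:
  assumes res: "torically_resolvable emb n x L r"
  shows "is_basis_of (\<lambda>c f s. c * f s) (\<alpha> ` {..<n} - {0}) (dual_space scaleG)"
proof -
  let ?D = "\<alpha> ` {..<n} - {0}"
  have "fnv.independent ?D"
  proof
    assume "fnv.dependent ?D"
    then obtain t where t: "t \<subseteq> ?D \<and> fnv.dependent t"
      and min: "\<And>t'. t' \<subseteq> ?D \<and> fnv.dependent t' \<Longrightarrow> card t \<le> card t'"
      using ex_has_least_nat[of "\<lambda>t. t \<subseteq> ?D \<and> fnv.dependent t" ?D card] by blast
    have fin: "finite t" using t finite_subset[of t ?D] by auto
    have ind: "fnv.independent (t - {f})" if "f \<in> t" for f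
      using min[of "t - {f}"] t card_Diff1_less[OF fin that] by fastforce
    obtain u f where u: "(\<Sum>h\<in>t. (\<lambda>z. u h * h z)) = 0" and f: "f \<in> t" "u f \<noteq> 0"
      using t fin by (auto simp: fnv.dependent_finite)
    have ev: "(\<Sum>h\<in>t. u h * h z) = 0" for z
      using fun_cong[OF u, of z] by (simp add: sum_fun_apply)
    \<comment> \<open>By minimality \<open>f\<close> is not in the span of
      \<open>t - {f, g}\<close>. The resulting functional kills that set, is \<open>1\<close> on
      \<open>f\<close> and a natural number \<open>m\<close> on \<open>g\<close>, so evaluating the
      relation leaves \<open>u f + m * u g = 0\<close>.\<close>
    have pair: "\<exists>m::nat. u f = - of_nat m * u g" if fg: "f \<in> t" "g \<in> t" "f \<noteq> g" for f g
    proof -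
      have "f \<notin> fnv.span (t - {g} - {f})"
        using ind[OF fg(2)] fg by (auto simp: fnv.dependent_def)
      moreover have "t - {g} - {f} = t - {f, g}" by auto
      ultimately have nf: "f \<notin> fnv.span (t - {f, g})" by simp
      define I where "I = {l. l < n \<and> \<alpha> l \<in> t - {f, g}}"
      have "\<alpha> ` I = t - {f, g}" using t by (auto simp: I_def)
      obtain i where i: "i < n" "f = \<alpha> i" using t fg by auto
      have "\<alpha> i \<notin> fnv.span (\<alpha> ` I)" using nf i \<open>\<alpha> ` I = _\<close> by simp
      moreover have "I \<subseteq> {..<n}" by (auto simp: I_def)
      ultimately obtain s where s: "\<And>l. l \<in> I \<Longrightarrow> \<alpha> l s = 0" "\<alpha> i s = 1" "\<And>l. l < n \<Longrightarrow> \<alpha> l s \<in> \<nat>"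
        using resolution_functional[OF res _ i(1)] by blast
      have z: "h s = 0" if "h \<in> t - {f, g}" for h
        using s(1) that \<open>\<alpha> ` I = t - {f, g}\<close> by (metis imageE)
      obtain l where l: "l < n" "g = \<alpha> l" using t fg by auto
      obtain m where m: "g s = of_nat m" using s(3)[OF l(1)] l(2) by (auto simp: Nats_def)
      have "(\<Sum>h\<in>t. u h * h s) = (\<Sum>h\<in>{f, g}. u h * h s)"
        using fin fg z by (intro sum.mono_neutral_right) auto
      also have "\<dots> = u f + u g * of_nat m" using fg(3) s(2) i m by simp
      finally show ?thesis using ev[of s]
        by (intro exI[of _ m]) (simp add: eq_neg_iff_add_eq_0 mult.commute)
    qed
    obtain z where z: "f z \<noteq> 0" using t f by fastforce
    show False
    proof (cases "t = {f}")
      case True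
      then show False using ev[of z] z f by simp
    next
      case False
      then obtain g where g: "g \<in> t" "g \<noteq> f" using f by auto
      obtain m where m: "u f = - of_nat m * u g" using pair[OF f(1) g(1)] g by auto
      have ug: "u g \<noteq> 0" using m f by auto
      show False
      proof (cases "t = {f, g}")
        case True
        obtain m' where m': "u g = - of_nat m' * u f" using pair[OF g(1) f(1)] g by auto
        have "u f = of_nat (m * m') * u f" using m m' by simp
        then have "of_nat (m * m') = (of_nat 1 :: 'k)" using f by simp
        \<comment> \<open>Two natural numbers with product \<open>1\<close> are both
          \<open>1\<close>, which makes the relation a multiple of \<open>g - f\<close>.\<close>
        then have "m * m' = 1" by (simp only: of_nat_eq_iff)
        then have "u f = - u g" using m by simp
        then have "u g * (g w - f w) = 0" for w
          using ev[of w] True g by (simp add: algebra_simps)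
        then have "g = f" using ug by (auto simp: fun_eq_iff)
        then show False using g by simp
      next
        case False
        then obtain h where h: "h \<in> t" "h \<noteq> f" "h \<noteq> g" using f g by auto
        obtain m' where m': "u g = - of_nat m' * u h" using pair[OF g(1) h(1)] h by auto
        obtain k where k: "u f = - of_nat k * u h" using pair[OF f(1) h(1)] h by auto
        have uh: "u h \<noteq> 0" using k f by auto
        \<comment> \<open>Going through \<open>g\<close>, the quotient of \<open>u f\<close> by
          \<open>u h\<close> is \<open>m * m'\<close>; directly it is \<open>- k\<close>. In
          characteristic zero both must vanish, against \<open>u f\<close> being nonzero.\<close>
        have "of_nat k * u h + of_nat m * of_nat m' * u h = 0"
          using k unfolding m m' by (simp add: eq_neg_iff_add_eq_0 add.commute mult.assoc)
        then have "of_nat (m * m' + k) * u h = 0" by (simp add: algebra_simps)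
        then have "of_nat (m * m' + k) = (0::'k)" using uh by simp
        then have "k = 0" by (simp only: of_nat_eq_0_iff add_is_0)
        then show False using k f by simp
      qed
    qed
  qed
  moreover have "fnv.span ?D = dual_space scaleG"
  proof
    show "fnv.span ?D \<subseteq> dual_space scaleG"
      using roots by (intro fnv.span_minimal G.dual_space_subspace) auto
    \<comment> \<open>Any order serves here: the weights of a stalk basis span the dual and are
      combinations of the roots.\<close>
    obtain S :: "(nat \<Rightarrow> int) set" and a s where
      s: "\<And>f t. f \<in> dual_space scaleG \<Longrightarrow> f t = (\<Sum>j<r. f (s j) * weight \<alpha> (a j) t)"
      by (rule resolution_basis[OF res inj_on_id2]) (rule that)
    have "\<alpha> l \<in> fnv.span ?D" if "l < n" for l
    proof (cases "\<alpha> l = 0")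
      case True
      then show ?thesis by (simp only: fnv.span_zero)
    next
      case False
      then show ?thesis using that by (intro fnv.span_base) auto
    qed
    then have wt: "weight \<alpha> b \<in> fnv.span ?D" for b
      by (intro span_fun_image[where g="weight \<alpha> b" and I="{..<n}" and c="\<lambda>t. of_int (b t)" and f=\<alpha>])
        (simp_all add: weight_def)
    show "dual_space scaleG \<subseteq> fnv.span ?D"
    proof
      fix f assume "f \<in> dual_space scaleG"
      from s[OF this] show "f \<in> fnv.span ?D" by (rule span_fun_image) (rule wt)
    qed
  qed
  ultimately show ?thesis by (simp add: is_basis_of_def)
qed

end

section \<open>Local rings of completely integrally closed algebras\<close>

context embedded_field
begin

lemma local_ring_common_denominator:
  fixes m :: nat
  assumes A: "k_subalgebra emb A" and R: "R \<in> local_rings A" and c: "\<And>i. c i \<in> R"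
  obtains q where "q \<in> A" "q \<noteq> 0" "inverse q \<in> R" "\<And>i. i < m \<Longrightarrow> q * c i \<in> A"
proof -
  note RD = local_ringsD[OF A R]
  note mult = k_subalgebraD(5)[OF A]
  have "\<exists>q\<in>A. q \<noteq> 0 \<and> inverse q \<in> R \<and> (\<forall>i<m. q * c i \<in> A)"
  proof (induct m)
    case 0
    then show ?case
      using k_subalgebraD(3)[OF A] k_subalgebraD(3)[OF RD(2)] by (intro bexI[of _ 1]) auto
  next
    case (Suc m)
    then obtain q where q: "q \<in> A" "q \<noteq> 0" "inverse q \<in> R" "\<forall>i<m. q * c i \<in> A" by blast
    obtain f g where fg: "f \<in> A" "g \<in> A" "g \<noteq> 0" "inverse g \<in> R" "c m = f / g"
      using local_rings_denominator[OF A R c] .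
    have "(g * q) * c i \<in> A" if "i < Suc m" for i
    proof (cases "i = m")
      case True
      then have "(g * q) * c i = q * f" using fg by simp
      then show ?thesis using mult[OF q(1) fg(1)] by (simp only:)
    next
      case False
      then have "g * (q * c i) \<in> A" using that q fg mult by auto
      then show ?thesis by (simp add: mult.assoc)
    qed
    moreover have "inverse (g * q) \<in> R"
      using k_subalgebraD(5)[OF RD(2) fg(4) q(3)] by simp
    ultimately show ?case using q fg mult by (intro bexI[of _ "g * q"]) auto
  qed
  then show ?thesis using that by blast
qed

text \<open>A root \<open>z\<close> of a monic polynomial over \<open>R\<close> has a multiple \<open>q z\<close>, \<open>q\<close> a unit of \<open>R\<close>, that is
  integral over \<open>A\<close>; its powers then have a common denominator.\<close>

lemma integrally_closed_local_ring:
  assumes A: "k_subalgebra emb A" "has_fraction_field_UNIV A" and R: "R \<in> local_rings A"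
    and closed: "\<And>d z. d \<noteq> 0 \<Longrightarrow> (\<And>m. d * z ^ m \<in> A) \<Longrightarrow> z \<in> A"
  shows "integrally_closed R"
  unfolding integrally_closed_def
proof (intro allI impI, elim conjE)
  fix z p assume p: "\<forall>i. coeff p i \<in> R" "lead_coeff p = 1" "poly p z = 0"
  note RD = local_ringsD[OF A(1) R]
  note AD = k_subalgebraD[OF A(1)]
  define N where "N = degree p"
  obtain q where q: "q \<in> A" "q \<noteq> 0" "inverse q \<in> R" "\<And>i. i < N \<Longrightarrow> q * coeff p i \<in> A"
    by (rule local_ring_common_denominator[OF A(1) R, of "coeff p" N]) (use p in blast)+
  define w where "w = q * z"
  \<comment> \<open>Coefficients of the monic equation for \<open>w = q * z\<close>, obtained by
    multiplying that of \<open>z\<close> by \<open>q ^ N\<close>. Below degree \<open>N\<close> at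
    least one factor \<open>q\<close> is left over to bring \<open>coeff p i\<close> into
    \<open>A\<close>.\<close>
  define b where "b = (\<lambda>i. q ^ (N - i) * coeff p i)"
  have b: "b i \<in> A" if "i < N" for i
  proof -
    obtain m where "N - i = Suc m" using \<open>i < N\<close> by (cases "N - i") auto
    then have "b i = q ^ m * (q * coeff p i)" by (simp add: b_def)
    then show ?thesis using AD(5)[OF AD(8)[OF q(1)] q(4)[OF that]] by (simp only:)
  qed
  have "0 = q ^ N * poly p z" using p by simp
  also have "\<dots> = (\<Sum>i\<le>N. b i * w ^ i)"
    unfolding poly_altdef N_def[symmetric] sum_distrib_left
  proof (rule sum.cong[OF refl])
    fix i assume "i \<in> {..N}"
    then have "q ^ N = q ^ (N - i) * q ^ i" by (simp flip: power_add)
    then show "q ^ N * (coeff p i * z ^ i) = b i * w ^ i"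
      by (simp add: b_def w_def power_mult_distrib mult_ac)
  qed
  also have "\<dots> = w ^ N + (\<Sum>i<N. b i * w ^ i)"
    using p(2) by (simp add: N_def b_def flip: lessThan_Suc_atMost)
  finally have wN: "w ^ N = - (\<Sum>i<N. b i * w ^ i)" by (simp add: eq_neg_iff_add_eq_0)
  obtain f g where fg: "f \<in> A" "g \<in> A" "g \<noteq> 0" "w = f / g"
    using A(2) unfolding has_fraction_field_UNIV_def by blast
  \<comment> \<open>Powers below the \<open>N\<close>-th are cleared by \<open>g ^ N\<close>
    directly; the monic equation reduces all others to lower ones.\<close>
  have "g ^ N * w ^ m \<in> A" for m
  proof (induct m rule: less_induct)
    case (less m)
    show ?case
    proof (cases "m < N")
      case True
      have "g ^ N = g ^ (N - m) * g ^ m" using True by (simp flip: power_add)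
      then have "g ^ N * w ^ m = g ^ (N - m) * f ^ m" using fg by (simp add: power_divide)
      then show ?thesis using AD(5)[OF AD(8)[OF fg(2)] AD(8)[OF fg(1)]] by (simp only:)
    next
      case False
      then have "w ^ m = w ^ (m - N) * w ^ N" by (simp flip: power_add)
      then have "g ^ N * w ^ m = - (\<Sum>i<N. b i * (g ^ N * w ^ (m - N + i)))"
        by (simp add: wN sum_distrib_left power_add mult_ac)
      moreover have "g ^ N * w ^ (m - N + i) \<in> A" if "i < N" for i
        by (rule less) (use that False in auto)
      ultimately show ?thesis
        using AD(6)[OF k_subalgebra_sum[OF A(1), of "{..<N}" "\<lambda>i. b i * (g ^ N * w ^ (m - N + i))"]]
          AD(5)[OF b] by simp
    qed
  qed
  then have "w \<in> A" using closed[of "g ^ N" w] fg by auto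
  then have "inverse q * w \<in> R" using RD(3) q by (intro k_subalgebraD(5)[OF RD(2)]) auto
  moreover have "inverse q * w = z" using q(2) by (simp add: w_def)
  ultimately show "z \<in> R" by (simp only:)
qed

lemma submodule_span_combination:
  assumes R: "k_subalgebra emb R" and y: "y \<in> submodule_span R (w ` {..<r::nat})"
  shows "\<exists>c. (\<forall>j<r. c j \<in> R) \<and> y = (\<lambda>\<delta>. \<Sum>j<r. c j * w j \<delta>)"
  using y
proof (induct rule: submodule_span.induct)
  case zero
  then show ?case using k_subalgebraD(2)[OF R] by (intro exI[of _ "\<lambda>_. 0"]) auto
next
  case (step a e y)
  then obtain c i where c: "\<forall>j<r. c j \<in> R" "y = (\<lambda>\<delta>. \<Sum>j<r. c j * w j \<delta>)" and i: "i < r" "e = w i"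
    by auto
  have "(\<lambda>\<delta>. a * e \<delta> + y \<delta>) = (\<lambda>\<delta>. \<Sum>j<r. (if j = i then a + c j else c j) * w j \<delta>)"
  proof
    fix \<delta>
    have "(\<Sum>j<r. (if j = i then a + c j else c j) * w j \<delta>)
        = (\<Sum>j<r. (if j = i then a * w j \<delta> else 0) + c j * w j \<delta>)"
      by (intro sum.cong) (auto simp: distrib_right)
    then show "a * e \<delta> + y \<delta> = (\<Sum>j<r. (if j = i then a + c j else c j) * w j \<delta>)"
      using i c by (simp add: sum.distrib)
  qed
  moreover have "\<forall>j<r. (if j = i then a + c j else c j) \<in> R"
    using c step k_subalgebraD(4)[OF R] by auto
  ultimately show ?case by (intro exI[of _ "\<lambda>j. if j = i then a + c j else c j"]) auto
qed

end

context finite_dimensional_vector_space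
begin

text \<open>Compares \<open>F\<close> with the basis of coordinate functionals, which is dual to
  \<open>Basis\<close>. It allows the nonzero roots to be numbered by the indices below the
  dimension of \<open>G\<close>.\<close>

lemma dual_space_basis_card:
  assumes "fnv.independent F" "fnv.span F = dual_space scale"
  shows "card F = card Basis"
proof -
  define C where "C = (\<lambda>b t. representation Basis t b)"
  have C: "C b t = (if t = b then 1 else 0)" if "t \<in> Basis" for b t
    using representation_basis[OF independent_Basis that] by (simp add: C_def)
  have inj: "inj_on C Basis"
  proof (rule inj_onI)
    fix b b' assume b: "b \<in> Basis" "b' \<in> Basis" "C b = C b'"
    then have "C b b = C b' b" by (simp only:)
    then show "b = b'" using C[OF b(1)] by (simp split: if_splits)
  qed
  have "fnv.independent (C ` Basis)"
  proof (rule fnv.independent_if_scalars_zero)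
    fix u f assume *: "(\<Sum>f\<in>C ` Basis. (\<lambda>z. u f * f z)) = 0" "f \<in> C ` Basis"
    then obtain b where b: "b \<in> Basis" "f = C b" by auto
    have "(\<Sum>b'\<in>Basis. u (C b') * C b' b) = 0"
      using fun_cong[OF *(1), of b] by (simp add: sum.reindex[OF inj] sum_fun_apply)
    moreover have "(\<Sum>b'\<in>Basis. u (C b') * C b' b) = (\<Sum>b'\<in>Basis. if b' = b then u (C b') else 0)"
      using b by (intro sum.cong) (auto simp: C)
    ultimately show "u f = 0" using b finite_Basis by simp
  qed (simp add: finite_Basis)
  moreover have F: "finite F" "card F \<le> card Basis"
    using independent_dual_card[OF _ assms(1)] assms(2) fnv.span_superset[of F] by auto
  moreover have "C ` Basis \<subseteq> fnv.span F"
    unfolding assms(2) C_def using coordinate_dual_space by auto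
  ultimately have "card (C ` Basis) \<le> card F" using fnv.independent_span_bound by blast
  then show ?thesis using F by (simp add: card_image[OF inj])
qed

end

context rational_functions
begin

lemma mon_sum: "mon (\<Sum>i\<in>I. f i) = (\<Prod>i\<in>I. mon (f i))"
proof (induct I rule: infinite_finite_induct)
  case (insert i I)
  then show ?case by (simp only: sum.insert prod.insert mon_add not_False_eq_True)
qed (simp_all only: sum.infinite prod.infinite sum.empty prod.empty mon_0 not_False_eq_True)

lemma mon_scale: "mon (\<lambda>l. c * a l) = mon a powi c"
proof -
  have "(\<Prod>i\<in>I. f i powi c) = (\<Prod>i\<in>I. f i) powi c" for I and f :: "nat \<Rightarrow> 'K"
    by (induct I rule: infinite_finite_induct) (simp_all add: power_int_mult_distrib)
  then show ?thesis
    by (simp add: mon_def mult.commute[of c] power_int_mult)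
qed

lemma exps_sum: "(\<And>i. i \<in> I \<Longrightarrow> f i \<in> exps) \<Longrightarrow> (\<Sum>i\<in>I. f i) \<in> exps"
  by (induct I rule: infinite_finite_induct) (auto intro: exps_add)

lemma weight_sum: "weight \<alpha> (\<Sum>i\<in>I. f i) s = (\<Sum>i\<in>I. weight \<alpha> (f i) s)"
proof (induct I rule: infinite_finite_induct)
  case (insert i I)
  then show ?case by (simp only: sum.insert weight_add not_False_eq_True)
qed (simp_all add: weight_def)

lemma has_fraction_field_superset: "B \<subseteq> A \<Longrightarrow> has_fraction_field_UNIV A"
  using rat unfolding rational_function_field_def has_fraction_field_UNIV_def by (meson subsetD)

lemma k_subalgebra_torus [simp]: "k_subalgebra emb (torus_coordinate_ring emb n x)"
  by (simp add: torus_coordinate_ring_def)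

lemma torus_mem:
  assumes "i < n"
  shows "x i \<in> torus_coordinate_ring emb n x" "inverse (x i) \<in> torus_coordinate_ring emb n x"
  using assms by (auto simp: torus_coordinate_ring_def intro: hull_inc)

lemma torus_subset_iff:
  assumes "k_subalgebra emb A"
  shows "torus_coordinate_ring emb n x \<subseteq> A \<longleftrightarrow> (\<forall>i<n. x i \<in> A \<and> inverse (x i) \<in> A)"
  unfolding torus_coordinate_ring_def by (subst subset_hull[where S="k_subalgebra emb", OF assms]) auto

text \<open>Such fractions form an algebra containing the generators of the torus algebra. This is
  the hypothesis of \<open>local_rings_coarsen\<close>.\<close>

lemma torus_fractions:
  assumes A: "k_subalgebra emb A" "B \<subseteq> A" and c: "c \<in> torus_coordinate_ring emb n x"
  shows "\<exists>a\<in>A. \<exists>b\<in>A. b \<noteq> 0 \<and> c = a / b \<and> inverse b \<in> torus_coordinate_ring emb n x"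
proof -
  let ?T = "torus_coordinate_ring emb n x"
  define N where "N = {c. \<exists>a\<in>A. \<exists>b\<in>A. b \<noteq> 0 \<and> c = a / b \<and> inverse b \<in> ?T}"
  note AD = k_subalgebraD[OF A(1)]
  note TD = k_subalgebraD[OF k_subalgebra_torus]
  have AN: "A \<subseteq> N"
  proof
    fix a assume "a \<in> A"
    then show "a \<in> N" unfolding N_def using AD(3) TD(3)
      by (intro CollectI bexI[of _ a] bexI[of _ 1]) auto
  qed
  have "k_subalgebra emb N"
    unfolding k_subalgebra_def
  proof (intro conjI ballI)
    show "range emb \<subseteq> N" using AD(1) AN by auto
    fix c d assume "c \<in> N" "d \<in> N"
    then obtain a b a' b' where *: "a \<in> A" "b \<in> A" "b \<noteq> 0" "c = a / b" "inverse b \<in> ?T"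
      "a' \<in> A" "b' \<in> A" "b' \<noteq> 0" "d = a' / b'" "inverse b' \<in> ?T"
      by (auto simp: N_def)
    have i: "inverse (b * b') \<in> ?T" using TD(5)[OF *(5,10)] by simp
    have "c + d = (a * b' + a' * b) / (b * b')" using * by (simp add: field_simps)
    then show "c + d \<in> N" unfolding N_def using * i AD(4,5)
      by (intro CollectI bexI[of _ "a * b' + a' * b"] bexI[of _ "b * b'"]) auto
    have "c * d = (a * a') / (b * b')" using * by simp
    then show "c * d \<in> N" unfolding N_def using * i AD(5)
      by (intro CollectI bexI[of _ "a * a'"] bexI[of _ "b * b'"]) auto
  qed
  moreover have "inverse (x i) \<in> N" if "i < n" for i
    unfolding N_def using A(2) AD(3) that torus_mem(2)
    by (intro CollectI bexI[of _ 1] bexI[of _ "x i"]) (auto simp: inverse_eq_divide)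
  moreover have "x i \<in> N" if "i < n" for i
    using AN A(2) x_in_B[OF that] by blast
  ultimately have "?T \<subseteq> N" by (auto simp: torus_subset_iff)
  then show ?thesis using c by (auto simp: N_def)
qed

end

section \<open>The resolution when the nonzero roots form a basis\<close>

text \<open>\<open>\<beta>\<close> enumerates the nonzero roots.  The resolution is the blowing up of the product, over
  \<open>j < r\<close>, of the ideals generated by the coordinates \<open>x i\<close> with \<open>\<alpha> i = \<beta> j\<close>; its charts are indexed
  by the choices of one such coordinate for each \<open>j\<close>.\<close>

locale basis_foliation = toral_foliation emb n x scaleG BG \<alpha> r
  for emb :: "'k::field_char_0 \<Rightarrow> 'K::field" and n x
    and scaleG :: "'k \<Rightarrow> 'g::ab_group_add \<Rightarrow> 'g" and BG and \<alpha> :: "nat \<Rightarrow> 'g \<Rightarrow> 'k" and r +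
  fixes \<beta> :: "nat \<Rightarrow> 'g \<Rightarrow> 'k"
  assumes bij: "bij_betw \<beta> {..<r} (\<alpha> ` {..<n} - {0})"
    and indep: "fnv.independent (\<alpha> ` {..<n} - {0})"
begin

definition choices :: "(nat \<Rightarrow> nat) set" where
  "choices = (\<Pi>\<^sub>E j\<in>{..<r}. {i. i < n \<and> \<alpha> i = \<beta> j})"

text \<open>One generator from each of the \<open>r\<close> ideals: these products generate the
  product ideal and are the homogeneous coordinates of its blowing up.\<close>

definition choice_mon :: "(nat \<Rightarrow> nat) \<Rightarrow> 'K" where
  "choice_mon \<phi> = (\<Prod>j<r. x (\<phi> j))"

definition choice_exp :: "(nat \<Rightarrow> nat) \<Rightarrow> nat \<Rightarrow> int" where
  "choice_exp \<phi> = (\<Sum>j<r. unit_exp (\<phi> j))"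

abbreviation "F \<equiv> choice_mon ` choices"
abbreviation "X \<equiv> projective_model emb B F"
abbreviation "A \<phi> \<equiv> chart B F (choice_mon \<phi>)"

lemma beta_inj: "i < r \<Longrightarrow> j < r \<Longrightarrow> \<beta> i = \<beta> j \<longleftrightarrow> i = j"
  using bij by (auto simp: bij_betw_def inj_on_def)

lemma beta_nonzero: "j < r \<Longrightarrow> \<beta> j \<noteq> 0"
  using bij by (auto simp: bij_betw_def)

lemma root_cases:
  assumes "i < n"
  obtains "\<alpha> i = 0" | j where "j < r" "\<alpha> i = \<beta> j"
  using assms bij by (auto simp: bij_betw_def image_iff set_eq_iff)

lemma choicesD: "\<phi> \<in> choices \<Longrightarrow> j < r \<Longrightarrow> \<phi> j < n" "\<phi> \<in> choices \<Longrightarrow> j < r \<Longrightarrow> \<alpha> (\<phi> j) = \<beta> j"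
  by (auto simp: choices_def PiE_def Pi_def)

lemma choices_inj: "\<phi> \<in> choices \<Longrightarrow> i < r \<Longrightarrow> j < r \<Longrightarrow> \<phi> i = \<phi> j \<longleftrightarrow> i = j"
  using choicesD(2) beta_inj by metis

lemma choices_upd: "\<phi> \<in> choices \<Longrightarrow> j < r \<Longrightarrow> i < n \<Longrightarrow> \<alpha> i = \<beta> j \<Longrightarrow> \<phi>(j := i) \<in> choices"
  by (auto simp: choices_def PiE_def Pi_def extensional_def)

lemma choices_finite: "finite choices" and choices_nonempty: "choices \<noteq> {}"
proof -
  show "finite choices" unfolding choices_def by (intro finite_PiE) auto
  have "\<exists>i. i < n \<and> \<alpha> i = \<beta> j" if "j < r" for j
  proof -
    have "\<beta> j \<in> \<alpha> ` {..<n} - {0}" using bij_betw_apply[OF bij, of j] that by simp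
    then obtain i where "i < n" "\<alpha> i = \<beta> j" by (metis DiffD1 imageE lessThan_iff)
    then show ?thesis by blast
  qed
  then show "choices \<noteq> {}" by (auto simp: choices_def PiE_eq_empty_iff)
qed

lemma choice_mon_nonzero: "\<phi> \<in> choices \<Longrightarrow> choice_mon \<phi> \<noteq> 0"
  using choicesD(1) by (auto simp: choice_mon_def)

lemma choice_exp: "\<phi> \<in> choices \<Longrightarrow> choice_exp \<phi> \<in> exps" "\<phi> \<in> choices \<Longrightarrow> mon (choice_exp \<phi>) = choice_mon \<phi>"
  unfolding choice_exp_def choice_mon_def mon_sum
  using choicesD(1) by (auto intro!: exps_sum prod.cong)

text \<open>Changing the choice at \<open>j\<close> to \<open>i\<close> changes the product by just
  this ratio.\<close>

lemma ratio_in_chart: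
  assumes \<phi>: "\<phi> \<in> choices" and i: "i < n" "j < r" "\<alpha> i = \<beta> j"
  shows "x i / x (\<phi> j) \<in> A \<phi>"
proof -
  define \<psi> where "\<psi> = \<phi>(j := i)"
  have \<psi>: "\<psi> \<in> choices" unfolding \<psi>_def by (rule choices_upd[OF \<phi> i(2,1,3)])
  have "choice_mon \<psi> = x i * (\<Prod>l\<in>{..<r} - {j}. x (\<phi> l))"
    unfolding choice_mon_def using i by (subst prod.remove[of _ j]) (auto simp: \<psi>_def intro!: prod.cong)
  moreover have "choice_mon \<phi> = x (\<phi> j) * (\<Prod>l\<in>{..<r} - {j}. x (\<phi> l))"
    unfolding choice_mon_def using i by (subst prod.remove[of _ j]) auto
  ultimately have "choice_mon \<psi> / choice_mon \<phi> = x i / x (\<phi> j)"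
    using choice_mon_nonzero[OF \<phi>] by simp
  then show ?thesis using chartI(2)[of "choice_mon \<psi>" F "choice_mon \<phi>" B] \<psi> by auto
qed

text \<open>The monomials of a chart are those whose exponents have nonnegative coordinates \<open>coord \<phi> i\<close>
  with respect to the monomials \<open>x i / x (\<phi> j)\<close>, where \<open>\<alpha> i = \<beta> j\<close>, \<open>i \<noteq> \<phi> j\<close>, and \<open>x i\<close> for all other \<open>i\<close>.\<close>

definition coord :: "(nat \<Rightarrow> nat) \<Rightarrow> nat \<Rightarrow> (nat \<Rightarrow> int) \<Rightarrow> int" where
  "coord \<phi> i a = (if i \<in> \<phi> ` {..<r} then \<Sum>l | l < n \<and> \<alpha> l = \<alpha> i. a l else a i)"

definition coord_exp :: "(nat \<Rightarrow> nat) \<Rightarrow> nat \<Rightarrow> nat \<Rightarrow> int" where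
  "coord_exp \<phi> i = (if \<alpha> i = 0 \<or> i \<in> \<phi> ` {..<r} then unit_exp i
     else unit_exp i - unit_exp (\<phi> (inv_into {..<r} \<beta> (\<alpha> i))))"

definition chart_exps :: "(nat \<Rightarrow> nat) \<Rightarrow> (nat \<Rightarrow> int) set" where
  "chart_exps \<phi> = {a \<in> exps. \<forall>i<n. 0 \<le> coord \<phi> i a}"

lemma inv_beta: "j < r \<Longrightarrow> inv_into {..<r} \<beta> (\<beta> j) = j"
  using bij by (simp add: bij_betw_def)

lemma coord_add: "coord \<phi> i (a + b) = coord \<phi> i a + coord \<phi> i b"
  by (simp add: coord_def sum.distrib)

lemma coord_diff: "coord \<phi> i (a - b) = coord \<phi> i a - coord \<phi> i b"
  by (simp add: coord_def sum_subtractf)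

lemma coord_scale: "coord \<phi> i (\<lambda>l. c * a l) = c * coord \<phi> i a"
  by (simp add: coord_def sum_distrib_left)

lemma coord_0: "coord \<phi> i 0 = 0"
  by (simp add: coord_def)

lemma coord_exp_simps:
  assumes \<phi>: "\<phi> \<in> choices" and i: "i < n"
  shows "coord_exp \<phi> i \<in> exps" "mon (coord_exp \<phi> i) \<in> A \<phi>"
proof -
  have xB: "x i \<in> A \<phi>" using i by (intro chartI(1)) auto
  from i show "coord_exp \<phi> i \<in> exps"
  proof (cases rule: root_cases)
    case (2 j)
    then show ?thesis using choicesD[OF \<phi>] i by (auto simp: coord_exp_def inv_beta)
  qed (use i in \<open>auto simp: coord_exp_def\<close>)
  from i show "mon (coord_exp \<phi> i) \<in> A \<phi>"
  proof (cases rule: root_cases)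
    case (2 j)
    then show ?thesis
      using ratio_in_chart[OF \<phi> i 2] choicesD[OF \<phi>] i xB
      by (auto simp: coord_exp_def inv_beta mon_diff)
  qed (use i xB in \<open>auto simp: coord_exp_def\<close>)
qed

text \<open>Only the entries at the chosen indices need care. There \<open>coord\<close> is the sum
  of \<open>a\<close> over all variables with the same root, and the denominators of the ratios take
  the other entries of that class away again.\<close>

lemma coord_decomposition:
  assumes \<phi>: "\<phi> \<in> choices" and a: "a \<in> exps"
  shows "a = (\<Sum>i<n. (\<lambda>l. coord \<phi> i a * coord_exp \<phi> i l))"
proof
  fix l
  show "a l = (\<Sum>i<n. (\<lambda>l. coord \<phi> i a * coord_exp \<phi> i l)) l"
  proof (cases "l < n")
    case False
    then have "coord_exp \<phi> i l = 0" if "i < n" for i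
      using coord_exp_simps(1)[OF \<phi> that] by (auto simp: exps_def)
    then show ?thesis using False a by (simp add: sum_fun_apply exps_def)
  next
    case l: True
    show ?thesis
    proof (cases "l \<in> \<phi> ` {..<r}")
      case False
      have "coord_exp \<phi> i l = (if i = l then 1 else 0)" if "i < n" for i
        using that
      proof (cases rule: root_cases)
        case (2 j)
        then show ?thesis using False by (auto simp: coord_exp_def unit_exp_def inv_beta)
      qed (auto simp: coord_exp_def unit_exp_def)
      then have "(\<Sum>i<n. coord \<phi> i a * coord_exp \<phi> i l) = (\<Sum>i<n. if i = l then coord \<phi> i a else 0)"
        by (intro sum.cong) auto
      then show ?thesis using l False by (simp add: sum_fun_apply coord_def)
    next
      case True
      then obtain j where j: "j < r" "l = \<phi> j" by auto
      define C where "C = {i. i < n \<and> \<alpha> i = \<beta> j}"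
      have lC: "l \<in> C" "finite C" "C \<subseteq> {..<n}" using choicesD[OF \<phi> j(1)] j by (auto simp: C_def)
      have trm: "coord \<phi> i a * coord_exp \<phi> i l =
          (if i = l then sum a C else if i \<in> C then - a i else 0)" if i: "i < n" for i
      proof (cases "i = l")
        case True
        then show ?thesis using j choicesD(2)[OF \<phi> j(1)]
          by (auto simp: coord_def coord_exp_def C_def)
      next
        case il: False
        show ?thesis
        proof (cases "i \<in> C")
          case True
          then have "i \<notin> \<phi> ` {..<r}"
            using il j choicesD(2)[OF \<phi>] beta_inj by (auto simp: C_def)
          then show ?thesis
            using True il j beta_nonzero[OF j(1)]
            by (auto simp: coord_def coord_exp_def C_def inv_beta unit_exp_def)
        next
          case False
          from i show ?thesis
          proof (cases rule: root_cases)
            case 1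
            then show ?thesis using il False by (simp add: coord_exp_def)
          next
            case (2 j')
            then have "j' \<noteq> j" using False i by (auto simp: C_def)
            then have "\<phi> j' \<noteq> l" using choices_inj[OF \<phi> 2(1) j(1)] j by simp
            then show ?thesis using il False 2 by (simp add: coord_exp_def inv_beta)
          qed
        qed
      qed
      have "(\<Sum>i<n. coord \<phi> i a * coord_exp \<phi> i l) =
          (\<Sum>i<n. if i = l then sum a C else if i \<in> C then - a i else 0)"
        by (intro sum.cong) (auto simp: trm)
      also have "\<dots> = sum a C + (\<Sum>i\<in>{..<n} - {l}. if i \<in> C then - a i else 0)"
        using l by (subst sum.remove[of _ l]) (auto intro!: sum.cong)
      also have "(\<Sum>i\<in>{..<n} - {l}. if i \<in> C then - a i else 0) = (\<Sum>i\<in>C - {l}. - a i)"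
        using lC by (intro sum.mono_neutral_cong_right) auto
      also have "sum a C + (\<Sum>i\<in>C - {l}. - a i) = a l"
        using lC by (simp add: sum.remove[of C l] sum_negf)
      finally show ?thesis by (simp add: sum_fun_apply)
    qed
  qed
qed

lemma chart_exps: "chart_exps \<phi> \<subseteq> exps" "0 \<in> chart_exps \<phi>"
  "a \<in> chart_exps \<phi> \<Longrightarrow> b \<in> chart_exps \<phi> \<Longrightarrow> a + b \<in> chart_exps \<phi>"
  by (auto simp: chart_exps_def coord_add coord_0 exps_add)

text \<open>At a chosen index the coordinate counts the factors belonging to one root, and every
  choice has exactly one. At any other index the exponent of the choice \<phi> is zero.\<close>

lemma coord_choice_exp:
  assumes "\<phi> \<in> choices" "\<psi> \<in> choices" "i < n"
  shows "coord \<phi> i (choice_exp \<phi>) \<le> coord \<phi> i (choice_exp \<psi>)"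
proof (cases "i \<in> \<phi> ` {..<r}")
  case True
  then obtain j where j: "j < r" "i = \<phi> j" by auto
  have *: "coord \<phi> i (choice_exp \<psi>) = 1" if \<psi>: "\<psi> \<in> choices" for \<psi>
  proof -
    have "coord \<phi> i (choice_exp \<psi>) = (\<Sum>l | l < n \<and> \<alpha> l = \<beta> j. \<Sum>j'<r. unit_exp (\<psi> j') l)"
      using j choicesD(2)[OF assms(1) j(1)] by (simp add: coord_def choice_exp_def sum_fun_apply)
    also have "\<dots> = (\<Sum>j'<r. \<Sum>l | l < n \<and> \<alpha> l = \<beta> j. unit_exp (\<psi> j') l)" by (rule sum.swap)
    also have "\<dots> = (\<Sum>j'<r. if j' = j then 1 else 0)"
    proof (rule sum.cong[OF refl])
      fix j' assume j': "j' \<in> {..<r}"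
      have "(\<Sum>l | l < n \<and> \<alpha> l = \<beta> j. unit_exp (\<psi> j') l)
          = (\<Sum>l | l < n \<and> \<alpha> l = \<beta> j. if l = \<psi> j' then 1 else 0)"
        by (simp add: unit_exp_def)
      also have "\<dots> = (if j' = j then 1 else 0)"
        using j' j choicesD[OF \<psi>, of j'] beta_inj by auto
      finally show "(\<Sum>l | l < n \<and> \<alpha> l = \<beta> j. unit_exp (\<psi> j') l) = (if j' = j then 1 else 0)" .
    qed
    finally show ?thesis using j by simp
  qed
  show ?thesis using *[OF assms(1)] *[OF assms(2)] by simp
next
  case False
  then have "coord \<phi> i (choice_exp \<phi>) = 0"
    by (auto simp: coord_def choice_exp_def sum_fun_apply unit_exp_def intro!: sum.neutral)
  moreover have "0 \<le> coord \<phi> i (choice_exp \<psi>)"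
    using False by (auto simp: coord_def choice_exp_def sum_fun_apply unit_exp_def intro!: sum_nonneg)
  ultimately show ?thesis by simp
qed

text \<open>One inclusion is checked on the generators of the chart. For the other,
  \<open>coord_decomposition\<close> writes a monomial as a product of nonnegative powers of the
  \<open>mon (coord_exp \<phi> i)\<close>, all of which lie in the chart.\<close>

lemma chart_eq_span:
  assumes \<phi>: "\<phi> \<in> choices"
  shows "A \<phi> = kv.span (mon ` chart_exps \<phi>)"
proof
  have sub: "k_subalgebra emb (kv.span (mon ` chart_exps \<phi>))"
    by (intro k_subalgebra_span_mon chart_exps)
  have mem: "mon a \<in> kv.span (mon ` chart_exps \<phi>)" if "a \<in> chart_exps \<phi>" for a
    using that by (intro kv.span_base) auto
  show "A \<phi> \<subseteq> kv.span (mon ` chart_exps \<phi>)"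
    unfolding chart_subset_iff[OF sub] B_subset_iff[OF sub]
  proof (intro conjI allI impI ballI)
    fix i assume i: "i < n"
    have "0 \<le> coord \<phi> l (unit_exp i)" for l
      by (auto simp: coord_def unit_exp_def intro!: sum_nonneg)
    then have "unit_exp i \<in> chart_exps \<phi>"
      using i by (simp add: chart_exps_def)
    then show "x i \<in> kv.span (mon ` chart_exps \<phi>)" using mem[of "unit_exp i"] i by simp
  next
    fix g assume "g \<in> F"
    then obtain \<psi> where \<psi>: "\<psi> \<in> choices" "g = choice_mon \<psi>" by auto
    have "choice_exp \<psi> - choice_exp \<phi> \<in> chart_exps \<phi>"
      using choice_exp(1)[OF \<phi>] choice_exp(1)[OF \<psi>(1)] coord_choice_exp[OF \<phi> \<psi>(1)]
      by (auto simp: chart_exps_def coord_diff)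
    from mem[OF this] show "g / choice_mon \<phi> \<in> kv.span (mon ` chart_exps \<phi>)"
      using choice_exp(2)[OF \<phi>] choice_exp(2)[OF \<psi>(1)] \<psi>(2) by (simp add: mon_diff)
  qed
  show "kv.span (mon ` chart_exps \<phi>) \<subseteq> A \<phi>"
  proof (intro kv.span_minimal k_subalgebra_subspace k_subalgebra_chart image_subsetI)
    fix a assume a: "a \<in> chart_exps \<phi>"
    then have "a \<in> exps" by (simp add: chart_exps_def)
    then have "mon a = mon (\<Sum>i<n. (\<lambda>l. coord \<phi> i a * coord_exp \<phi> i l))"
      using coord_decomposition[OF \<phi>] by metis
    also have "\<dots> = (\<Prod>i<n. mon (coord_exp \<phi> i) ^ nat (coord \<phi> i a))"
      unfolding mon_sum mon_scale
      using a by (intro prod.cong) (auto simp: chart_exps_def power_int_def)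
    also have "\<dots> \<in> A \<phi>"
      using coord_exp_simps(2)[OF \<phi>]
      by (intro k_subalgebra_prod k_subalgebra_chart k_subalgebraD(8)[OF k_subalgebra_chart]) auto
    finally show "mon a \<in> A \<phi>" .
  qed
qed

text \<open>The coefficient of degree \<open>n\<close> makes the order graded, so that only finitely many elements of
  \<open>chart_exps \<phi>\<close> have valuation at least that of a given one.\<close>

definition graded_val :: "(nat \<Rightarrow> nat) \<Rightarrow> (nat \<Rightarrow> int) \<Rightarrow> real poly" where
  "graded_val \<phi> a = - (monom (of_int (\<Sum>i<n. coord \<phi> i a)) n + order_val id a)"

lemma order_val_id_coeff: "coeff (order_val id a) i = (if i < n then of_int (a i) else 0)"
  by (simp add: order_val_def coeff_sum)

text \<open>The degrees below \<open>n\<close> hold the entries of \<open>a\<close> and alone give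
  injectivity; they only break ties in the total. By the minus sign in \<open>graded_val\<close>,
  raising the value cannot raise the total.\<close>

lemma graded_valuation: "monomial_valuation emb n x (graded_val \<phi>)"
proof
  show "graded_val \<phi> (a + b) = graded_val \<phi> a + graded_val \<phi> b" for a b
    by (simp add: graded_val_def order_val_def coord_add sum.distrib flip: add_monom)
  show "a = 0" if "a \<in> exps" "graded_val \<phi> a = 0" for a
  proof
    fix i show "a i = 0 i"
    proof (cases "i < n")
      case True
      have "coeff (graded_val \<phi> a) i = - of_int (a i)"
        using True by (simp add: graded_val_def order_val_id_coeff)
      then show ?thesis using that by simp
    qed (use that in \<open>simp add: exps_def\<close>)
  qed
qed

lemma graded_val_le:
  assumes "graded_val \<phi> a \<le> graded_val \<phi> b"
  shows "(\<Sum>i<n. coord \<phi> i b) \<le> (\<Sum>i<n. coord \<phi> i a)"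
proof (rule ccontr)
  assume less: "\<not> ?thesis"
  have "0 < graded_val \<phi> a - graded_val \<phi> b"
  proof (rule pos_polyI[of _ n])
    show "0 < coeff (graded_val \<phi> a - graded_val \<phi> b) n"
      using less by (simp add: graded_val_def order_val_id_coeff flip: of_int_sum)
    show "degree (graded_val \<phi> a - graded_val \<phi> b) \<le> n"
      by (rule degree_le) (simp add: graded_val_def order_val_id_coeff)
  qed
  then show False using assms by simp
qed

text \<open>The coordinates are nonnegative with bounded sum, and they determine the
  exponent.\<close>

lemma chart_exps_finite:
  assumes \<phi>: "\<phi> \<in> choices"
  shows "finite {b \<in> chart_exps \<phi>. graded_val \<phi> a \<le> graded_val \<phi> b}"
proof -
  define D where "D = (\<Sum>i<n. coord \<phi> i a)"
  define f where "f = (\<lambda>b. restrict (\<lambda>i. coord \<phi> i b) {..<n})"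
  let ?S = "{b \<in> chart_exps \<phi>. graded_val \<phi> a \<le> graded_val \<phi> b}"
  have "f ` ?S \<subseteq> (\<Pi>\<^sub>E i\<in>{..<n}. {0..D})"
  proof (intro image_subsetI PiE_I)
    fix b i assume b: "b \<in> ?S" and i: "i \<in> {..<n}"
    have "coord \<phi> i b \<le> (\<Sum>i<n. coord \<phi> i b)"
      using b i by (intro member_le_sum) (auto simp: chart_exps_def)
    then show "f b i \<in> {0..D}"
      using b i graded_val_le[of \<phi> a b] by (auto simp: f_def D_def chart_exps_def)
  qed (auto simp: f_def)
  moreover have "finite (\<Pi>\<^sub>E i\<in>{..<n}. {0..D})" by (intro finite_PiE) auto
  ultimately have "finite (f ` ?S)" by (rule finite_subset)
  moreover have "inj_on f ?S"
  proof (rule inj_onI)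
    fix b c assume bc: "b \<in> ?S" "c \<in> ?S" "f b = f c"
    then have e: "b \<in> exps" "c \<in> exps" by (auto simp: chart_exps_def)
    have "coord \<phi> i b = coord \<phi> i c" if "i < n" for i
      using fun_cong[OF bc(3), of i] that by (simp add: f_def)
    then have "(\<Sum>i<n. (\<lambda>l. coord \<phi> i b * coord_exp \<phi> i l)) = (\<Sum>i<n. (\<lambda>l. coord \<phi> i c * coord_exp \<phi> i l))"
      by (intro sum.cong) auto
    then show "b = c" using coord_decomposition[OF \<phi> e(1)] coord_decomposition[OF \<phi> e(2)] by simp
  qed
  ultimately show ?thesis by (rule finite_imageD)
qed

lemma chart_completely_integrally_closed:
  assumes \<phi>: "\<phi> \<in> choices" and d: "d \<noteq> 0" "\<And>m. d * z ^ m \<in> A \<phi>"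
  shows "z \<in> A \<phi>"
  unfolding chart_eq_span[OF \<phi>]
proof (rule monomial_valuation.completely_integrally_closed[OF graded_valuation[of \<phi>]])
  fix a b assume a: "a \<in> exps" "b \<in> chart_exps \<phi>" "\<And>m. b + (\<lambda>i. int m * a i) \<in> chart_exps \<phi>"
  have "0 \<le> coord \<phi> i a" if i: "i < n" for i
  proof (rule ccontr)
    assume "\<not> 0 \<le> coord \<phi> i a"
    then have neg: "coord \<phi> i a \<le> - 1" by simp
    \<comment> \<open>More than the coordinate of \<open>b\<close>, so that \<open>m\<close> times a
      coordinate of at most \<open>- 1\<close> outweighs it.\<close>
    define m where "m = nat (coord \<phi> i b) + 1"
    have "0 \<le> coord \<phi> i (b + (\<lambda>l. int m * a l))"
      using a(3)[of m] i by (simp add: chart_exps_def)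
    then have "0 \<le> coord \<phi> i b + int m * coord \<phi> i a" by (simp only: coord_add coord_scale)
    moreover have "int m * coord \<phi> i a \<le> int m * (- 1)"
      using neg by (intro mult_left_mono) auto
    moreover have "coord \<phi> i b < int m" by (simp add: m_def)
    ultimately show False by linarith
  qed
  then show "a \<in> chart_exps \<phi>" using a by (simp add: chart_exps_def)
qed (use chart_exps chart_exps_finite[OF \<phi>] d chart_eq_span[OF \<phi>] in auto)

section \<open>The blowing up is a toric variety, projective over \<open>V\<close>\<close>

lemma chart_generators:
  "A \<phi> = k_subalgebra emb hull (x ` {..<n} \<union> (\<lambda>g. g / choice_mon \<phi>) ` F)"
  unfolding chart_def affine_coordinate_ring_def by (rule hull_Un_left[symmetric])

lemma B_subset_chart: "B \<subseteq> A \<phi>"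
  using chartI(1) by auto

lemma X_cases:
  assumes "R \<in> X"
  obtains \<phi> where "\<phi> \<in> choices" "R \<in> local_rings (A \<phi>)"
  using assms by (auto simp: projective_model_chart)

lemma F_nonzero: "0 \<notin> F"
  using choice_mon_nonzero by auto

lemma toric_variety_X: "toric_variety emb n x X"
  unfolding toric_variety_def
proof (intro conjI exI[of _ "chart B F ` F"])
  show "variety_covered_by emb (chart B F ` F) X"
    unfolding variety_covered_by_def
  proof (intro conjI ballI)
    show "finite (chart B F ` F)" "chart B F ` F \<noteq> {}"
      using choices_finite choices_nonempty by auto
    show "X = (\<Union>A\<in>chart B F ` F. local_rings A)" by (simp add: projective_model_chart)
    show "separated X" by (rule separated_projective_model[OF F_nonzero])
    fix C assume "C \<in> chart B F ` F"
    then obtain \<phi> where C: "\<phi> \<in> choices" "C = A \<phi>" by auto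
    show "affine_model emb C"
      unfolding affine_model_def C(2)
    proof
      show "\<exists>G. finite G \<and> A \<phi> = k_subalgebra emb hull G"
        using chart_generators choices_finite by (intro exI conjI) auto
    qed (rule has_fraction_field_superset[OF B_subset_chart])
  qed
  show "\<forall>C\<in>chart B F ` F. torus_stable emb n x C"
  proof
    fix C assume "C \<in> chart B F ` F"
    then obtain \<phi> where C: "\<phi> \<in> choices" "C = A \<phi>" by auto
    have "mon ` chart_exps \<phi> \<subseteq> C \<inter> characters n x"
      unfolding C(2) chart_eq_span[OF C(1)] characters_eq
      using chart_exps(1) kv.span_superset by blast
    then have "C \<subseteq> kv.span (C \<inter> characters n x)"
      using kv.span_mono chart_eq_span[OF C(1)] C(2) by metis
    moreover have "kv.span (C \<inter> characters n x) \<subseteq> C"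
      unfolding C(2) by (intro kv.span_minimal k_subalgebra_subspace k_subalgebra_chart) auto
    ultimately show "torus_stable emb n x C" unfolding torus_stable_def by auto
  qed
  show "normal_variety X"
    unfolding normal_variety_def
  proof
    fix R assume "R \<in> X"
    then obtain \<phi> where \<phi>: "\<phi> \<in> choices" "R \<in> local_rings (A \<phi>)" by (rule X_cases)
    show "integrally_closed R"
      by (rule integrally_closed_local_ring[OF k_subalgebra_chart has_fraction_field_superset \<phi>(2)])
        (fact B_subset_chart, erule chart_completely_integrally_closed[OF \<phi>(1)])
  qed
  let ?T = "torus_coordinate_ring emb n x"
  note TD = k_subalgebraD[OF k_subalgebra_torus]
  show "zariski_open X (local_rings ?T)"
    unfolding zariski_open_def
  proof (intro conjI ballI)
    obtain \<phi> where \<phi>: "\<phi> \<in> choices" using choices_nonempty by auto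
    have FT: "g \<in> ?T" "inverse g \<in> ?T" if "g \<in> F" for g
    proof -
      obtain \<psi> where \<psi>: "\<psi> \<in> choices" "g = choice_mon \<psi>" using \<open>g \<in> F\<close> by auto
      show "g \<in> ?T" unfolding \<psi> choice_mon_def
        using choicesD(1)[OF \<psi>(1)] torus_mem by (intro k_subalgebra_prod k_subalgebra_torus) auto
      have "inverse g = (\<Prod>j<r. inverse (x (\<psi> j)))"
        unfolding \<psi> choice_mon_def by (simp flip: prod_inversef)
      also have "\<dots> \<in> ?T"
        using choicesD(1)[OF \<psi>(1)] torus_mem by (intro k_subalgebra_prod k_subalgebra_torus) auto
      finally show "inverse g \<in> ?T" .
    qed
    have "A \<phi> \<subseteq> ?T"
      unfolding chart_subset_iff[OF k_subalgebra_torus] B_subset_iff[OF k_subalgebra_torus]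
    proof (intro conjI ballI)
      fix g assume "g \<in> F"
      then show "g / choice_mon \<phi> \<in> ?T"
        using TD(5)[OF FT(1)[of g] FT(2)[of "choice_mon \<phi>"]] \<phi> by (auto simp: field_simps)
    qed (use torus_mem in auto)
    \<comment> \<open>The torus algebra is a localization of the chart, so each of its local rings
      is one of the chart.\<close>
    then have "local_rings ?T \<subseteq> local_rings (A \<phi>)"
      using local_rings_coarsen[OF k_subalgebra_chart k_subalgebra_torus]
        torus_fractions[OF k_subalgebra_chart B_subset_chart] by blast
    then show "local_rings ?T \<subseteq> X" using \<phi> by (auto simp: projective_model_chart)
    fix R assume R: "R \<in> local_rings ?T"
    \<comment> \<open>The torus is the locus where all \<open>inverse (x i)\<close> are
      regular.\<close>
    show "\<exists>G. finite G \<and> G \<subseteq> R \<and> {R' \<in> X. G \<subseteq> R'} \<subseteq> local_rings ?T"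
    proof (intro exI[of _ "(\<lambda>i. inverse (x i)) ` {..<n}"] conjI subsetI)
      fix z assume "z \<in> (\<lambda>i. inverse (x i)) ` {..<n}"
      then show "z \<in> R" using torus_mem local_ringsD(3)[OF k_subalgebra_torus R] by auto
    next
      fix R' assume R': "R' \<in> {R' \<in> X. (\<lambda>i. inverse (x i)) ` {..<n} \<subseteq> R'}"
      then have "R' \<in> X" by simp
      then obtain \<psi> where \<psi>: "\<psi> \<in> choices" "R' \<in> local_rings (A \<psi>)" by (rule X_cases)
      note D = local_ringsD[OF k_subalgebra_chart \<psi>(2)]
      have BR: "B \<subseteq> R'" using D(3) B_subset_chart by auto
      have "?T \<subseteq> R'"
        using R' BR x_in_B by (auto simp: torus_subset_iff[OF D(2)])
      moreover have "A \<psi> \<subseteq> ?T"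
        unfolding chart_subset_iff[OF k_subalgebra_torus] B_subset_iff[OF k_subalgebra_torus]
      proof (intro conjI ballI)
        fix g assume "g \<in> F"
        then show "g / choice_mon \<psi> \<in> ?T"
          using TD(5)[OF FT(1)[of g] FT(2)[of "choice_mon \<psi>"]] \<psi> by (auto simp: field_simps)
      qed (use torus_mem in auto)
      ultimately show "R' \<in> local_rings ?T"
        by (intro local_rings_refine[OF k_subalgebra_chart \<psi>(2)] k_subalgebra_torus)
    qed simp
  qed
qed

text \<open>One affine neighborhood, \<open>Spec B\<close>, serves for all points: the blowing up is
  projective over the whole of \<open>V\<close>.\<close>

lemma locally_projective_X: "locally_projective emb X (affine_space emb n x)"
proof -
  have dom: "\<exists>Q\<in>affine_space emb n x. dominates R Q" if "R \<in> X" for R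
  proof -
    obtain \<phi> where \<phi>: "\<phi> \<in> choices" "R \<in> local_rings (A \<phi>)" using \<open>R \<in> X\<close> by (rule X_cases)
    note D = local_ringsD[OF k_subalgebra_chart \<phi>(2)]
    have BR: "B \<subseteq> R" using D(3) B_subset_chart by auto
    show ?thesis
      unfolding affine_space_def
      using center_in_local_rings[OF D(1) k_subalgebra_B BR] dominates_center[OF D(1) BR] by blast
  qed
  have "affine_model emb B"
    unfolding affine_model_def
  proof
    show "\<exists>G. finite G \<and> B = k_subalgebra emb hull G"
      unfolding affine_coordinate_ring_def by (rule exI[of _ "x ` {..<n}"]) simp
  qed (rule has_fraction_field_superset, simp)
  moreover have "zariski_open (affine_space emb n x) (local_rings B)"
    by (auto simp: zariski_open_def affine_space_def)
  moreover have "{R \<in> X. \<exists>Q'\<in>local_rings B. dominates R Q'} = X"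
    using dom by (auto simp: affine_space_def)
  moreover have "finite F" "F \<noteq> {}" using choices_finite choices_nonempty by auto
  ultimately have "\<exists>C. affine_model emb C \<and> Q \<in> local_rings C \<and> zariski_open (affine_space emb n x) (local_rings C) \<and>
      (\<exists>F. finite F \<and> F \<noteq> {} \<and> 0 \<notin> F \<and>
        {R \<in> X. \<exists>Q'\<in>local_rings C. dominates R Q'} = projective_model emb C F)"
    if "Q \<in> affine_space emb n x" for Q
    using F_nonzero that unfolding affine_space_def by blast
  then show ?thesis
    using dom unfolding locally_projective_def birational_morphism_def by blast
qed

section \<open>The foliation on the blowing up\<close>

lemma weight_choice_exp:
  assumes "\<phi> \<in> choices"
  shows "weight \<alpha> (choice_exp \<phi>) s = (\<Sum>j<r. \<beta> j s)"
  unfolding choice_exp_def weight_sum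
  using choicesD[OF assms] by (intro sum.cong) (auto simp: weight_unit)

lemma foliation_weight_0:
  assumes "\<delta> \<in> L" "\<And>s. weight \<alpha> a s = 0"
  shows "\<delta> (mon a) = 0"
  using foliation_relation[where J="{0::nat}" and \<mu>="\<lambda>_. 1" and a="\<lambda>_. a", OF assms(1)] assms(2) by simp

lemma foliation_same_weight:
  assumes "\<delta> \<in> L" "\<And>s. weight \<alpha> a s = weight \<alpha> b s"
  shows "\<delta> (mon a) / mon a = \<delta> (mon b) / mon b"
proof -
  have "\<delta> (mon (a - b)) = 0"
    by (rule foliation_weight_0[OF assms(1)]) (simp only: weight_diff assms(2) diff_self)
  moreover have "\<delta> (mon (a - b) * mon b) / (mon (a - b) * mon b)
      = \<delta> (mon (a - b)) / mon (a - b) + \<delta> (mon b) / mon b"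
    by (rule log_derivation_mult[OF foliation_derivation[OF assms(1)]]) auto
  moreover have "mon (a - b) * mon b = mon a" by (simp add: mon_diff)
  ultimately show ?thesis by simp
qed

text \<open>If \<open>x i\<close> and \<open>x (\<phi> j)\<close> have the same root, the foliation
  kills their ratio, so the differential of \<open>x i\<close> is that ratio times the one of
  \<open>x (\<phi> j)\<close>. Only regularity of these ratios is required, and \<open>R\<close> may
  come from another chart; thus one basis works on an open set.\<close>

lemma free_basis:
  assumes \<phi>: "\<phi> \<in> choices" and R: "R \<in> X"
    and ratio: "\<And>i j. i < n \<Longrightarrow> j < r \<Longrightarrow> \<alpha> i = \<beta> j \<Longrightarrow> x i / x (\<phi> j) \<in> R"
  shows "is_free_basis R (omega_stalk L R) r (\<lambda>j. differential L (x (\<phi> j)))"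
proof -
  define w where "w = (\<lambda>j. differential L (x (\<phi> j)))"
  obtain \<psi> where \<psi>: "\<psi> \<in> choices" "R \<in> local_rings (A \<psi>)" using R by (rule X_cases)
  note D = local_ringsD[OF k_subalgebra_chart \<psi>(2)]
  have xR: "x i \<in> R" if "i < n" for i using that D(3) B_subset_chart x_in_B by blast
  have "omega_stalk L R \<subseteq> submodule_span R (w ` {..<r})"
  proof (rule omega_stalk_subset[OF D(2)])
    fix z assume "z \<in> R"
    then show "differential L z \<in> submodule_span R (w ` {..<r})"
    proof (rule differential_in_submodule_span[OF \<psi>(2) chart_generators, rotated 2])
      show "k_derivation emb \<delta>" if "\<delta> \<in> L" for \<delta> using that by (rule foliation_derivation)
      fix a assume "a \<in> x ` {..<n} \<union> (\<lambda>g. g / choice_mon \<psi>) ` F"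
      then consider i where "i < n" "a = x i" | \<chi> where "\<chi> \<in> choices" "a = choice_mon \<chi> / choice_mon \<psi>"
        by auto
      then show "differential L a \<in> submodule_span R (w ` {..<r})"
      proof cases
        case (1 i)
        from 1(1) show ?thesis
        proof (cases rule: root_cases)
          case zero: 1
          have "\<delta> (mon (unit_exp i)) = 0" if "\<delta> \<in> L" for \<delta>
            using that by (rule foliation_weight_0) (use zero 1 in \<open>simp add: weight_unit\<close>)
          then have "differential L a = (\<lambda>_. 0)" using 1 by (auto simp: differential_def)
          then show ?thesis using submodule_span.zero by simp
        next
          case (2 j)
          have "\<delta> (x i) = x i / x (\<phi> j) * \<delta> (x (\<phi> j))" if "\<delta> \<in> L" for \<delta>
            using foliation_same_weight[OF that, of "unit_exp i" "unit_exp (\<phi> j)"]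
              1 2 choicesD[OF \<phi> 2(1)] by (simp add: weight_unit field_simps)
          then have "differential L a = (\<lambda>\<delta>. x i / x (\<phi> j) * w j \<delta>)"
            using 1 by (auto simp: differential_def w_def)
          moreover have "(\<lambda>\<delta>. x i / x (\<phi> j) * w j \<delta>) \<in> submodule_span R (w ` {..<r})"
            using ratio[OF 1(1) 2] 2
            by (intro submodule_span_scale[OF D(2)] submodule_span_base[OF D(2)]) auto
          ultimately show ?thesis by simp
        qed
      next
        case (2 \<chi>)
        \<comment> \<open>All choice exponents have the same weight, the sum of the \<beta> j, so
          the foliation kills the quotients of the homogeneous coordinates.\<close>
        have a: "a = mon (choice_exp \<chi> - choice_exp \<psi>)"
          using 2 \<psi> by (simp add: mon_diff choice_exp)
        have "\<delta> a = 0" if "\<delta> \<in> L" for \<delta>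
          unfolding a using that
          by (rule foliation_weight_0) (simp add: weight_diff weight_choice_exp 2 \<psi>)
        then have "differential L a = (\<lambda>_. 0)" by (auto simp: differential_def)
        then show ?thesis using submodule_span.zero by simp
      qed
    qed
  qed
  moreover obtain s where "\<And>f t. f \<in> dual_space scaleG \<Longrightarrow> f t = (\<Sum>j<r. f (s j) * \<beta> j t)"
    and s: "\<And>i j. i < r \<Longrightarrow> j < r \<Longrightarrow> \<beta> i (s j) = (if j = i then 1 else 0)"
  proof (rule G.dual_basis_exists[OF dim[symmetric], of \<beta>])
    show "\<beta> j \<in> dual_space scaleG" if "j < r" for j
      using choicesD[OF \<phi> that] roots by metis
    fix \<mu> j assume \<mu>: "\<And>t. (\<Sum>j<r. \<mu> j * \<beta> j t) = 0" and j: "j < r"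
    have inj: "inj_on \<beta> {..<r}" and im: "\<beta> ` {..<r} = \<alpha> ` {..<n} - {0}"
      using bij by (auto simp: bij_betw_def)
    let ?u = "\<lambda>f. \<mu> (inv_into {..<r} \<beta> f)"
    have "(\<Sum>f\<in>\<beta> ` {..<r}. (\<lambda>z. ?u f * f z)) = 0"
    proof
      fix z
      have "(\<Sum>f\<in>\<beta> ` {..<r}. (\<lambda>z. ?u f * f z)) z = (\<Sum>j<r. \<mu> j * \<beta> j z)"
        by (simp add: sum_fun_apply sum.reindex[OF inj] inv_beta)
      then show "(\<Sum>f\<in>\<beta> ` {..<r}. (\<lambda>z. ?u f * f z)) z = 0 z" using \<mu> by simp
    qed
    then have "?u (\<beta> j) = 0"
      using fnv.independentD[OF indep[folded im] _ subset_refl, of ?u "\<beta> j"] j by simp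
    then show "\<mu> j = 0" using j by (simp add: inv_beta)
  qed (rule that)
  ultimately show ?thesis
    unfolding is_free_basis_def w_def[symmetric]
  proof (intro conjI allI impI ballI)
    show "w j \<in> omega_stalk L R" if "j < r" for j
      unfolding w_def using xR choicesD(1)[OF \<phi> that] by (intro omega_stalkI[OF D(2)]) auto
    show "\<exists>c. (\<forall>j<r. c j \<in> R) \<and> \<eta> = (\<lambda>\<delta>. \<Sum>j<r. c j * w j \<delta>)" if "\<eta> \<in> omega_stalk L R" for \<eta>
      using that \<open>omega_stalk L R \<subseteq> _\<close> by (intro submodule_span_combination[OF D(2)]) auto
    fix c i assume c: "(\<forall>j<r. c j \<in> R) \<and> (\<forall>\<delta>. (\<Sum>j<r. c j * w j \<delta>) = 0)" and i: "i < r"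
    \<comment> \<open>The derivation of the dual vector \<open>s i\<close> kills every
      \<open>x (\<phi> j)\<close> with \<open>j\<close> different from \<open>i\<close> and so
      isolates the coefficient \<open>c i\<close>.\<close>
    obtain \<delta> where \<delta>: "acts_as_derivation emb n x \<alpha> (s i) \<delta>" "\<delta> \<in> L"
      by (rule foliation_derivation_exists)
    have "w j \<delta> = (if j = i then x (\<phi> i) else 0)" if "j < r" for j
    proof -
      have "\<delta> (x (\<phi> j)) = emb (\<beta> j (s i)) * x (\<phi> j)"
        using \<delta>(1) choicesD[OF \<phi> that] by (auto simp: acts_as_derivation_def)
      then show ?thesis using \<delta>(2) s[OF that i] by (auto simp: w_def differential_def)
    qed
    then have "(\<Sum>j<r. c j * w j \<delta>) = (\<Sum>j<r. if j = i then c j * x (\<phi> i) else 0)"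
      by (intro sum.cong) auto
    then have "c i * x (\<phi> i) = 0" using c i by simp
    then show "c i = 0" using choicesD(1)[OF \<phi> i] by simp
  qed
qed

lemma nonsingular_X: "nonsingular_foliation L r X"
  unfolding nonsingular_foliation_def
proof
  fix R assume "R \<in> X"
  then obtain \<phi> where \<phi>: "\<phi> \<in> choices" "R \<in> local_rings (A \<phi>)" by (rule X_cases)
  \<comment> \<open>These finitely many ratios cut out the open neighborhood of \<open>R\<close> on
    which the basis belonging to \<phi> can be used.\<close>
  define G where "G = (\<lambda>(i, j). x i / x (\<phi> j)) ` {(i, j). i < n \<and> j < r \<and> \<alpha> i = \<beta> j}"
  have fin: "finite G"
    unfolding G_def by (rule finite_imageI, rule finite_subset[of _ "{..<n} \<times> {..<r}"]) auto
  have "G \<subseteq> R"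
    using ratio_in_chart[OF \<phi>(1)] local_ringsD(3)[OF k_subalgebra_chart \<phi>(2)] by (auto simp: G_def)
  moreover have "zariski_open X {R' \<in> X. G \<subseteq> R'}"
    unfolding zariski_open_def using fin by auto
  moreover have "is_free_basis R' (omega_stalk L R') r (\<lambda>j. differential L (x (\<phi> j)))"
    if "R' \<in> {R' \<in> X. G \<subseteq> R'}" for R'
    using that by (intro free_basis[OF \<phi>(1)]) (auto simp: G_def)
  ultimately show "\<exists>U w. zariski_open X U \<and> R \<in> U \<and> (\<forall>R'\<in>U. is_free_basis R' (omega_stalk L R') r w)"
    using \<open>R \<in> X\<close> by (intro exI[of _ "{R' \<in> X. G \<subseteq> R'}"] exI[of _ "\<lambda>j. differential L (x (\<phi> j))"]) blast
qed

lemma resolvable: "torically_resolvable emb n x L r"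
  using toric_variety_X locally_projective_X nonsingular_X by (auto simp: torically_resolvable_def)

end

lemma (in toral_foliation) basis_imp_resolvable:
  assumes "is_basis_of (\<lambda>c f s. c * f s) (\<alpha> ` {..<n} - {0}) (dual_space scaleG)"
  shows "torically_resolvable emb n x L r"
proof -
  let ?D = "\<alpha> ` {..<n} - {0}"
  have D: "fnv.independent ?D" "fnv.span ?D = dual_space scaleG"
    using assms by (auto simp: is_basis_of_def)
  have "card ?D = r" using G.dual_space_basis_card[OF D] dim by simp
  then obtain \<beta> where "bij_betw \<beta> {..<r} ?D"
    using ex_bij_betw_nat_finite[of ?D] by (auto simp: atLeast0LessThan)
  then interpret basis_foliation emb n x scaleG BG \<alpha> r \<beta>
    by unfold_locales (use D in auto)
  show ?thesis by (rule resolvable)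
qed

theorem corollary6:
  fixes scaleG :: "'k::field_char_0 \<Rightarrow> 'g::ab_group_add \<Rightarrow> 'g"
    and bracket :: "'g \<Rightarrow> 'g \<Rightarrow> 'g"
    and BG :: "'g set" and r :: nat
    and scaleV :: "'k \<Rightarrow> 'v::ab_group_add \<Rightarrow> 'v"
    and BV :: "'v set"
    and \<rho> :: "'g \<Rightarrow> 'v \<Rightarrow> 'v"
    and n :: nat
    and \<xi> :: "nat \<Rightarrow> 'v \<Rightarrow> 'k"
    and \<alpha> :: "nat \<Rightarrow> 'g \<Rightarrow> 'k"
    and emb :: "'k \<Rightarrow> 'K::field"
    and x :: "nat \<Rightarrow> 'K"
  assumes G_lie: "commutative_lie_algebra scaleG bracket"
    and G_dim: "finite_dimensional_vector_space scaleG BG" "card BG = r"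
    and V_dim: "finite_dimensional_vector_space scaleV BV"
    and V_rep: "lie_representation scaleG bracket scaleV \<rho>"
    and V_faithful: "faithful \<rho>"
    and V_split: "split_semisimple scaleV \<rho>"
    and coords: "linear_coordinates scaleV n \<xi>"
    and roots: "\<And>i. i < n \<Longrightarrow> \<alpha> i \<in> dual_space scaleG"
    and eigen: "\<And>i s v. i < n \<Longrightarrow> \<xi> i (\<rho> s v) = \<alpha> i s * \<xi> i v"
    and function_field: "rational_function_field emb n x"
  shows "torically_resolvable emb n x (foliation emb n x \<alpha>) r \<longleftrightarrow>
         is_basis_of (\<lambda>c f s. c * f s) (\<alpha> ` {..<n} - {0}) (dual_space scaleG)"
proof -
  interpret G: finite_dimensional_vector_space scaleG BG by (rule G_dim(1))
  interpret toral_foliation emb n x scaleG BG \<alpha> r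
  proof
    show "field_embedding emb" using function_field by (simp add: rational_function_field_def)
  qed (fact function_field roots G_dim(2))+
  show ?thesis using resolvable_imp_basis basis_imp_resolvable by blast
qed

end
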